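(* Let $f,g:[0,1]\to\mathbb{R}$ with $f',g'\in BV$, and let $F=F(I(f))\in\mathcal{WA}$ and $G=G(I(g))\in\mathcal{WA}$ be Wick-analytic functionals of the single Wiener integrals $I(f)$ and $I(g)$, respectively. Then $$\lim_{n\to\infty}n^2\,\mathbb{E}\big[(F-\widehat{F}^n)(G-\widehat{G}^n)\big]=\frac1{12}\langle f',g'\rangle\,\mathbb{E}\big[F'(I(f))\,G'(I(g))\big].$$
   Context: Setting: $(W_t)_{t\in[0,1]}$ is a Brownian motion on $(\Omega,\mathcal{F},P)$, where $\mathcal{F}$ is generated by $W$ and completed by null sets. $L^2=L^2([0,1];\mathbb{R})$ has norm $\|\cdot\|$ and inner product $\langle\cdot,\cdot\rangle$; $L^2(\Omega)=L^2(\Omega,\mathcal{F},P)$. For $f\in L^2$, $I(f)=\int_0^1 f(s)\,dW_s$ is the Wiener integral. "$f'\in BV$" means: $f\in L^2$ is differentiable on $[0,1]$ and $f':[0,1]\to\mathbb{R}$ is of bounded variation. Optimal approximation: for $X\in L^2(\Omega)$, $\widehat{X}^n:=\mathbb{E}[X\mid W_{1/n},W_{2/n},\ldots,W_1]$. Wick exponential: $e^{\diamond I(g)}:=\exp(I(g)-\|g\|^2/2)$, $g\in L^2$. Wick product: $X\diamond Y$ is the element of $L^2(\Omega)$ (when it exists) with $\mathbb{E}[(X\diamond Y)e^{\diamond I(g)}]=\mathbb{E}[Xe^{\diamond I(g)}]\,\mathbb{E}[Ye^{\diamond I(g)}]$ for all $g\in L^2$ (these values determine an element of $L^2(\Omega)$).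 $X^{\diamond k}$ is the $k$-fold Wick power, $X^{\diamond0}=1$; one has $I(f)^{\diamond k}=h^k_{\|f\|^2}(I(f))$ with $h^k_{\|f\|^2}$ the monic Hermite polynomial of degree $k$ with variance parameter $\|f\|^2$. Wick-analytic functionals of one Wiener integral: $F(I(f))\in\mathcal{WA}$ means $F(I(f))=\sum_{k\ge0}a_kI(f)^{\diamond k}$ with real coefficients satisfying $\sup_{k\ge1}\sqrt[k]{k!\,|a_k|}<\infty$ (the series converges in $L^2(\Omega)$). Its derivative is $F'(I(f))=\sum_{k\ge0}(k+1)a_{k+1}I(f)^{\diamond k}$ (the ordinary derivative of $F$ evaluated at $I(f)$), which is again of this form. *)

theory Defs
  imports "HOL-Probability.Probability"
begin

section \<open>Square-integrable functions\<close>

text \<open>Elements of \<open>L\<^sup>2\<close> are represented by functions; equality in \<open>L\<^sup>2\<close> is almost-everywhere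
  equality.\<close>

definition L2 :: "'a measure \<Rightarrow> ('a \<Rightarrow> real) set" where
  "L2 M = {X \<in> borel_measurable M. integrable M (\<lambda>x. (X x)\<^sup>2)}"

definition L2_tendsto :: "'a measure \<Rightarrow> (nat \<Rightarrow> 'a \<Rightarrow> real) \<Rightarrow> ('a \<Rightarrow> real) \<Rightarrow> bool" where
  "L2_tendsto M X Y \<longleftrightarrow> (\<forall>n. X n \<in> L2 M) \<and> Y \<in> L2 M \<and>
     (\<lambda>n. \<integral>x. (X n x - Y x)\<^sup>2 \<partial>M) \<longlonglongrightarrow> 0"

definition L2_sums :: "'a measure \<Rightarrow> (nat \<Rightarrow> 'a \<Rightarrow> real) \<Rightarrow> ('a \<Rightarrow> real) \<Rightarrow> bool" where
  "L2_sums M X Y \<longleftrightarrow> L2_tendsto M (\<lambda>n x. \<Sum>k<n. X k x) Y"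

abbreviation unit_interval :: "real measure" where
  "unit_interval \<equiv> lebesgue_on {0..1}"

definition inner_L2 :: "(real \<Rightarrow> real) \<Rightarrow> (real \<Rightarrow> real) \<Rightarrow> real" where
  "inner_L2 f g = (\<integral>t. f t * g t \<partial>unit_interval)"


section \<open>Functions with a derivative of bounded variation\<close>

definition bounded_variation_on_unit :: "(real \<Rightarrow> real) \<Rightarrow> bool" where
  "bounded_variation_on_unit h \<longleftrightarrow>
     (\<exists>B. \<forall>n (t :: nat \<Rightarrow> real). mono_on {..n} t \<and> t ` {..n} \<subseteq> {0..1} \<longrightarrow>
        (\<Sum>i<n. \<bar>h (t (Suc i)) - h (t i)\<bar>) \<le> B)"

definition has_BV_derivative :: "(real \<Rightarrow> real) \<Rightarrow> (real \<Rightarrow> real) \<Rightarrow> bool" where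
  "has_BV_derivative f f' \<longleftrightarrow> f \<in> L2 unit_interval \<and>
     (\<forall>t\<in>{0..1}. (f has_real_derivative f' t) (at t within {0..1})) \<and>
     bounded_variation_on_unit f'"


section \<open>Brownian motion\<close>

definition generated_sigma :: "'a measure \<Rightarrow> (real \<Rightarrow> 'a \<Rightarrow> real) \<Rightarrow> real set \<Rightarrow> 'a measure" where
  "generated_sigma M W T =
     sigma (space M) {W t -` B \<inter> space M | t B. t \<in> T \<and> B \<in> sets borel}"

text \<open>The last assumption says that the \<open>\<sigma>\<close>-algebra of the probability space is the one generated
  by the Brownian motion, completed by null sets.\<close>

locale brownian_motion = prob_space M for M :: "'a measure" +
  fixes W :: "real \<Rightarrow> 'a \<Rightarrow> real"
  assumes W_measurable: "t \<in> {0..1} \<Longrightarrow> W t \<in> borel_measurable M"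
    and W_0: "AE \<omega> in M. W 0 \<omega> = 0"
    and W_indep_increments:
      "\<lbrakk>strict_mono_on {..n} \<tau>; \<tau> ` {..n} \<subseteq> {0..1}\<rbrakk> \<Longrightarrow>
        indep_vars (\<lambda>_. borel) (\<lambda>i \<omega>. W (\<tau> (Suc i)) \<omega> - W (\<tau> i) \<omega>) {..<n}"
    and W_normal_increments:
      "\<lbrakk>0 \<le> s; s < t; t \<le> 1\<rbrakk> \<Longrightarrow>
        distributed M lborel (\<lambda>\<omega>. W t \<omega> - W s \<omega>) (normal_density 0 (sqrt (t - s)))"
    and W_continuous: "AE \<omega> in M. continuous_on {0..1} (\<lambda>t. W t \<omega>)"
    and sets_eq_completion:
      "sets M = sets (completion (restr_to_subalg M (generated_sigma M W {0..1})))"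

definition optimal_approx ::
    "'a measure \<Rightarrow> (real \<Rightarrow> 'a \<Rightarrow> real) \<Rightarrow> nat \<Rightarrow> ('a \<Rightarrow> real) \<Rightarrow> 'a \<Rightarrow> real" where
  "optimal_approx M W n X =
     real_cond_exp M (generated_sigma M W ((\<lambda>i. real i / real n) ` {1..n})) X"


section \<open>The Wiener integral\<close>

definition step_fun :: "nat \<Rightarrow> (nat \<Rightarrow> real) \<Rightarrow> (nat \<Rightarrow> real) \<Rightarrow> real \<Rightarrow> real" where
  "step_fun N t c s = (\<Sum>i<N. c i * indicator {t i<..t (Suc i)} s)"

definition step_integral ::
    "(real \<Rightarrow> 'a \<Rightarrow> real) \<Rightarrow> nat \<Rightarrow> (nat \<Rightarrow> real) \<Rightarrow> (nat \<Rightarrow> real) \<Rightarrow> 'a \<Rightarrow> real" where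
  "step_integral W N t c \<omega> = (\<Sum>i<N. c i * (W (t (Suc i)) \<omega> - W (t i) \<omega>))"

text \<open>The continuous extension to \<open>L\<^sup>2\<close> of the elementary integral of step functions.\<close>

definition is_wiener_integral ::
    "'a measure \<Rightarrow> (real \<Rightarrow> 'a \<Rightarrow> real) \<Rightarrow> (real \<Rightarrow> real) \<Rightarrow> ('a \<Rightarrow> real) \<Rightarrow> bool" where
  "is_wiener_integral M W f X \<longleftrightarrow>
     (\<exists>N t c. (\<forall>m. mono_on {..N m} (t m) \<and> t m ` {..N m} \<subseteq> {0..1}) \<and>
        L2_tendsto unit_interval (\<lambda>m. step_fun (N m) (t m) (c m)) f \<and>
        L2_tendsto M (\<lambda>m. step_integral W (N m) (t m) (c m)) X)"

text \<open>Here and below, \<open>SOME\<close> picks a representative of an element of \<open>L\<^sup>2(\<Omega>)\<close> that is determined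
  only up to almost sure equality.\<close>

definition wiener_integral ::
    "'a measure \<Rightarrow> (real \<Rightarrow> 'a \<Rightarrow> real) \<Rightarrow> (real \<Rightarrow> real) \<Rightarrow> 'a \<Rightarrow> real" where
  "wiener_integral M W f = (SOME X. is_wiener_integral M W f X)"


section \<open>Wick calculus\<close>

definition wick_exp ::
    "'a measure \<Rightarrow> (real \<Rightarrow> 'a \<Rightarrow> real) \<Rightarrow> (real \<Rightarrow> real) \<Rightarrow> 'a \<Rightarrow> real" where
  "wick_exp M W g \<omega> = exp (wiener_integral M W g \<omega> - inner_L2 g g / 2)"

definition is_wick_product ::
    "'a measure \<Rightarrow> (real \<Rightarrow> 'a \<Rightarrow> real) \<Rightarrow> ('a \<Rightarrow> real) \<Rightarrow> ('a \<Rightarrow> real) \<Rightarrow> ('a \<Rightarrow> real) \<Rightarrow> bool" where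
  "is_wick_product M W X Y Z \<longleftrightarrow> Z \<in> L2 M \<and>
     (\<forall>g \<in> L2 unit_interval.
        (\<integral>\<omega>. Z \<omega> * wick_exp M W g \<omega> \<partial>M) =
        (\<integral>\<omega>. X \<omega> * wick_exp M W g \<omega> \<partial>M) * (\<integral>\<omega>. Y \<omega> * wick_exp M W g \<omega> \<partial>M))"

definition wick_product ::
    "'a measure \<Rightarrow> (real \<Rightarrow> 'a \<Rightarrow> real) \<Rightarrow> ('a \<Rightarrow> real) \<Rightarrow> ('a \<Rightarrow> real) \<Rightarrow> 'a \<Rightarrow> real" where
  "wick_product M W X Y = (SOME Z. is_wick_product M W X Y Z)"

primrec wick_power ::
    "'a measure \<Rightarrow> (real \<Rightarrow> 'a \<Rightarrow> real) \<Rightarrow> ('a \<Rightarrow> real) \<Rightarrow> nat \<Rightarrow> 'a \<Rightarrow> real" where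
  "wick_power M W X 0 = (\<lambda>_. 1)"
| "wick_power M W X (Suc k) = wick_product M W X (wick_power M W X k)"

definition wick_term ::
    "'a measure \<Rightarrow> (real \<Rightarrow> 'a \<Rightarrow> real) \<Rightarrow> (real \<Rightarrow> real) \<Rightarrow> (nat \<Rightarrow> real) \<Rightarrow> nat \<Rightarrow> 'a \<Rightarrow> real" where
  "wick_term M W f a k \<omega> = a k * wick_power M W (wiener_integral M W f) k \<omega>"

definition wick_analytic ::
    "'a measure \<Rightarrow> (real \<Rightarrow> 'a \<Rightarrow> real) \<Rightarrow> (real \<Rightarrow> real) \<Rightarrow> (nat \<Rightarrow> real) \<Rightarrow> ('a \<Rightarrow> real) \<Rightarrow> bool" where
  "wick_analytic M W f a F \<longleftrightarrow>
     bdd_above ((\<lambda>k. root k (fact k * \<bar>a k\<bar>)) ` {1..}) \<and> L2_sums M (wick_term M W f a) F"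

definition wick_derivative ::
    "'a measure \<Rightarrow> (real \<Rightarrow> 'a \<Rightarrow> real) \<Rightarrow> (real \<Rightarrow> real) \<Rightarrow> (nat \<Rightarrow> real) \<Rightarrow> 'a \<Rightarrow> real" where
  "wick_derivative M W f a =
     (SOME D. L2_sums M (wick_term M W f (\<lambda>k. real (k + 1) * a (k + 1))) D)"

end

theory Submission
  imports Defs
begin

text \<open>Expand \<open>F\<close> and \<open>G\<close> into Hermite polynomials of \<open>I(f)\<close> and \<open>I(g)\<close>. Conditioning on the grid replaces
  \<open>f\<close> by its \<open>L\<^sup>2\<close> projection \<open>f\<^sub>n\<close> onto the functions that are constant on the grid cells, that is,
  \<open>E[I(f)\<^sup>\<diamond>\<^sup>k | grid] = I(f\<^sub>n)\<^sup>\<diamond>\<^sup>k\<close>, because both sides pair in the same way with every Wick exponential of a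
  grid step function, and these are total in \<open>L\<^sup>2\<close> of the grid \<open>\<sigma>\<close>-algebra. By orthogonality of the
  Hermite polynomials the error equals \<open>p \<langle>f, g\<rangle> - p \<langle>f\<^sub>n, g\<^sub>n\<rangle>\<close> for the entire function
  \<open>p x = (\<Sum>k. k! a\<^sub>k b\<^sub>k x\<^sup>k)\<close>, whose derivative at \<open>\<langle>f, g\<rangle>\<close> is \<open>E[F' G']\<close>. It remains to expand
  \<open>\<langle>f, g\<rangle> - \<langle>f\<^sub>n, g\<^sub>n\<rangle>\<close>: on a cell of length \<open>h\<close> at \<open>t\<close>, the covariance of the affine parts is
  \<open>f' t * g' t * h\<^sup>3 / 12\<close>, and bounded variation of the derivatives makes the remainders sum to \<open>O(h\<^sup>3)\<close>.

  All Hermite identities come from one device: if \<open>Y exp (s X)\<close> is integrable for every \<open>s\<close>, then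
  \<open>E[Y exp (s X)]\<close> is a power series in \<open>s\<close> with the moments \<open>E[Y X\<^sup>k]\<close> as coefficients.\<close>

section \<open>The space of square-integrable functions\<close>

text \<open>Wiener integrals, Wick products and derivative series are selected by
  \<open>SOME\<close>, so their values cannot be computed directly. The argument works with
  characterising relations instead: \<open>wiener_pair\<close> for Wiener integrals, the pairing
  with \<open>wick_exp\<close> for Wick powers, L2 limits for series. For each of them existence
  makes the selection meaningful and almost sure uniqueness makes it harmless; for Wick products
  uniqueness rests on the assumption that the events are those generated by \<open>W\<close>,
  completed by null sets. The constant 1/12 is the variance of the uniform distribution on an
  interval of length one: on a cell of length h, subtracting the product of the means leaves h times
  a covariance under the uniform law, and linear functions contribute their slopes times h^2/12.
  With derivatives merely of bounded variation, the remainder on a single cell is governed by the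
  oscillation of the derivative there. No rate is claimed for one cell; only the sum of the
  oscillations over all cells is bounded, uniformly in n. After scaling by n^2 each cell error
  carries a factor 1/n besides its oscillation, which gives a total error of order 1/n.\<close>

lemma L2_measurable: "X \<in> L2 M \<Longrightarrow> X \<in> borel_measurable M"
  by (simp add: L2_def)

lemma L2_integrable_square: "X \<in> L2 M \<Longrightarrow> integrable M (\<lambda>x. (X x)\<^sup>2)"
  by (simp add: L2_def)

lemma L2I: "X \<in> borel_measurable M \<Longrightarrow> integrable M (\<lambda>x. (X x)\<^sup>2) \<Longrightarrow> X \<in> L2 M"
  by (simp add: L2_def)

lemma L2_integrable_mult:
  assumes "X \<in> L2 M" "Y \<in> L2 M"
  shows "integrable M (\<lambda>x. X x * Y x)"
proof (rule Bochner_Integration.integrable_bound)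
  show "integrable M (\<lambda>x. (X x)\<^sup>2 + (Y x)\<^sup>2)"
    using assms by (intro Bochner_Integration.integrable_add L2_integrable_square)
  show "(\<lambda>x. X x * Y x) \<in> borel_measurable M"
    using assms[THEN L2_measurable] by measurable
  have "\<bar>u * v\<bar> \<le> u\<^sup>2 + v\<^sup>2" for u v :: real
  proof -
    have "2 * (\<bar>u\<bar> * \<bar>v\<bar>) \<le> u\<^sup>2 + v\<^sup>2"
      using sum_squares_bound[of "\<bar>u\<bar>" "\<bar>v\<bar>"] by (simp add: mult.assoc)
    moreover have "0 \<le> \<bar>u\<bar> * \<bar>v\<bar>" by simp
    ultimately show ?thesis unfolding abs_mult by linarith
  qed
  then show "AE x in M. norm (X x * Y x) \<le> norm ((X x)\<^sup>2 + (Y x)\<^sup>2)"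
    by (intro AE_I2) (simp add: abs_of_nonneg)
qed

lemma L2_cmult: "X \<in> L2 M \<Longrightarrow> (\<lambda>x. c * X x) \<in> L2 M" for c :: real
  by (auto simp: L2_def power_mult_distrib)

lemma L2_add: "X \<in> L2 M \<Longrightarrow> Y \<in> L2 M \<Longrightarrow> (\<lambda>x. X x + Y x) \<in> L2 M"
proof -
  assume *: "X \<in> L2 M" "Y \<in> L2 M"
  have "integrable M (\<lambda>x. (X x)\<^sup>2 + (Y x)\<^sup>2 + 2 * (X x * Y x))"
    using * by (intro Bochner_Integration.integrable_add L2_integrable_square
        integrable_mult_right L2_integrable_mult)
  moreover have "(\<lambda>x. (X x)\<^sup>2 + (Y x)\<^sup>2 + 2 * (X x * Y x)) = (\<lambda>x. (X x + Y x)\<^sup>2)"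
    by (simp add: power2_sum mult.assoc)
  ultimately show ?thesis using *[THEN L2_measurable] by (intro L2I) auto
qed

lemma L2_diff: "X \<in> L2 M \<Longrightarrow> Y \<in> L2 M \<Longrightarrow> (\<lambda>x. X x - Y x) \<in> L2 M"
  using L2_add[of X M "\<lambda>x. (-1) * Y x"] L2_cmult[of Y M "-1"] by simp

lemma L2_zero: "(\<lambda>_. 0) \<in> L2 M"
  by (simp add: L2_def)

lemma L2_sum: "(\<And>i. i \<in> I \<Longrightarrow> X i \<in> L2 M) \<Longrightarrow> (\<lambda>x. \<Sum>i\<in>I. X i x) \<in> L2 M"
  by (induction I rule: infinite_finite_induct) (auto intro: L2_zero L2_add)

lemma L2_cong_AE:
  assumes "X \<in> L2 M" "Y \<in> borel_measurable M" "AE x in M. X x = Y x"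
  shows "Y \<in> L2 M"
proof (rule L2I)
  show "integrable M (\<lambda>x. (Y x)\<^sup>2)"
    by (rule integrable_cong_AE_imp[OF L2_integrable_square[OF assms(1)]]) (use assms in auto)
qed (rule assms)

text \<open>The algebraic core of Cauchy-Schwarz. The value at the minimiser \<open>b / a\<close>
  gives the claim; a vanishing leading coefficient is treated separately, because the first function
  may be null.\<close>

lemma quadratic_nonneg_imp_discriminant:
  fixes a b c :: real
  assumes "\<And>t. 0 \<le> a * t\<^sup>2 - 2 * b * t + c" "0 \<le> a"
  shows "b\<^sup>2 \<le> a * c"
proof (cases "a = 0")
  case True
  have "b = 0"
  proof (rule ccontr)
    assume "b \<noteq> 0"
    \<comment> \<open>For \<open>a = 0\<close> the expression is affine in \<open>t\<close>, and at
      this point it equals -1.\<close>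
    with assms(1)[of "(c + 1) / (2 * b)"] True show False by simp
  qed
  then show ?thesis using True by simp
next
  case False
  with assms(2) have "a > 0" by simp
  with assms(1)[of "b / a"] show ?thesis
    by (simp add: power2_eq_square field_simps)
qed

lemma L2_Cauchy_Schwarz:
  assumes "X \<in> L2 M" "Y \<in> L2 M"
  shows "(\<integral>x. X x * Y x \<partial>M)\<^sup>2 \<le> (\<integral>x. (X x)\<^sup>2 \<partial>M) * (\<integral>x. (Y x)\<^sup>2 \<partial>M)"
proof (rule quadratic_nonneg_imp_discriminant)
  fix t :: real
  have "0 \<le> (\<integral>x. (t * X x - Y x)\<^sup>2 \<partial>M)" by simp
  also have "(\<lambda>x. (t * X x - Y x)\<^sup>2) = (\<lambda>x. t\<^sup>2 * (X x)\<^sup>2 - 2 * t * (X x * Y x) + (Y x)\<^sup>2)"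
    by (simp add: power2_eq_square algebra_simps)
  also have "(\<integral>x. t\<^sup>2 * (X x)\<^sup>2 - 2 * t * (X x * Y x) + (Y x)\<^sup>2 \<partial>M) =
      t\<^sup>2 * (\<integral>x. (X x)\<^sup>2 \<partial>M) - 2 * t * (\<integral>x. X x * Y x \<partial>M) + (\<integral>x. (Y x)\<^sup>2 \<partial>M)"
    using assms by (simp add: L2_integrable_square L2_integrable_mult)
  finally show "0 \<le> (\<integral>x. (X x)\<^sup>2 \<partial>M) * t\<^sup>2 - 2 * (\<integral>x. X x * Y x \<partial>M) * t + (\<integral>x. (Y x)\<^sup>2 \<partial>M)"
    by (simp add: algebra_simps)
qed simp

text \<open>Expanding both factors around their limits leaves the limit and three products that each
  contain a null sequence, so Cauchy-Schwarz applies to each of them. This is the only passage to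
  the limit needed for expectations of products.\<close>

lemma L2_tendsto_inner:
  assumes "L2_tendsto M X X'" "L2_tendsto M Y Y'"
  shows "(\<lambda>n. \<integral>x. X n x * Y n x \<partial>M) \<longlonglongrightarrow> (\<integral>x. X' x * Y' x \<partial>M)"
proof -
  note X = assms(1)[unfolded L2_tendsto_def] and Y = assms(2)[unfolded L2_tendsto_def]
  have null: "(\<lambda>n. \<integral>x. U n x * V n x \<partial>M) \<longlonglongrightarrow> 0"
    if "\<And>n. U n \<in> L2 M" "\<And>n. V n \<in> L2 M"
       "(\<lambda>n. (\<integral>x. (U n x)\<^sup>2 \<partial>M) * (\<integral>x. (V n x)\<^sup>2 \<partial>M)) \<longlonglongrightarrow> 0" for U V
  proof -
    have "(\<lambda>n. (\<integral>x. U n x * V n x \<partial>M)\<^sup>2) \<longlonglongrightarrow> 0"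
      by (rule tendsto_sandwich[OF always_eventually always_eventually tendsto_const that(3)])
        (auto intro: L2_Cauchy_Schwarz[OF that(1) that(2)])
    then show ?thesis by simp
  qed
  have *: "(\<integral>x. X n x * Y n x \<partial>M) = (\<integral>x. X' x * Y' x \<partial>M) + (\<integral>x. X' x * (Y n x - Y' x) \<partial>M) +
      (\<integral>x. (X n x - X' x) * Y' x \<partial>M) + (\<integral>x. (X n x - X' x) * (Y n x - Y' x) \<partial>M)" for n
  proof -
    have "(\<lambda>x. X n x * Y n x) = (\<lambda>x. X' x * Y' x + X' x * (Y n x - Y' x) + (X n x - X' x) * Y' x
        + (X n x - X' x) * (Y n x - Y' x))" by (simp add: algebra_simps)
    then show ?thesis using X Y by (simp add: L2_integrable_mult L2_diff)
  qed
  have "(\<lambda>n. \<integral>x. X' x * (Y n x - Y' x) \<partial>M) \<longlonglongrightarrow> 0"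
    by (rule null) (use X Y in \<open>auto intro: L2_diff tendsto_mult_right_zero\<close>)
  moreover have "(\<lambda>n. \<integral>x. (X n x - X' x) * Y' x \<partial>M) \<longlonglongrightarrow> 0"
    by (rule null) (use X Y in \<open>auto intro: L2_diff tendsto_mult_left_zero\<close>)
  moreover have "(\<lambda>n. \<integral>x. (X n x - X' x) * (Y n x - Y' x) \<partial>M) \<longlonglongrightarrow> 0"
    by (rule null) (use X Y in \<open>auto intro: L2_diff tendsto_mult_zero\<close>)
  ultimately show ?thesis unfolding * by (auto intro!: tendsto_eq_intros)
qed

lemma L2_tendsto_const: "X \<in> L2 M \<Longrightarrow> L2_tendsto M (\<lambda>_. X) X"
  by (simp add: L2_tendsto_def)

lemma L2_tendsto_cmult:
  assumes "L2_tendsto M X X'"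
  shows "L2_tendsto M (\<lambda>n x. c * X n x) (\<lambda>x. c * X' x)"
proof -
  have "(\<integral>x. (c * X n x - c * X' x)\<^sup>2 \<partial>M) = c\<^sup>2 * (\<integral>x. (X n x - X' x)\<^sup>2 \<partial>M)" for n
    by (subst integral_mult_right_zero[symmetric])
      (simp add: power_mult_distrib flip: right_diff_distrib)
  then show ?thesis
    using assms unfolding L2_tendsto_def by (auto intro: L2_cmult tendsto_mult_right_zero)
qed

text \<open>A substitute for the triangle inequality in squared form; the constant 2 is harmless in
  all limits and avoids taking roots.\<close>

lemma L2_integral_square_add_le:
  assumes "X \<in> L2 M" "Y \<in> L2 M"
  shows "(\<integral>x. (X x + Y x)\<^sup>2 \<partial>M) \<le> 2 * (\<integral>x. (X x)\<^sup>2 \<partial>M) + 2 * (\<integral>x. (Y x)\<^sup>2 \<partial>M)"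
proof -
  have "(\<integral>x. (X x + Y x)\<^sup>2 \<partial>M) \<le> (\<integral>x. 2 * (X x)\<^sup>2 + 2 * (Y x)\<^sup>2 \<partial>M)"
  proof (rule integral_mono)
    show "(X x + Y x)\<^sup>2 \<le> 2 * (X x)\<^sup>2 + 2 * (Y x)\<^sup>2" for x
      using sum_squares_bound[of "X x" "Y x"] by (simp add: power2_sum)
  qed (use assms in \<open>auto intro!: L2_integrable_square L2_add\<close>)
  then show ?thesis using assms by (simp add: L2_integrable_square)
qed

lemma L2_tendsto_add:
  assumes "L2_tendsto M X X'" "L2_tendsto M Y Y'"
  shows "L2_tendsto M (\<lambda>n x. X n x + Y n x) (\<lambda>x. X' x + Y' x)"
  unfolding L2_tendsto_def
proof (intro conjI allI)
  note X = assms(1)[unfolded L2_tendsto_def] and Y = assms(2)[unfolded L2_tendsto_def]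
  show "(\<lambda>x. X n x + Y n x) \<in> L2 M" for n using X Y by (auto intro: L2_add)
  show "(\<lambda>x. X' x + Y' x) \<in> L2 M" using X Y by (auto intro: L2_add)
  show "(\<lambda>n. \<integral>x. (X n x + Y n x - (X' x + Y' x))\<^sup>2 \<partial>M) \<longlonglongrightarrow> 0"
  proof (rule tendsto_sandwich[OF always_eventually always_eventually tendsto_const])
    show "\<forall>n. (\<integral>x. (X n x + Y n x - (X' x + Y' x))\<^sup>2 \<partial>M)
      \<le> 2 * (\<integral>x. (X n x - X' x)\<^sup>2 \<partial>M) + 2 * (\<integral>x. (Y n x - Y' x)\<^sup>2 \<partial>M)"
      using L2_integral_square_add_le[OF L2_diff L2_diff, of "X _" M X' "Y _" Y'] X Y
      by (simp add: algebra_simps)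
    show "(\<lambda>n. 2 * (\<integral>x. (X n x - X' x)\<^sup>2 \<partial>M) + 2 * (\<integral>x. (Y n x - Y' x)\<^sup>2 \<partial>M)) \<longlonglongrightarrow> 0"
      using X Y by (auto intro!: tendsto_eq_intros)
  qed simp
qed

lemma L2_tendsto_diff:
  assumes "L2_tendsto M X X'" "L2_tendsto M Y Y'"
  shows "L2_tendsto M (\<lambda>n x. X n x - Y n x) (\<lambda>x. X' x - Y' x)"
  using L2_tendsto_add[OF assms(1) L2_tendsto_cmult[OF assms(2), of "-1"]] by simp

lemma L2_tendsto_cong_AE:
  assumes "L2_tendsto M X X'"
    and "\<And>n. Y n \<in> borel_measurable M" "Y' \<in> borel_measurable M"
    and "\<And>n. AE x in M. X n x = Y n x" "AE x in M. X' x = Y' x"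
  shows "L2_tendsto M Y Y'"
proof -
  note X = assms(1)[unfolded L2_tendsto_def]
  have [measurable]: "X n \<in> borel_measurable M" "X' \<in> borel_measurable M" for n
    using X L2_measurable by auto
  note [measurable] = assms(2,3)
  have "(\<integral>x. (X n x - X' x)\<^sup>2 \<partial>M) = (\<integral>x. (Y n x - Y' x)\<^sup>2 \<partial>M)" for n
    using assms(4)[of n] assms(5) by (intro integral_cong_AE) auto
  then show ?thesis
    using X L2_cong_AE[OF _ assms(2,4)] L2_cong_AE[OF _ assms(3,5)]
    unfolding L2_tendsto_def by auto
qed

text \<open>Fatou's lemma is applied to extended nonnegative integrals, which are meaningful before
  \<open>v\<close> is known to be integrable. The finite bound then yields integrability and the
  estimate together.\<close>

lemma Fatou_real:
  fixes u :: "nat \<Rightarrow> 'a \<Rightarrow> real"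
  assumes int: "\<And>n. integrable M (u n)" and nonneg: "\<And>n x. 0 \<le> u n x"
    and [measurable]: "v \<in> borel_measurable M"
    and lim: "AE x in M. (\<lambda>n. u n x) \<longlonglongrightarrow> v x"
    and bound: "eventually (\<lambda>n. (\<integral>x. u n x \<partial>M) \<le> C) sequentially"
  shows "integrable M v" "(\<integral>x. v x \<partial>M) \<le> C"
proof -
  have [measurable]: "u n \<in> borel_measurable M" for n using int by auto
  have "(\<integral>\<^sup>+x. ennreal (v x) \<partial>M) = (\<integral>\<^sup>+x. liminf (\<lambda>n. ennreal (u n x)) \<partial>M)"
    using lim by (intro nn_integral_cong_AE)
      (auto intro!: lim_imp_Liminf[OF sequentially_bot tendsto_ennrealI, symmetric] elim!: eventually_mono)
  also have "\<dots> \<le> liminf (\<lambda>n. \<integral>\<^sup>+x. ennreal (u n x) \<partial>M)"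
    by (rule nn_integral_liminf) auto
  also have "\<dots> \<le> ennreal C"
  proof -
    have "liminf (\<lambda>n. \<integral>\<^sup>+x. ennreal (u n x) \<partial>M) \<le> liminf (\<lambda>n. ennreal C)"
      using bound
      by (intro Liminf_mono) (auto elim!: eventually_mono simp: nn_integral_eq_integral int nonneg ennreal_leI)
    then show ?thesis by (simp add: Liminf_const)
  qed
  finally have le: "(\<integral>\<^sup>+x. ennreal (v x) \<partial>M) \<le> ennreal C" .
  have v: "AE x in M. 0 \<le> v x"
    using lim by eventually_elim (auto intro: LIMSEQ_le_const nonneg)
  obtain n where "(\<integral>x. u n x \<partial>M) \<le> C"
    using eventually_happens'[OF sequentially_bot bound] by blast
  moreover have "0 \<le> (\<integral>x. u n x \<partial>M)" by (simp add: nonneg)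
  ultimately have C: "0 \<le> C" by linarith
  show *: "integrable M v"
    using v le by (intro integrableI_nonneg) (auto simp: le_less_trans)
  show "(\<integral>x. v x \<partial>M) \<le> C"
    using le C by (simp add: nn_integral_eq_integral * v)
qed

section \<open>Almost sure subsequences and completeness of L2 on a probability space\<close>

lemma (in prob_space) L2_integrable:
  assumes "X \<in> L2 M" shows "integrable M X"
  using L2_integrable_mult[OF assms, of "\<lambda>_. 1"] by (simp add: L2_def)

lemma (in prob_space) L2_integral_abs_le:
  assumes "X \<in> L2 M"
  shows "(\<integral>x. \<bar>X x\<bar> \<partial>M) \<le> sqrt (\<integral>x. (X x)\<^sup>2 \<partial>M)"
proof -
  have "(\<lambda>x. \<bar>X x\<bar>) \<in> L2 M" using assms by (auto simp: L2_def)
  from L2_Cauchy_Schwarz[OF this, of "\<lambda>_. 1"] show ?thesis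
    by (intro real_le_rsqrt) (simp add: L2_def prob_space)
qed

lemma (in prob_space) L2_tendsto_AE_subseq:
  assumes "L2_tendsto M X Y"
  obtains r :: "nat \<Rightarrow> nat" where "strict_mono r" "AE x in M. (\<lambda>n. X (r n) x) \<longlonglongrightarrow> Y x"
proof -
  note * = assms[unfolded L2_tendsto_def]
  have "(\<lambda>n. \<integral>x. norm (X n x - Y x) \<partial>M) \<longlonglongrightarrow> 0"
  proof (rule tendsto_sandwich[OF always_eventually always_eventually tendsto_const])
    show "\<forall>n. (\<integral>x. norm (X n x - Y x) \<partial>M) \<le> sqrt (\<integral>x. (X n x - Y x)\<^sup>2 \<partial>M)"
      using * L2_integral_abs_le[OF L2_diff] by simp
    show "(\<lambda>n. sqrt (\<integral>x. (X n x - Y x)\<^sup>2 \<partial>M)) \<longlonglongrightarrow> 0"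
      using * tendsto_real_sqrt by fastforce
  qed simp
  moreover have "integrable M (\<lambda>x. X n x - Y x)" for n
    using * by (intro L2_integrable L2_diff) auto
  ultimately obtain r :: "nat \<Rightarrow> nat" where "strict_mono r"
      "AE x in M. (\<lambda>n. X (r n) x - Y x) \<longlonglongrightarrow> 0"
    using tendsto_L1_AE_subseq[of M "\<lambda>n x. X n x - Y x"] by auto
  then show ?thesis using that[of r] by (simp add: LIM_zero_iff)
qed

text \<open>The Riesz-Fischer argument: a rapidly converging subsequence has almost surely summable
  increments, hence a pointwise limit, and Fatou's lemma carries the Cauchy estimate over to that
  limit.\<close>

lemma (in prob_space) L2_complete:
  assumes X: "\<And>n. X n \<in> L2 M"
    and cauchy: "\<And>e. e > 0 \<Longrightarrow> \<exists>N. \<forall>m\<ge>N. \<forall>n\<ge>N. (\<integral>x. (X m x - X n x)\<^sup>2 \<partial>M) < e"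
  obtains Y where "L2_tendsto M X Y"
proof -
  note [measurable] = L2_measurable[OF X]
  \<comment> \<open>Squared distances below \<open>(1/4)^k\<close> make the L1 norms of the
    increments at most \<open>(1/2)^k\<close>, which is summable.\<close>
  have "\<exists>N. \<forall>k. (\<forall>m\<ge>N k. \<forall>n\<ge>N k. (\<integral>x. (X m x - X n x)\<^sup>2 \<partial>M) < (1/4)^k) \<and> N k < N (Suc k)"
  proof (rule dependent_nat_choice)
    show "\<exists>N. \<forall>m\<ge>N. \<forall>n\<ge>N. (\<integral>x. (X m x - X n x)\<^sup>2 \<partial>M) < (1/4)^0"
      by (rule cauchy) simp
    fix K k :: nat
    obtain N where N: "\<forall>m\<ge>N. \<forall>n\<ge>N. (\<integral>x. (X m x - X n x)\<^sup>2 \<partial>M) < (1/4)^Suc k"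
      using cauchy[of "(1/4)^Suc k"] by auto
    show "\<exists>y. (\<forall>m\<ge>y. \<forall>n\<ge>y. (\<integral>x. (X m x - X n x)\<^sup>2 \<partial>M) < (1/4)^Suc k) \<and> K < y"
      using N by (intro exI[of _ "max N (Suc K)"]) auto
  qed
  then obtain r where r: "\<And>k m n. m \<ge> r k \<Longrightarrow> n \<ge> r k \<Longrightarrow> (\<integral>x. (X m x - X n x)\<^sup>2 \<partial>M) < (1/4)^k"
    and r_mono: "strict_mono r" unfolding strict_mono_Suc_iff by blast
  define D where "D k x = X (r (Suc k)) x - X (r k) x" for k x
  have D: "D k \<in> L2 M" for k unfolding D_def by (intro L2_diff X)
  have [measurable]: "D k \<in> borel_measurable M" for k using D L2_measurable by auto
  have "(\<integral>x. \<bar>D k x\<bar> \<partial>M) \<le> (1/2)^k" for k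
  proof -
    have "(\<integral>x. \<bar>D k x\<bar> \<partial>M) \<le> sqrt (\<integral>x. (D k x)\<^sup>2 \<partial>M)" by (rule L2_integral_abs_le[OF D])
    also have "\<dots> \<le> sqrt ((1/4)^k)"
      using r[of k "r (Suc k)" "r k"] strict_mono_leD[OF r_mono, of k "Suc k"] by (simp add: D_def)
    also have "\<dots> = (1/2)^k"
      by (simp add: real_sqrt_power real_sqrt_divide)
    finally show ?thesis .
  qed
  then have nnD: "(\<integral>\<^sup>+x. ennreal \<bar>D k x\<bar> \<partial>M) \<le> ennreal ((1/2)^k)" for k
    using L2_integrable[OF D, of k] by (subst nn_integral_eq_integral) (auto intro: ennreal_leI)
  have "(\<integral>\<^sup>+x. (\<Sum>k. ennreal \<bar>D k x\<bar>) \<partial>M) = (\<Sum>k. \<integral>\<^sup>+x. ennreal \<bar>D k x\<bar> \<partial>M)"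
    by (rule nn_integral_suminf) simp
  also have "\<dots> \<le> (\<Sum>k. ennreal ((1/2)^k))"
    by (intro suminf_le nnD) auto
  also have "\<dots> = ennreal (\<Sum>k. (1/2)^k)"
    by (rule suminf_ennreal2) (auto intro: summable_geometric)
  finally have "(\<integral>\<^sup>+x. (\<Sum>k. ennreal \<bar>D k x\<bar>) \<partial>M) \<noteq> \<infinity>"
    by (metis ennreal_neq_top infinity_ennreal_def top_unique)
  then have "AE x in M. (\<Sum>k. ennreal \<bar>D k x\<bar>) \<noteq> \<infinity>"
    by (intro nn_integral_PInf_AE) auto
  then have conv: "AE x in M. convergent (\<lambda>k. X (r k) x)"
  proof eventually_elim
    case (elim x)
    then have "summable (\<lambda>k. \<bar>D k x\<bar>)" by (intro summable_suminf_not_top) auto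
    then have "summable (\<lambda>k. D k x)" by (rule summable_rabs_cancel)
    then have "convergent (\<lambda>n. \<Sum>k<n. D k x)" by (simp add: summable_iff_convergent)
    moreover have "(\<Sum>k<n. D k x) = X (r n) x - X (r 0) x" for n
      unfolding D_def by (rule sum_lessThan_telescope)
    ultimately have "convergent (\<lambda>n. X (r n) x - X (r 0) x)" by simp
    from convergent_add[OF this convergent_const[of "X (r 0) x"]] show ?case by simp
  qed
  define Y where "Y x = lim (\<lambda>k. X (r k) x)" for x
  have Y[measurable]: "Y \<in> borel_measurable M" unfolding Y_def by measurable
  have lim: "AE x in M. (\<lambda>k. X (r k) x) \<longlonglongrightarrow> Y x"
    using conv by eventually_elim (simp add: Y_def convergent_LIMSEQ_iff)
  \<comment> \<open>The index \<open>n\<close> stays fixed while the other index runs through the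
    subsequence, so the distance to the limit inherits the Cauchy bound for the whole
    sequence.\<close>
  have fat: "integrable M (\<lambda>x. (X n x - Y x)\<^sup>2) \<and> (\<integral>x. (X n x - Y x)\<^sup>2 \<partial>M) \<le> e"
    if N: "\<And>m n. m \<ge> N \<Longrightarrow> n \<ge> N \<Longrightarrow> (\<integral>x. (X m x - X n x)\<^sup>2 \<partial>M) < e" and "n \<ge> N" for n N e
  proof -
    have 1: "integrable M (\<lambda>x. (X n x - X (r k) x)\<^sup>2)" for k
      by (intro L2_integrable_square L2_diff X)
    have 2: "AE x in M. (\<lambda>k. (X n x - X (r k) x)\<^sup>2) \<longlonglongrightarrow> (X n x - Y x)\<^sup>2"
      using lim by eventually_elim (auto intro!: tendsto_intros)
    have "r k \<ge> N" if "k \<ge> N" for k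
      using that seq_suble[OF r_mono, of k] by linarith
    then have 3: "eventually (\<lambda>k. (\<integral>x. (X n x - X (r k) x)\<^sup>2 \<partial>M) \<le> e) sequentially"
      using N \<open>n \<ge> N\<close> unfolding eventually_sequentially by (meson less_imp_le)
    show ?thesis using Fatou_real[OF 1 _ _ 2 3] by auto
  qed
  have Y_L2: "Y \<in> L2 M"
  proof -
    obtain N where "\<forall>m\<ge>N. \<forall>n\<ge>N. (\<integral>x. (X m x - X n x)\<^sup>2 \<partial>M) < 1" using cauchy[of 1] by auto
    with fat[of N 1 N] have "(\<lambda>x. X N x - Y x) \<in> L2 M" by (intro L2I) auto
    from L2_diff[OF X[of N] this] show ?thesis by simp
  qed
  have "(\<lambda>n. \<integral>x. (X n x - Y x)\<^sup>2 \<partial>M) \<longlonglongrightarrow> 0"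
  proof (rule LIMSEQ_I)
    fix e :: real assume "e > 0"
    then obtain N where N: "\<forall>m\<ge>N. \<forall>n\<ge>N. (\<integral>x. (X m x - X n x)\<^sup>2 \<partial>M) < e / 2"
      using cauchy[of "e / 2"] by auto
    have "norm ((\<integral>x. (X n x - Y x)\<^sup>2 \<partial>M) - 0) < e" if "n \<ge> N" for n
      using fat[of N "e / 2" n] N that \<open>e > 0\<close> by auto
    then show "\<exists>N. \<forall>n\<ge>N. norm ((\<integral>x. (X n x - Y x)\<^sup>2 \<partial>M) - 0) < e" by blast
  qed
  then show ?thesis using that X Y_L2 by (auto simp: L2_tendsto_def)
qed

section \<open>Exponential moments\<close>

lemma exp_partial_sum_le:
  fixes x :: real
  assumes "0 \<le> x"
  shows "(\<Sum>k<n. x ^ k / fact k) \<le> exp x"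
proof -
  have "(\<Sum>k<n. x ^ k /\<^sub>R fact k) \<le> (\<Sum>k. x ^ k /\<^sub>R fact k)"
    by (rule sum_le_suminf) (use assms summable_exp_generic[of x] in auto)
  then show ?thesis by (simp add: exp_def field_simps)
qed

lemma power_div_fact_le_exp:
  fixes x :: real
  assumes "0 \<le> x"
  shows "x ^ k / fact k \<le> exp x"
proof -
  have "x ^ k / fact k \<le> (\<Sum>j<Suc k. x ^ j / fact j)"
    using assms by (intro member_le_sum) auto
  also have "\<dots> \<le> exp x" by (rule exp_partial_sum_le[OF assms])
  finally show ?thesis .
qed

lemma exp_abs_le: "exp \<bar>c * x\<bar> \<le> exp (c * x) + exp (- c * x)" for c x :: real
  by (cases "0 \<le> c * x") auto

text \<open>The constant coefficient is the limit of the sum at 0; dividing by \<open>s\<close> then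
  shifts the series, and the induction continues. The hypothesis leaves out \<open>s = 0\<close> so
  that it survives this division.\<close>

lemma powser_zero_imp_coeff_zero:
  fixes a :: "nat \<Rightarrow> real"
  assumes "\<And>s. s \<noteq> 0 \<Longrightarrow> (\<lambda>n. a n * s ^ n) sums 0"
  shows "a k = 0"
  using assms
proof (induction k arbitrary: a)
  case (0 a)
  have "((\<lambda>_. 0) \<longlongrightarrow> a 0) (at (0::real))"
    by (rule powser_limit_0_strong[of 1 a]) (use 0 in auto)
  then show ?case using tendsto_const tendsto_unique trivial_limit_at by metis
next
  case (Suc k a)
  have "((\<lambda>_. 0) \<longlongrightarrow> a 0) (at (0::real))"
    by (rule powser_limit_0_strong[of 1 a]) (use Suc.prems in auto)
  then have a0: "a 0 = 0" using tendsto_const tendsto_unique trivial_limit_at by metis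
  have "(\<lambda>n. a (Suc n) * s ^ n) sums 0" if "s \<noteq> 0" for s
  proof -
    have "(\<lambda>n. a (Suc n) * s ^ Suc n) sums 0"
      using Suc.prems[OF that] sums_Suc_iff[of "\<lambda>n. a n * s ^ n" 0] a0 by simp
    from sums_mult[OF this, of "1 / s"] show ?thesis using that by (simp add: field_simps)
  qed
  then show ?case by (rule Suc.IH)
qed

lemma powser_eq_imp_coeff_eq:
  fixes a b :: "nat \<Rightarrow> real"
  assumes "\<And>s. (\<lambda>n. a n * s ^ n) sums f s" "\<And>s. (\<lambda>n. b n * s ^ n) sums f s"
  shows "a k = b k"
proof -
  have "(\<lambda>n. (a n - b n) * s ^ n) sums 0" for s
    using sums_diff[OF assms(1)[of s] assms(2)[of s]] by (simp add: left_diff_distrib)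
  then show ?thesis using powser_zero_imp_coeff_zero[of "\<lambda>n. a n - b n" k] by simp
qed

text \<open>Exponents of both signs are available, so their sum dominates the exponential of the
  absolute value. The resulting function dominates all monomials and all partial sums of the
  exponential series at once.\<close>

lemma exp_moments_dominated:
  fixes X Y :: "'a \<Rightarrow> real"
  assumes [measurable]: "X \<in> borel_measurable M" "Y \<in> borel_measurable M"
    and int: "\<And>s. integrable M (\<lambda>\<omega>. Y \<omega> * exp (s * X \<omega>))"
  shows "integrable M (\<lambda>\<omega>. \<bar>Y \<omega>\<bar> * exp \<bar>c * X \<omega>\<bar>)"
proof (rule Bochner_Integration.integrable_bound)
  show "integrable M (\<lambda>\<omega>. \<bar>Y \<omega> * exp (c * X \<omega>)\<bar> + \<bar>Y \<omega> * exp (- c * X \<omega>)\<bar>)"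
    by (intro Bochner_Integration.integrable_add integrable_abs int)
  have "\<bar>y\<bar> * exp \<bar>c * x\<bar> \<le> \<bar>y * exp (c * x)\<bar> + \<bar>y * exp (- c * x)\<bar>" for x y
    using mult_left_mono[OF exp_abs_le[of c x], of "\<bar>y\<bar>"] by (simp add: abs_mult distrib_left)
  then show "AE \<omega> in M. norm (\<bar>Y \<omega>\<bar> * exp \<bar>c * X \<omega>\<bar>)
      \<le> norm (\<bar>Y \<omega> * exp (c * X \<omega>)\<bar> + \<bar>Y \<omega> * exp (- c * X \<omega>)\<bar>)"
    by (intro AE_I2) (simp add: abs_mult)
qed simp

lemma exp_moments_integrable:
  fixes X Y :: "'a \<Rightarrow> real"
  assumes [measurable]: "X \<in> borel_measurable M" "Y \<in> borel_measurable M"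
    and int: "\<And>s. integrable M (\<lambda>\<omega>. Y \<omega> * exp (s * X \<omega>))"
  shows "integrable M (\<lambda>\<omega>. Y \<omega> * X \<omega> ^ k)"
proof (rule Bochner_Integration.integrable_bound)
  show "integrable M (\<lambda>\<omega>. fact k * (\<bar>Y \<omega>\<bar> * exp \<bar>1 * X \<omega>\<bar>))"
    by (intro integrable_mult_right exp_moments_dominated assms)
  have "\<bar>y * x ^ k\<bar> \<le> fact k * (\<bar>y\<bar> * exp \<bar>x\<bar>)" for x y :: real
    using mult_left_mono[OF power_div_fact_le_exp[of "\<bar>x\<bar>" k], of "fact k * \<bar>y\<bar>"]
    by (simp add: abs_mult power_abs)
  then show "AE \<omega> in M. norm (Y \<omega> * X \<omega> ^ k) \<le> norm (fact k * (\<bar>Y \<omega>\<bar> * exp \<bar>1 * X \<omega>\<bar>))"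
    by (intro AE_I2) simp
qed simp

text \<open>Dominated convergence exchanges series and integral. The parameter is complex because
  the same moments must serve twice: real \<open>z\<close> gives the Laplace transform, imaginary
  \<open>z\<close> the characteristic function.\<close>

lemma exp_moments_sums:
  fixes X Y :: "'a \<Rightarrow> real" and z :: complex
  assumes [measurable]: "X \<in> borel_measurable M" "Y \<in> borel_measurable M"
    and int: "\<And>s. integrable M (\<lambda>\<omega>. Y \<omega> * exp (s * X \<omega>))"
  shows "(\<lambda>k. of_real (\<integral>\<omega>. Y \<omega> * X \<omega> ^ k \<partial>M) / fact k * z ^ k) sums
      (\<integral>\<omega>. of_real (Y \<omega>) * exp (z * of_real (X \<omega>)) \<partial>M)"
  unfolding sums_def
proof -
  let ?s = "\<lambda>n \<omega>. \<Sum>k<n. z ^ k / fact k * of_real (Y \<omega> * X \<omega> ^ k)"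
  have s: "(\<Sum>k<n. of_real (\<integral>\<omega>. Y \<omega> * X \<omega> ^ k \<partial>M) / fact k * z ^ k) = (\<integral>\<omega>. ?s n \<omega> \<partial>M)" for n
  proof -
    have "integrable M (\<lambda>\<omega>. z ^ k / fact k * of_real (Y \<omega> * X \<omega> ^ k))" for k
      using exp_moments_integrable[OF assms, of k]
      by (intro integrable_mult_right) (simp only: integrable_of_real)
    then have "(\<integral>\<omega>. ?s n \<omega> \<partial>M) = (\<Sum>k<n. \<integral>\<omega>. z ^ k / fact k * of_real (Y \<omega> * X \<omega> ^ k) \<partial>M)"
      by (intro Bochner_Integration.integral_sum) auto
    also have "\<dots> = (\<Sum>k<n. of_real (\<integral>\<omega>. Y \<omega> * X \<omega> ^ k \<partial>M) / fact k * z ^ k)"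
    proof (intro sum.cong refl)
      fix k
      have "(\<integral>\<omega>. z ^ k / fact k * of_real (Y \<omega> * X \<omega> ^ k) \<partial>M) =
          z ^ k / fact k * (\<integral>\<omega>. of_real (Y \<omega> * X \<omega> ^ k) \<partial>M)"
        by (rule integral_mult_right_zero)
      also have "(\<integral>\<omega>. complex_of_real (Y \<omega> * X \<omega> ^ k) \<partial>M) = of_real (\<integral>\<omega>. Y \<omega> * X \<omega> ^ k \<partial>M)"
        by (rule integral_of_real[OF exp_moments_integrable[OF assms]])
      finally show "(\<integral>\<omega>. z ^ k / fact k * of_real (Y \<omega> * X \<omega> ^ k) \<partial>M) =
          of_real (\<integral>\<omega>. Y \<omega> * X \<omega> ^ k \<partial>M) / fact k * z ^ k" by simp
    qed
    finally show ?thesis by simp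
  qed
  have "(\<lambda>n. \<integral>\<omega>. ?s n \<omega> \<partial>M) \<longlonglongrightarrow> (\<integral>\<omega>. of_real (Y \<omega>) * exp (z * of_real (X \<omega>)) \<partial>M)"
  proof (rule integral_dominated_convergence)
    show "integrable M (\<lambda>\<omega>. \<bar>Y \<omega>\<bar> * exp \<bar>cmod z * X \<omega>\<bar>)"
      by (rule exp_moments_dominated[OF assms])
    show "AE \<omega> in M. (\<lambda>n. ?s n \<omega>) \<longlonglongrightarrow> of_real (Y \<omega>) * exp (z * of_real (X \<omega>))"
    proof (rule AE_I2)
      fix \<omega>
      have "(\<lambda>k. of_real (Y \<omega>) * ((z * of_real (X \<omega>)) ^ k /\<^sub>R fact k)) sums
          (of_real (Y \<omega>) * exp (z * of_real (X \<omega>)))"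
        by (intro sums_mult exp_converges)
      then show "(\<lambda>n. ?s n \<omega>) \<longlonglongrightarrow> of_real (Y \<omega>) * exp (z * of_real (X \<omega>))"
        by (simp add: sums_def power_mult_distrib scaleR_conv_of_real field_simps)
    qed
    show "AE \<omega> in M. norm (?s n \<omega>) \<le> \<bar>Y \<omega>\<bar> * exp \<bar>cmod z * X \<omega>\<bar>" for n
    proof (rule AE_I2)
      fix \<omega>
      have "norm (?s n \<omega>) \<le> (\<Sum>k<n. norm (z ^ k / fact k * of_real (Y \<omega> * X \<omega> ^ k)))"
        by (rule norm_sum)
      also have "\<dots> = \<bar>Y \<omega>\<bar> * (\<Sum>k<n. \<bar>cmod z * X \<omega>\<bar> ^ k / fact k)"
        by (simp add: sum_distrib_left norm_mult norm_divide norm_power abs_mult power_mult_distrib ac_simps)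
      also have "\<dots> \<le> \<bar>Y \<omega>\<bar> * exp \<bar>cmod z * X \<omega>\<bar>"
        by (intro mult_left_mono exp_partial_sum_le) auto
      finally show "norm (?s n \<omega>) \<le> \<bar>Y \<omega>\<bar> * exp \<bar>cmod z * X \<omega>\<bar>" .
    qed
  qed measurable
  then show "(\<lambda>n. \<Sum>k<n. of_real (\<integral>\<omega>. Y \<omega> * X \<omega> ^ k \<partial>M) / fact k * z ^ k) \<longlonglongrightarrow>
      (\<integral>\<omega>. of_real (Y \<omega>) * exp (z * of_real (X \<omega>)) \<partial>M)"
    unfolding s .
qed

lemma exp_moments_sums_real:
  fixes X Y :: "'a \<Rightarrow> real"
  assumes "X \<in> borel_measurable M" "Y \<in> borel_measurable M"
    and "\<And>s. integrable M (\<lambda>\<omega>. Y \<omega> * exp (s * X \<omega>))"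
  shows "(\<lambda>k. (\<integral>\<omega>. Y \<omega> * X \<omega> ^ k \<partial>M) / fact k * s ^ k) sums (\<integral>\<omega>. Y \<omega> * exp (s * X \<omega>) \<partial>M)"
proof -
  have "(\<integral>\<omega>. of_real (Y \<omega>) * exp (of_real s * of_real (X \<omega>)) \<partial>M) =
      (\<integral>\<omega>. complex_of_real (Y \<omega> * exp (s * X \<omega>)) \<partial>M)"
    by (simp only: of_real_mult exp_of_real[symmetric])
  also have "\<dots> = of_real (\<integral>\<omega>. Y \<omega> * exp (s * X \<omega>) \<partial>M)"
    by (rule integral_of_real[OF assms(3)])
  finally show ?thesis
    using exp_moments_sums[OF assms, of "of_real s"]
    by (simp flip: sums_of_real_iff[where 'a = complex])
qed

section \<open>Uniqueness of the Laplace transform\<close>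

lemma integrable_mult_indicator_comp:
  fixes h X :: "'a \<Rightarrow> real"
  assumes h: "integrable M h" and [measurable]: "X \<in> borel_measurable M" "A \<in> sets borel"
  shows "integrable M (\<lambda>\<omega>. h \<omega> * indicator A (X \<omega>))"
  using h
proof (rule Bochner_Integration.integrable_bound)
  show "(\<lambda>\<omega>. h \<omega> * indicator A (X \<omega>)) \<in> borel_measurable M"
    using borel_measurable_integrable[OF h] by measurable
qed (auto simp: indicator_def)

lemma prob_space_density_divide:
  fixes p :: "'a \<Rightarrow> real"
  assumes "integrable M p" "\<And>\<omega>. 0 \<le> p \<omega>" "(\<integral>\<omega>. p \<omega> \<partial>M) = c" "0 < c"
  shows "prob_space (density M (\<lambda>\<omega>. ennreal (p \<omega> / c)))"
proof (rule prob_spaceI)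
  have "(\<integral>\<^sup>+\<omega>. ennreal (p \<omega> / c) \<partial>M) = ennreal (\<integral>\<omega>. p \<omega> / c \<partial>M)"
    using assms by (intro nn_integral_eq_integral) auto
  also have "\<dots> = 1" using assms by simp
  finally show "emeasure (density M (\<lambda>\<omega>. ennreal (p \<omega> / c)))
      (space (density M (\<lambda>\<omega>. ennreal (p \<omega> / c)))) = 1"
    using assms(1) by (subst emeasure_density) (auto cong: nn_integral_cong simp: borel_measurable_integrable)
qed

text \<open>A vanishing real Laplace transform kills every moment, and then the same series kills
  the transform at imaginary arguments. The positive and the negative part of \<open>Y\<close>, used
  as densities, therefore give \<open>X\<close> the same characteristic function, and Levy's
  uniqueness theorem identifies the two laws.\<close>

lemma laplace_transform_zero:
  fixes X Y :: "'a \<Rightarrow> real"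
  assumes [measurable]: "X \<in> borel_measurable M" "Y \<in> borel_measurable M"
    and int: "\<And>s. integrable M (\<lambda>\<omega>. Y \<omega> * exp (s * X \<omega>))"
    and zero: "\<And>s. (\<integral>\<omega>. Y \<omega> * exp (s * X \<omega>) \<partial>M) = 0"
    and [measurable]: "A \<in> sets borel"
  shows "(\<integral>\<omega>. Y \<omega> * indicator A (X \<omega>) \<partial>M) = 0"
proof -
  have "(\<integral>\<omega>. Y \<omega> * X \<omega> ^ k \<partial>M) / fact k = 0" for k
    using exp_moments_sums_real[OF assms(1-3)] zero
      powser_zero_imp_coeff_zero[of "\<lambda>k. (\<integral>\<omega>. Y \<omega> * X \<omega> ^ k \<partial>M) / fact k"] by simp
  then have char0: "(\<integral>\<omega>. of_real (Y \<omega>) * exp (z * of_real (X \<omega>)) \<partial>M) = 0" for z :: complex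
    using exp_moments_sums[OF assms(1-3), of z] sums_unique2[OF _ sums_zero] by simp
  have intY: "integrable M Y" using int[of 0] by simp
  \<comment> \<open>The transform at \<open>s = 0\<close> vanishes, so both parts have the same
    total mass \<open>c\<close>.\<close>
  define p q where "p \<omega> = max (Y \<omega>) 0" and "q \<omega> = max (- Y \<omega>) 0" for \<omega>
  have pq[measurable]: "integrable M p" "integrable M q" and Y: "Y \<omega> = p \<omega> - q \<omega>" for \<omega>
    using intY unfolding p_def[abs_def] q_def[abs_def] by auto
  have pos: "0 \<le> p \<omega>" "0 \<le> q \<omega>" for \<omega> by (auto simp: p_def q_def)
  define c where "c = (\<integral>\<omega>. p \<omega> \<partial>M)"
  have c': "c = (\<integral>\<omega>. q \<omega> \<partial>M)" using zero[of 0] pq by (simp add: c_def Y)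
  show ?thesis
  \<comment> \<open>Mass zero cannot be normalised to a probability measure; in that case
    \<open>Y\<close> vanishes almost everywhere.\<close>
  proof (cases "c = 0")
    case True
    then have "AE \<omega> in M. p \<omega> = 0" "AE \<omega> in M. q \<omega> = 0"
      using integral_nonneg_eq_0_iff_AE[OF pq(1)] integral_nonneg_eq_0_iff_AE[OF pq(2)] pos c_def c'
      by simp_all
    then have "AE \<omega> in M. Y \<omega> * indicator A (X \<omega>) = 0" by eventually_elim (simp add: Y)
    then show ?thesis by (rule integral_eq_zero_AE)
  next
    case False
    moreover have "0 \<le> c" using pos by (simp add: c_def)
    ultimately have c: "0 < c" by simp
    define P where "P r = density M (\<lambda>\<omega>. ennreal (r \<omega> / c))" for r
    have P: "prob_space (P p)" "prob_space (P q)" unfolding P_def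
      by (rule prob_space_density_divide; use pq pos c_def c' c in auto)+
    have meas[measurable]: "X \<in> borel_measurable (P r)" for r by (simp add: P_def)
    have distr: "real_distribution (distr (P p) borel X)" "real_distribution (distr (P q) borel X)"
      using P by (auto intro!: prob_space.real_distribution_distr)
    have int_P: "(\<integral>x. h x \<partial>distr (P r) borel X) = (\<integral>\<omega>. (r \<omega> / c) *\<^sub>R h (X \<omega>) \<partial>M)"
      if "r = p \<or> r = q" and [measurable]: "h \<in> borel_measurable borel"
      for r and h :: "real \<Rightarrow> 'c :: {banach, second_countable_topology}"
    proof -
      have "(\<integral>x. h x \<partial>distr (P r) borel X) = (\<integral>\<omega>. h (X \<omega>) \<partial>P r)"
        by (rule integral_distr) auto
      also have "\<dots> = (\<integral>\<omega>. (r \<omega> / c) *\<^sub>R h (X \<omega>) \<partial>M)"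
        unfolding P_def using that pos c pq by (intro integral_density) auto
      finally show ?thesis .
    qed
    have "char (distr (P p) borel X) = char (distr (P q) borel X)"
    proof
      fix t
      have i: "integrable M (\<lambda>\<omega>. (r \<omega> / c) *\<^sub>R iexp (t * X \<omega>))" if "r = p \<or> r = q" for r
      proof (rule Bochner_Integration.integrable_bound)
        show "integrable M (\<lambda>\<omega>. r \<omega> / c)" using that pq by auto
        show "(\<lambda>\<omega>. (r \<omega> / c) *\<^sub>R iexp (t * X \<omega>)) \<in> borel_measurable M"
          using that pq by (auto simp: borel_measurable_integrable)
      qed auto
      have "char (distr (P p) borel X) t - char (distr (P q) borel X) t =
          (\<integral>\<omega>. (p \<omega> / c) *\<^sub>R iexp (t * X \<omega>) \<partial>M) - (\<integral>\<omega>. (q \<omega> / c) *\<^sub>R iexp (t * X \<omega>) \<partial>M)"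
        unfolding char_def by (simp add: int_P)
      also have "\<dots> = (\<integral>\<omega>. (p \<omega> / c) *\<^sub>R iexp (t * X \<omega>) - (q \<omega> / c) *\<^sub>R iexp (t * X \<omega>) \<partial>M)"
        using i by simp
      also have "\<dots> = (\<integral>\<omega>. of_real (1 / c) * (of_real (Y \<omega>) * exp ((\<i> * of_real t) * of_real (X \<omega>))) \<partial>M)"
        by (intro Bochner_Integration.integral_cong refl)
          (simp add: Y scaleR_conv_of_real left_diff_distrib diff_divide_distrib mult_ac)
      also have "\<dots> = 0" using char0 by simp
      finally show "char (distr (P p) borel X) t = char (distr (P q) borel X) t" by simp
    qed
    then have "distr (P p) borel X = distr (P q) borel X"
      by (rule Levy_uniqueness[OF distr])
    then have "(\<integral>\<omega>. (p \<omega> / c) *\<^sub>R indicator A (X \<omega>) \<partial>M) = (\<integral>\<omega>. (q \<omega> / c) *\<^sub>R (indicator A (X \<omega>) :: real) \<partial>M)"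
      using int_P[of p "indicator A :: real \<Rightarrow> real"] int_P[of q "indicator A :: real \<Rightarrow> real"] by simp
    then have eq: "(\<integral>\<omega>. p \<omega> * indicator A (X \<omega>) \<partial>M) = (\<integral>\<omega>. q \<omega> * indicator A (X \<omega>) \<partial>M)"
      using c by simp
    have "integrable M (\<lambda>\<omega>. r \<omega> * indicator A (X \<omega>))" if "r = p \<or> r = q" for r
      using that pq by (auto intro: integrable_mult_indicator_comp)
    then show ?thesis using eq by (simp add: Y left_diff_distrib)
  qed
qed

section \<open>Functionals orthogonal to exponentials of a process\<close>

lemma sets_generated_sigma:
  "sets (generated_sigma M X T) = sigma_sets (space M) {X t -` B \<inter> space M | t B. t \<in> T \<and> B \<in> sets borel}"
  unfolding generated_sigma_def by (rule sets_measure_of) auto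

lemma space_generated_sigma [simp]: "space (generated_sigma M X T) = space M"
  unfolding generated_sigma_def by (rule space_measure_of) auto

lemma subalgebra_generated_sigma:
  assumes "\<And>t. t \<in> T \<Longrightarrow> X t \<in> borel_measurable M"
  shows "subalgebra M (generated_sigma M X T)"
  unfolding subalgebra_def sets_generated_sigma
  using assms by (auto intro!: sets.sigma_sets_subset measurable_sets)

lemma measurable_generated_sigma: "t \<in> T \<Longrightarrow> X t \<in> borel_measurable (generated_sigma M X T)"
  by (rule measurableI) (auto simp: sets_generated_sigma)

text \<open>Iterating the one-dimensional uniqueness theorem avoids a multivariate Laplace transform:
  the class \<open>V\<close> of exponents only has to be stable under adding multiples of each \<open>X t\<close>.\<close>

lemma exponential_orthogonal_imp_set_integral_zero:
  fixes X :: "real \<Rightarrow> 'a \<Rightarrow> real" and V :: "('a \<Rightarrow> real) set"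
  assumes Z[measurable]: "Z \<in> borel_measurable M"
    and X[measurable]: "\<And>t. t \<in> T \<Longrightarrow> X t \<in> borel_measurable M"
    and V: "\<And>v. v \<in> V \<Longrightarrow> v \<in> borel_measurable M" "(\<lambda>_. 0) \<in> V"
      "\<And>v t s. v \<in> V \<Longrightarrow> t \<in> T \<Longrightarrow> (\<lambda>\<omega>. v \<omega> + s * X t \<omega>) \<in> V"
    and int: "\<And>v. v \<in> V \<Longrightarrow> integrable M (\<lambda>\<omega>. Z \<omega> * exp (v \<omega>))"
    and zero: "\<And>v. v \<in> V \<Longrightarrow> (\<integral>\<omega>. Z \<omega> * exp (v \<omega>) \<partial>M) = 0"
    and B: "B \<in> sets (generated_sigma M X T)"
  shows "(LINT \<omega>:B|M. Z \<omega>) = 0"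
proof -
  let ?f = "\<lambda>S A v \<omega>. Z \<omega> * (\<Prod>t\<in>S. indicator (A t) (X t \<omega>)) * exp (v \<omega>)"
  have step: "integrable M (?f S A v) \<and> integral\<^sup>L M (?f S A v) = 0"
    if "finite S" "S \<subseteq> T" "v \<in> V" "\<And>t. t \<in> S \<Longrightarrow> A t \<in> sets borel" for S A v
    using that
  proof (induction S arbitrary: v rule: finite_induct)
    case empty
    then show ?case using int zero by simp
  next
    case (insert t S)
    have [measurable]: "X t \<in> borel_measurable M" "A t \<in> sets borel" "v \<in> borel_measurable M"
      using insert.prems X V by auto
    have [measurable]: "t' \<in> S \<Longrightarrow> X t' \<in> borel_measurable M" "t' \<in> S \<Longrightarrow> A t' \<in> sets borel" for t'
      using insert.prems X by auto
    have f: "?f S A v \<in> borel_measurable M" by measurable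
    have eq: "?f S A v \<omega> * exp (s * X t \<omega>) = ?f S A (\<lambda>\<omega>. v \<omega> + s * X t \<omega>) \<omega>" for s \<omega>
      by (simp add: exp_add)
    \<comment> \<open>The integrand with the indicators already inserted plays the part of
      \<open>Y\<close> in the one-dimensional theorem. Multiplying it by
      \<open>exp (s * X t \<omega>)\<close> only changes the exponent \<open>v\<close>, which is why
      the induction must run over arbitrary \<open>v\<close>.\<close>
    have IH: "integrable M (\<lambda>\<omega>. ?f S A v \<omega> * exp (s * X t \<omega>))"
        "(\<integral>\<omega>. ?f S A v \<omega> * exp (s * X t \<omega>) \<partial>M) = 0" for s
      unfolding eq using insert.IH[of "\<lambda>\<omega>. v \<omega> + s * X t \<omega>"] insert.prems V by auto
    have eq2: "?f (insert t S) A v = (\<lambda>\<omega>. ?f S A v \<omega> * indicator (A t) (X t \<omega>))"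
      using insert.hyps by (auto simp: mult_ac)
    have "integral\<^sup>L M (?f (insert t S) A v) = 0"
      unfolding eq2 by (rule laplace_transform_zero[OF _ f IH]) auto
    moreover have "integrable M (?f (insert t S) A v)"
      unfolding eq2 using IH(1)[of 0] by (intro integrable_mult_indicator_comp) simp_all
    ultimately show ?case by simp
  qed
  have intZ: "integrable M Z" using int[OF V(2)] by simp
  \<comment> \<open>The finite-dimensional cylinder sets: a generator stable under intersections, as
    Dynkin's theorem requires.\<close>
  define G where "G = {{\<omega> \<in> space M. \<forall>t\<in>S. X t \<omega> \<in> A t} | S A.
      finite S \<and> S \<subseteq> T \<and> (\<forall>t\<in>S. A t \<in> sets borel)}"
  have G_M: "G \<subseteq> sets M"
  proof
    fix C assume "C \<in> G"
    then obtain S A where C: "C = {\<omega> \<in> space M. \<forall>t\<in>S. X t \<omega> \<in> A t}" "finite S" "S \<subseteq> T"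
      "\<And>t. t \<in> S \<Longrightarrow> A t \<in> sets borel" unfolding G_def by blast
    show "C \<in> sets M" unfolding C(1)
      by (intro sets.sets_Collect_finite_All) (use C X in \<open>auto intro!: measurable_sets_borel\<close>)
  qed
  have basic: "(LINT \<omega>:C|M. Z \<omega>) = 0" if "C \<in> G" for C
  proof -
    obtain S A where C: "C = {\<omega> \<in> space M. \<forall>t\<in>S. X t \<omega> \<in> A t}" "finite S" "S \<subseteq> T"
      "\<And>t. t \<in> S \<Longrightarrow> A t \<in> sets borel" using \<open>C \<in> G\<close> unfolding G_def by blast
    have "indicator C \<omega> *\<^sub>R Z \<omega> = ?f S A (\<lambda>_. 0) \<omega>" if "\<omega> \<in> space M" for \<omega>
    proof -
      have "(\<Prod>t\<in>S. indicator (A t) (X t \<omega>)) = (indicator C \<omega> :: real)"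
        using C(1,2) that by (auto simp: indicator_def intro!: prod.neutral)
      then show ?thesis by simp
    qed
    then have "(LINT \<omega>:C|M. Z \<omega>) = integral\<^sup>L M (?f S A (\<lambda>_. 0))"
      unfolding set_lebesgue_integral_def by (intro Bochner_Integration.integral_cong) auto
    then show ?thesis using step[OF C(2,3) V(2), of A] C(4) by simp
  qed
  have stable: "Int_stable G"
  proof (rule Int_stableI)
    fix C D assume "C \<in> G" "D \<in> G"
    then obtain S A S' A' where C: "C = {\<omega> \<in> space M. \<forall>t\<in>S. X t \<omega> \<in> A t}" "finite S" "S \<subseteq> T"
        "\<And>t. t \<in> S \<Longrightarrow> A t \<in> sets borel"
      and D: "D = {\<omega> \<in> space M. \<forall>t\<in>S'. X t \<omega> \<in> A' t}" "finite S'" "S' \<subseteq> T"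
        "\<And>t. t \<in> S' \<Longrightarrow> A' t \<in> sets borel" unfolding G_def by blast
    \<comment> \<open>Each family is padded with \<open>UNIV\<close> outside its own index set, so
      both cylinders are described over the union of the index sets.\<close>
    define A'' where "A'' t = (if t \<in> S then A t else UNIV) \<inter> (if t \<in> S' then A' t else UNIV)" for t
    have "C \<inter> D = {\<omega> \<in> space M. \<forall>t\<in>S \<union> S'. X t \<omega> \<in> A'' t}"
      unfolding C(1) D(1) A''_def by auto
    moreover have "\<forall>t\<in>S \<union> S'. A'' t \<in> sets borel"
      using C(4) D(4) by (auto simp: A''_def)
    ultimately show "C \<inter> D \<in> G"
      unfolding G_def using C(2,3) D(2,3) by blast
  qed
  have "{X t -` B \<inter> space M | t B. t \<in> T \<and> B \<in> sets borel} \<subseteq> G"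
  proof clarify
    fix t B assume "t \<in> T" "B \<in> sets (borel :: real measure)"
    then show "X t -` B \<inter> space M \<in> G"
      unfolding G_def by (intro CollectI exI[of _ "{t}"] exI[of _ "\<lambda>_. B"]) auto
  qed
  then have "B \<in> sigma_sets (space M) G"
    using B sigma_sets_mono'[of _ G] unfolding sets_generated_sigma by blast
  moreover have G_Pow: "G \<subseteq> Pow (space M)" using G_M sets.sets_into_space by blast
  moreover have sig: "C \<in> sets M" if "C \<in> sigma_sets (space M) G" for C
    using sets.sigma_sets_subset[OF G_M] that by blast
  moreover have "space M \<in> G"
    unfolding G_def by (intro CollectI exI[of _ "{}"]) auto
  then have total: "(LINT \<omega>:space M|M. Z \<omega>) = 0" by (rule basic)
  have set_int: "set_integrable M C Z" if "C \<in> sets M" for C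
    unfolding set_integrable_def by (rule integrable_mult_indicator[OF that intZ])
  show ?thesis
    using stable \<open>G \<subseteq> Pow (space M)\<close> \<open>B \<in> sigma_sets (space M) G\<close>
  proof (induction rule: sigma_sets_induct_disjoint)
    case (basic C) then show ?case by (rule \<open>\<And>C. C \<in> G \<Longrightarrow> (LINT \<omega>:C|M. Z \<omega>) = 0\<close>)
  next
    case empty show ?case by (simp add: set_lebesgue_integral_def)
  next
    case (compl C)
    have C: "C \<in> sets M" using compl sig by blast
    have "(LINT \<omega>:C \<union> (space M - C)|M. Z \<omega>) = (LINT \<omega>:C|M. Z \<omega>) + (LINT \<omega>:space M - C|M. Z \<omega>)"
      by (rule set_integral_Un) (use C set_int in auto)
    moreover have "C \<union> (space M - C) = space M" using C sets.sets_into_space by blast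
    ultimately show ?case using compl total by simp
  next
    case (union A)
    have A: "A i \<in> sets M" for i using union(2) sig by blast
    then have UN: "(\<Union>i. A i) \<in> sets M" by blast
    have "(LINT \<omega>:(\<Union>i. A i)|M. Z \<omega>) = (\<Sum>i. LINT \<omega>:A i|M. Z \<omega>)"
      by (rule lebesgue_integral_countable_add)
        (use union(1) A UN set_int in \<open>auto simp: disjoint_family_on_def\<close>)
    then show ?case using union by simp
  qed
qed

section \<open>Hermite polynomials\<close>

text \<open>The Taylor coefficients in \<open>s\<close> of
  \<open>exp (- (s\<^sup>2 * v / 2))\<close>; odd powers do not occur.\<close>

definition hermite_coeff :: "real \<Rightarrow> nat \<Rightarrow> real" where
  "hermite_coeff v m = (if even m then (- v / 2) ^ (m div 2) / fact (m div 2) else 0)"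

text \<open>The monic Hermite polynomial with variance parameter \<open>v\<close>, divided by \<open>fact k\<close>: the coefficient
  of \<open>s ^ k\<close> in \<open>exp (s * x - s\<^sup>2 * v / 2)\<close>.\<close>

definition whermite :: "real \<Rightarrow> nat \<Rightarrow> real \<Rightarrow> real" where
  "whermite v k x = (\<Sum>i\<le>k. x ^ i / fact i * hermite_coeff v (k - i))"

lemma whermite_0: "whermite v 0 x = 1"
  by (simp add: whermite_def hermite_coeff_def)

lemma whermite_1: "whermite v (Suc 0) x = x"
  by (simp add: whermite_def hermite_coeff_def)

lemma measurable_whermite [measurable]: "whermite v k \<in> borel_measurable borel"
  unfolding whermite_def by measurable

lemma hermite_coeff_sums: "(\<lambda>m. hermite_coeff v m * s ^ m) sums exp (- (s\<^sup>2 * v / 2))"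
proof -
  have "(\<lambda>m. (- (s\<^sup>2 * v / 2)) ^ m /\<^sub>R fact m) sums exp (- (s\<^sup>2 * v / 2))"
    by (rule exp_converges)
  moreover have "hermite_coeff v (2 * m) * s ^ (2 * m) = (- (s\<^sup>2 * v / 2)) ^ m /\<^sub>R fact m" for m
  proof -
    have "- (s\<^sup>2 * v / 2) = (- v / 2) * s\<^sup>2" by simp
    moreover have "s ^ (2 * m) = (s\<^sup>2) ^ m" by (rule power_mult)
    ultimately show ?thesis by (simp only: power_mult_distrib) (simp add: hermite_coeff_def field_simps)
  qed
  ultimately have "(\<lambda>m. hermite_coeff v (2 * m) * s ^ (2 * m)) sums exp (- (s\<^sup>2 * v / 2))"
    by simp
  then show ?thesis
    by (subst (asm) sums_mono_reindex[of "\<lambda>m. 2 * m" "\<lambda>m. hermite_coeff v m * s ^ m"])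
      (auto simp: strict_mono_def hermite_coeff_def)
qed

text \<open>Convergence at a point of larger modulus, here \<open>\<bar>s\<bar> + 1\<close>, gives
  absolute convergence at \<open>s\<close>; this is what the Cauchy product asks for.\<close>

lemma hermite_coeff_abs_summable: "summable (\<lambda>m. norm (hermite_coeff v m * s ^ m))"
  by (rule powser_insidea[of _ "\<bar>s\<bar> + 1"]) (use hermite_coeff_sums sums_summable in auto)

text \<open>By its definition \<open>whermite\<close> is a Cauchy product coefficient, so its
  moments are obtained by multiplying the moment series by the series of the Gaussian factor. The
  weight \<open>Y\<close> is kept general: it is an exponential in one application and a Hermite
  polynomial in the next.\<close>

lemma
  fixes X Y :: "'a \<Rightarrow> real"
  assumes X: "X \<in> borel_measurable M" and Y: "Y \<in> borel_measurable M"
    and int: "\<And>s. integrable M (\<lambda>\<omega>. Y \<omega> * exp (s * X \<omega>))"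
  shows integrable_mult_whermite: "integrable M (\<lambda>\<omega>. Y \<omega> * whermite v k (X \<omega>))"
    and whermite_sums: "(\<lambda>k. (\<integral>\<omega>. Y \<omega> * whermite v k (X \<omega>) \<partial>M) * s ^ k) sums
      ((\<integral>\<omega>. Y \<omega> * exp (s * X \<omega>) \<partial>M) * exp (- (s\<^sup>2 * v / 2)))"
proof -
  define m where "m i = (\<integral>\<omega>. Y \<omega> * X \<omega> ^ i \<partial>M)" for i
  note mi = exp_moments_integrable[OF assms]
  have e: "Y \<omega> * whermite v k (X \<omega>) = (\<Sum>i\<le>k. (hermite_coeff v (k - i) / fact i) * (Y \<omega> * X \<omega> ^ i))" for \<omega> k
    by (simp add: whermite_def sum_distrib_left mult_ac)
  show "integrable M (\<lambda>\<omega>. Y \<omega> * whermite v k (X \<omega>))"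
    unfolding e by (intro Bochner_Integration.integrable_sum integrable_mult_right mi)
  have i: "(\<integral>\<omega>. Y \<omega> * whermite v k (X \<omega>) \<partial>M) = (\<Sum>i\<le>k. (hermite_coeff v (k - i) / fact i) * m i)" for k
    unfolding e m_def
    by (subst Bochner_Integration.integral_sum) (use mi in \<open>auto intro!: integrable_mult_right\<close>)
  have sums: "(\<lambda>k. m k / fact k * s ^ k) sums (\<integral>\<omega>. Y \<omega> * exp (s * X \<omega>) \<partial>M)" for s
    unfolding m_def by (rule exp_moments_sums_real[OF assms])
  have "summable (\<lambda>k. norm (m k / fact k * s ^ k))"
    by (rule powser_insidea[of _ "\<bar>s\<bar> + 1"]) (use sums sums_summable in auto)
  from Cauchy_product_sums[OF this hermite_coeff_abs_summable, of v s]
  have "(\<lambda>k. \<Sum>i\<le>k. m i / fact i * s ^ i * (hermite_coeff v (k - i) * s ^ (k - i))) sums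
    ((\<integral>\<omega>. Y \<omega> * exp (s * X \<omega>) \<partial>M) * exp (- (s\<^sup>2 * v / 2)))"
    using sums[of s] hermite_coeff_sums[of v s] by (simp add: sums_iff)
  moreover have "(\<Sum>i\<le>k. m i / fact i * s ^ i * (hermite_coeff v (k - i) * s ^ (k - i))) =
      (\<integral>\<omega>. Y \<omega> * whermite v k (X \<omega>) \<partial>M) * s ^ k" for k
  proof -
    have "m i / fact i * s ^ i * (hermite_coeff v (k - i) * s ^ (k - i)) =
        hermite_coeff v (k - i) / fact i * m i * s ^ k" if "i \<le> k" for i
    proof -
      have "s ^ k = s ^ i * s ^ (k - i)" using that by (simp flip: power_add)
      then show ?thesis by simp
    qed
    then show ?thesis unfolding i sum_distrib_right by (intro sum.cong) auto
  qed
  ultimately show "(\<lambda>k. (\<integral>\<omega>. Y \<omega> * whermite v k (X \<omega>) \<partial>M) * s ^ k) sums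
      ((\<integral>\<omega>. Y \<omega> * exp (s * X \<omega>) \<partial>M) * exp (- (s\<^sup>2 * v / 2)))"
    by simp
qed

section \<open>Density of step functions\<close>

lemma borel_measurable_unit_interval: "h \<in> borel_measurable borel \<Longrightarrow> h \<in> borel_measurable unit_interval"
  by (intro measurable_restrict_space1 measurable_completion) simp

lemma prob_space_unit_interval: "prob_space unit_interval"
  by (rule prob_spaceI) (simp add: emeasure_restrict_space space_restrict_space)

interpretation unit_interval: prob_space unit_interval
  by (rule prob_space_unit_interval)

lemma AE_unit_interval_neq: "AE s in unit_interval. s \<noteq> a"
proof -
  have "AE s in lebesgue. s \<noteq> a"
    by (intro AE_completion AE_lborel_singleton)
  then show ?thesis by (simp add: AE_restrict_space_iff) (auto elim: eventually_mono)
qed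

lemma indicator_Ioc_add:
  fixes a b s :: real
  assumes "0 \<le> a" "a \<le> b"
  shows "indicator {0<..a} s + indicator {a<..b} s = (indicator {0<..b} s :: real)"
  using assms by (auto simp: indicator_def)

text \<open>All intervals start at 0, so each indicator corresponds to a single value
  \<open>W t\<close>, and sums of step functions need a union of node sets instead of a common
  refinement of partitions.\<close>

definition indicator_comb :: "real set \<Rightarrow> (real \<Rightarrow> real) \<Rightarrow> real \<Rightarrow> real" where
  "indicator_comb S c s = (\<Sum>t\<in>S. c t * indicator {0<..t} s)"

definition step_functions :: "(real \<Rightarrow> real) set" where
  "step_functions = {indicator_comb S c | S c. finite S \<and> S \<subseteq> {0..1}}"

lemma linear_comb_extend:
  fixes c h :: "real \<Rightarrow> real"
  assumes "finite S'" "S \<subseteq> S'"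
  shows "(\<Sum>t\<in>S. c t * h t) = (\<Sum>t\<in>S'. (if t \<in> S then c t else 0) * h t)"
  using assms by (intro sum.mono_neutral_cong_left) auto

lemma linear_comb_union:
  fixes c c' h :: "real \<Rightarrow> real"
  assumes "finite S" "finite S'"
  shows "(\<Sum>t\<in>S. c t * h t) + (\<Sum>t\<in>S'. c' t * h t) =
    (\<Sum>t\<in>S \<union> S'. ((if t \<in> S then c t else 0) + (if t \<in> S' then c' t else 0)) * h t)"
  using assms linear_comb_extend[of "S \<union> S'" S c h] linear_comb_extend[of "S \<union> S'" S' c' h]
  by (simp add: distrib_right sum.distrib)

lemma step_functions_add:
  assumes "\<phi> \<in> step_functions" "\<psi> \<in> step_functions"
  shows "(\<lambda>s. \<phi> s + \<psi> s) \<in> step_functions"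
proof -
  obtain S c S' c' where S: "\<phi> = indicator_comb S c" "finite S" "S \<subseteq> {0..1}"
    and S': "\<psi> = indicator_comb S' c'" "finite S'" "S' \<subseteq> {0..1}"
    using assms unfolding step_functions_def by blast
  have "(\<lambda>s. \<phi> s + \<psi> s) = indicator_comb (S \<union> S') (\<lambda>t. (if t \<in> S then c t else 0) + (if t \<in> S' then c' t else 0))"
    unfolding S S' indicator_comb_def by (intro ext linear_comb_union S S')
  then show ?thesis using S S' unfolding step_functions_def by blast
qed

lemma step_functions_cmult:
  assumes "\<phi> \<in> step_functions"
  shows "(\<lambda>s. a * \<phi> s) \<in> step_functions"
proof -
  obtain S c where S: "\<phi> = indicator_comb S c" "finite S" "S \<subseteq> {0..1}"
    using assms unfolding step_functions_def by blast
  have "(\<lambda>s. a * \<phi> s) = indicator_comb S (\<lambda>t. a * c t)"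
    unfolding S indicator_comb_def by (simp add: sum_distrib_left mult.assoc)
  then show ?thesis using S unfolding step_functions_def by blast
qed

lemma indicator_in_step_functions:
  assumes "t \<in> {0..1}"
  shows "indicator {0<..t} \<in> step_functions"
proof -
  have "indicator {0<..t} = indicator_comb {t} (\<lambda>_. 1)" by (auto simp: indicator_comb_def)
  then show ?thesis using assms unfolding step_functions_def by blast
qed

lemma bounded_L2_unit_interval:
  assumes [measurable]: "h \<in> borel_measurable unit_interval" and B: "\<And>s. s \<in> {0..1} \<Longrightarrow> \<bar>h s\<bar> \<le> B"
  shows "h \<in> L2 unit_interval"
proof (rule L2I)
  have "(h s)\<^sup>2 \<le> B\<^sup>2" if "s \<in> {0..1}" for s
    using B[OF that] by (intro power2_le_iff_abs_le[THEN iffD2]) auto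
  then show "integrable unit_interval (\<lambda>s. (h s)\<^sup>2)"
    by (intro unit_interval.integrable_const_bound[where B = "B\<^sup>2"]) (auto simp: space_restrict_space)
qed (rule assms)

lemma continuous_L2_unit_interval:
  fixes h :: "real \<Rightarrow> real"
  assumes "continuous_on {0..1} h"
  shows "h \<in> L2 unit_interval"
proof -
  obtain B where "\<And>s. s \<in> {0..1} \<Longrightarrow> norm (h s) \<le> B"
    using continuous_on_compact_bound[OF compact_Icc assms] by blast
  moreover have "h \<in> borel_measurable unit_interval"
    using assms by (rule continuous_imp_measurable_on_sets_lebesgue) simp
  ultimately show ?thesis by (intro bounded_L2_unit_interval) auto
qed

lemma indicator_L2_unit_interval: "A \<in> sets borel \<Longrightarrow> indicator A \<in> L2 unit_interval"
  by (rule bounded_L2_unit_interval[where B = 1])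
    (auto intro: borel_measurable_unit_interval simp: indicator_def)

lemma step_functions_L2: "\<phi> \<in> step_functions \<Longrightarrow> \<phi> \<in> L2 unit_interval"
  unfolding step_functions_def indicator_comb_def
  by (auto intro!: L2_sum L2_cmult indicator_L2_unit_interval)

section \<open>The closure of the step functions in L2 of the unit interval\<close>

definition step_closure :: "(real \<Rightarrow> real) set" where
  "step_closure = {\<phi> \<in> L2 unit_interval.
     \<forall>e>0. \<exists>\<psi>\<in>step_functions. (\<integral>s. (\<phi> s - \<psi> s)\<^sup>2 \<partial>unit_interval) < e}"

lemma step_closureI:
  assumes "\<phi> \<in> L2 unit_interval"
    and "\<And>e. e > 0 \<Longrightarrow> \<exists>\<psi>\<in>step_closure. (\<integral>s. (\<phi> s - \<psi> s)\<^sup>2 \<partial>unit_interval) < e"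
  shows "\<phi> \<in> step_closure"
  unfolding step_closure_def
proof (intro CollectI conjI allI impI assms(1))
  fix e :: real assume "e > 0"
  then obtain \<psi> where \<psi>: "\<psi> \<in> step_closure" "(\<integral>s. (\<phi> s - \<psi> s)\<^sup>2 \<partial>unit_interval) < e / 4"
    using assms(2)[of "e / 4"] by auto
  then obtain \<rho> where \<rho>: "\<rho> \<in> step_functions" "(\<integral>s. (\<psi> s - \<rho> s)\<^sup>2 \<partial>unit_interval) < e / 4"
    using \<open>e > 0\<close> unfolding step_closure_def by (auto dest: spec[of _ "e / 4"])
  have "(\<integral>s. ((\<phi> s - \<psi> s) + (\<psi> s - \<rho> s))\<^sup>2 \<partial>unit_interval) \<le>
      2 * (\<integral>s. (\<phi> s - \<psi> s)\<^sup>2 \<partial>unit_interval) + 2 * (\<integral>s. (\<psi> s - \<rho> s)\<^sup>2 \<partial>unit_interval)"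
    using assms(1) \<psi>(1) step_functions_L2[OF \<rho>(1)]
    by (intro L2_integral_square_add_le L2_diff) (auto simp: step_closure_def)
  then have "(\<integral>s. (\<phi> s - \<rho> s)\<^sup>2 \<partial>unit_interval) < e" using \<psi> \<rho> by simp
  then show "\<exists>\<psi>\<in>step_functions. (\<integral>s. (\<phi> s - \<psi> s)\<^sup>2 \<partial>unit_interval) < e" using \<rho> by blast
qed

lemma step_functions_closure: "\<phi> \<in> step_functions \<Longrightarrow> \<phi> \<in> step_closure"
  unfolding step_closure_def using step_functions_L2 by (auto intro!: bexI[of _ \<phi>])

lemma step_closure_add:
  assumes "\<phi> \<in> step_closure" "\<psi> \<in> step_closure"
  shows "(\<lambda>s. \<phi> s + \<psi> s) \<in> step_closure"
  unfolding step_closure_def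
proof (intro CollectI conjI allI impI)
  have L: "\<phi> \<in> L2 unit_interval" "\<psi> \<in> L2 unit_interval" using assms by (auto simp: step_closure_def)
  then show "(\<lambda>s. \<phi> s + \<psi> s) \<in> L2 unit_interval" by (rule L2_add)
  fix e :: real assume "e > 0"
  then obtain \<phi>' \<psi>' where *: "\<phi>' \<in> step_functions" "(\<integral>s. (\<phi> s - \<phi>' s)\<^sup>2 \<partial>unit_interval) < e / 4"
    "\<psi>' \<in> step_functions" "(\<integral>s. (\<psi> s - \<psi>' s)\<^sup>2 \<partial>unit_interval) < e / 4"
    using assms unfolding step_closure_def by (fastforce dest: spec[of _ "e / 4"])
  have "(\<integral>s. ((\<phi> s - \<phi>' s) + (\<psi> s - \<psi>' s))\<^sup>2 \<partial>unit_interval) \<le>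
      2 * (\<integral>s. (\<phi> s - \<phi>' s)\<^sup>2 \<partial>unit_interval) + 2 * (\<integral>s. (\<psi> s - \<psi>' s)\<^sup>2 \<partial>unit_interval)"
    using L step_functions_L2 * by (intro L2_integral_square_add_le L2_diff) auto
  then have "(\<integral>s. (\<phi> s + \<psi> s - (\<phi>' s + \<psi>' s))\<^sup>2 \<partial>unit_interval) < e"
    using * by (simp add: algebra_simps)
  then show "\<exists>\<rho>\<in>step_functions. (\<integral>s. (\<phi> s + \<psi> s - \<rho> s)\<^sup>2 \<partial>unit_interval) < e"
    using step_functions_add[OF *(1,3)] by (intro bexI[of _ "\<lambda>s. \<phi>' s + \<psi>' s"])
qed

lemma step_closure_cmult:
  assumes "\<phi> \<in> step_closure"
  shows "(\<lambda>s. a * \<phi> s) \<in> step_closure"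
  unfolding step_closure_def
proof (intro CollectI conjI allI impI)
  show "(\<lambda>s. a * \<phi> s) \<in> L2 unit_interval" using assms by (intro L2_cmult) (simp add: step_closure_def)
  fix e :: real assume "e > 0"
  then have "e / (a\<^sup>2 + 1) > 0" by (simp add: add_nonneg_pos)
  then obtain \<phi>' where *: "\<phi>' \<in> step_functions" "(\<integral>s. (\<phi> s - \<phi>' s)\<^sup>2 \<partial>unit_interval) < e / (a\<^sup>2 + 1)"
    using assms unfolding step_closure_def by blast
  have "(\<integral>s. (a * \<phi> s - a * \<phi>' s)\<^sup>2 \<partial>unit_interval) = a\<^sup>2 * (\<integral>s. (\<phi> s - \<phi>' s)\<^sup>2 \<partial>unit_interval)"
    by (subst integral_mult_right_zero[symmetric])
      (simp add: power_mult_distrib flip: right_diff_distrib)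
  also have "\<dots> \<le> (a\<^sup>2 + 1) * (\<integral>s. (\<phi> s - \<phi>' s)\<^sup>2 \<partial>unit_interval)"
    by (intro mult_right_mono) auto
  also have "\<dots> < e"
    using *(2) by (subst (asm) pos_less_divide_eq) (simp_all add: add_nonneg_pos mult.commute)
  finally show "\<exists>\<rho>\<in>step_functions. (\<integral>s. (a * \<phi> s - \<rho> s)\<^sup>2 \<partial>unit_interval) < e"
    using step_functions_cmult[OF *(1)] by (intro bexI[of _ "\<lambda>s. a * \<phi>' s"])
qed

lemma step_closure_sum:
  "(\<And>i. i \<in> I \<Longrightarrow> \<phi> i \<in> step_closure) \<Longrightarrow> (\<lambda>s. \<Sum>i\<in>I. \<phi> i s) \<in> step_closure"
proof (induction I rule: infinite_finite_induct)
  case (insert i I)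
  then show ?case by (auto intro: step_closure_add)
qed (use step_closure_cmult[OF step_functions_closure[OF indicator_in_step_functions[of 0]], of 0] in simp_all)

lemma step_closure_cong_AE:
  assumes "\<phi> \<in> step_closure" "\<psi> \<in> borel_measurable unit_interval" "AE s in unit_interval. \<phi> s = \<psi> s"
  shows "\<psi> \<in> step_closure"
proof -
  have \<phi>: "\<phi> \<in> L2 unit_interval" using assms(1) by (simp add: step_closure_def)
  have "(\<integral>s. (\<psi> s - \<phi> s)\<^sup>2 \<partial>unit_interval) = 0"
    using assms(3) by (intro integral_eq_zero_AE) auto
  then show ?thesis
    using assms L2_cong_AE[OF \<phi> assms(2,3)] by (intro step_closureI) (auto intro!: bexI[of _ \<phi>])
qed

text \<open>Dominated convergence upgrades pointwise limits to L2 limits. It supplies both limit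
  steps of the density proof: countable disjoint unions, and simple functions approximating a given
  function.\<close>

lemma step_closure_dominated:
  assumes F: "\<And>i. F i \<in> step_closure" and w: "w \<in> L2 unit_interval"
    and f[measurable]: "f \<in> borel_measurable unit_interval"
    and lim: "AE s in unit_interval. (\<lambda>i. F i s) \<longlonglongrightarrow> f s"
    and bound: "\<And>i. AE s in unit_interval. \<bar>F i s\<bar> \<le> \<bar>w s\<bar>"
  shows "f \<in> step_closure"
proof -
  have FL: "F i \<in> L2 unit_interval" for i using F by (simp add: step_closure_def)
  have [measurable]: "F i \<in> borel_measurable unit_interval" "w \<in> borel_measurable unit_interval" for i
    using FL w L2_measurable by auto
  have fw: "AE s in unit_interval. \<bar>f s\<bar> \<le> \<bar>w s\<bar>"
  proof -
    have "AE s in unit_interval. \<forall>i. \<bar>F i s\<bar> \<le> \<bar>w s\<bar>" using bound by (simp add: AE_all_countable)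
    with lim show ?thesis
      by eventually_elim (auto intro!: LIMSEQ_le_const2[OF tendsto_rabs])
  qed
  have sq: "u\<^sup>2 \<le> v\<^sup>2" if "\<bar>u\<bar> \<le> \<bar>v\<bar>" for u v :: real using that by (simp add: abs_le_square_iff)
  have fL: "f \<in> L2 unit_interval"
  proof (rule L2I[OF f], rule Bochner_Integration.integrable_bound[OF L2_integrable_square[OF w]])
    show "AE s in unit_interval. norm ((f s)\<^sup>2) \<le> norm ((w s)\<^sup>2)"
      using fw by eventually_elim (auto intro: sq)
  qed simp
  have "(\<lambda>i. \<integral>s. (f s - F i s)\<^sup>2 \<partial>unit_interval) \<longlonglongrightarrow> (\<integral>s. 0 \<partial>unit_interval)"
  proof (rule integral_dominated_convergence)
    show "integrable unit_interval (\<lambda>s. 4 * (w s)\<^sup>2)" using w by (simp add: L2_integrable_square)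
    show "AE s in unit_interval. (\<lambda>i. (f s - F i s)\<^sup>2) \<longlonglongrightarrow> 0"
      using lim by eventually_elim (auto intro!: tendsto_eq_intros)
    show "AE s in unit_interval. norm ((f s - F i s)\<^sup>2) \<le> 4 * (w s)\<^sup>2" for i
      using fw bound[of i]
    proof eventually_elim
      case (elim s)
      then have "(f s - F i s)\<^sup>2 \<le> (2 * w s)\<^sup>2" by (intro sq) auto
      then show ?case by (simp add: power_mult_distrib)
    qed
  qed simp_all
  then have lim0: "(\<lambda>i. \<integral>s. (f s - F i s)\<^sup>2 \<partial>unit_interval) \<longlonglongrightarrow> 0" by simp
  show ?thesis
  proof (rule step_closureI[OF fL])
    fix e :: real assume "e > 0"
    from order_tendstoD(2)[OF lim0 this] obtain i where "(\<integral>s. (f s - F i s)\<^sup>2 \<partial>unit_interval) < e"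
      using eventually_happens'[OF sequentially_bot] by blast
    then show "\<exists>\<psi>\<in>step_closure. (\<integral>s. (f s - \<psi> s)\<^sup>2 \<partial>unit_interval) < e" using F by blast
  qed
qed

lemma const_step_closure: "(\<lambda>_. 1) \<in> step_closure"
proof (rule step_closure_cong_AE)
  show "indicator {0<..1} \<in> step_closure" by (rule step_functions_closure[OF indicator_in_step_functions]) simp
  have "AE s in unit_interval. s \<in> {0..1}"
    using AE_space[of unit_interval] by (simp add: space_restrict_space)
  with AE_unit_interval_neq[of 0] show "AE s in unit_interval. indicator {0<..1} s = (1 :: real)"
    by eventually_elim (auto simp: indicator_def)
qed simp

text \<open>Dynkin's theorem with closed half-lines as generator; complements use linearity of the
  closure, disjoint unions use dominated limits.\<close>

lemma indicator_step_closure: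
  assumes "A \<in> sets borel"
  shows "indicator A \<in> step_closure"
proof -
  let ?G = "range (\<lambda>a::real. {..a})"
  have "Int_stable ?G"
  proof (rule Int_stableI)
    fix A B :: "real set" assume "A \<in> ?G" "B \<in> ?G"
    then obtain a b where "A = {..a}" "B = {..b}" by blast
    then have "A \<inter> B = {..min a b}" by auto
    then show "A \<inter> B \<in> ?G" by blast
  qed
  moreover have "?G \<subseteq> Pow UNIV" by simp
  moreover have "A \<in> sigma_sets UNIV ?G" using assms by (subst (asm) borel_eq_atMost) simp
  ultimately show ?thesis
  proof (induction rule: sigma_sets_induct_disjoint)
    case (basic A)
    then obtain a where A: "A = {..a}" by auto
    \<comment> \<open>On the unit interval the half-line agrees with an initial interval ending at
      the clamped point, up to the null set containing 0.\<close>
    define a' where "a' = max 0 (min a 1)"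
    show ?case
    proof (rule step_closure_cong_AE)
      show "indicator {0<..a'} \<in> step_closure"
        by (rule step_functions_closure[OF indicator_in_step_functions]) (auto simp: a'_def)
      have "AE s in unit_interval. s \<in> {0..1}"
        using AE_space[of unit_interval] by (simp add: space_restrict_space)
      with AE_unit_interval_neq[of 0] show "AE s in unit_interval. indicator {0<..a'} s = (indicator A s :: real)"
        by eventually_elim (auto simp: indicator_def A a'_def)
      show "indicator A \<in> borel_measurable unit_interval"
        unfolding A by (intro borel_measurable_unit_interval) simp
    qed
  next
    case empty
    have "indicator {} = (\<lambda>s::real. 0 * 1 :: real)" by auto
    then show ?case using step_closure_cmult[OF const_step_closure, of 0] by simp
  next
    case (compl A)
    have "indicator (UNIV - A) = (\<lambda>s::real. 1 + (-1) * indicator A s :: real)" by (auto simp: indicator_def)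
    then show ?case using step_closure_add[OF const_step_closure step_closure_cmult[OF compl(2), of "-1"]] by simp
  next
    case (union A)
    have A: "A i \<in> sets borel" for i
      using union(2) by (subst borel_eq_atMost) auto
    show ?case
    proof (rule step_closure_dominated[where F = "\<lambda>n s. \<Sum>i<n. indicator (A i) s" and w = "\<lambda>_. 1"])
      show "(\<lambda>s. \<Sum>i<n. indicator (A i) s) \<in> step_closure" for n
        by (intro step_closure_sum union)
      show "(\<lambda>_. 1) \<in> L2 unit_interval" by (rule bounded_L2_unit_interval[of _ 1]) auto
      show "indicator (\<Union>i. A i) \<in> borel_measurable unit_interval"
        by (intro borel_measurable_unit_interval borel_measurable_indicator sets.countable_UN) (use A in auto)
      have e: "(\<Sum>i<n. indicator (A i) s) = (indicator (\<Union>i<n. A i) s :: real)" for n s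
        by (rule indicator_UN_disjoint[symmetric])
          (use union(1) in \<open>auto simp: disjoint_family_on_def\<close>)
      show "AE s in unit_interval. (\<lambda>n. \<Sum>i<n. indicator (A i) s) \<longlonglongrightarrow> (indicator (\<Union>i. A i) s :: real)"
        unfolding e by (intro AE_I2 LIMSEQ_indicator_UN)
      show "AE s in unit_interval. \<bar>\<Sum>i<n. indicator (A i) s\<bar> \<le> \<bar>1::real\<bar>" for n
        unfolding e by (intro AE_I2) (simp split: split_indicator)
    qed
  qed
qed

text \<open>The measure is Lebesgue, whereas the preceding result concerns Borel sets. Hence
  \<open>f\<close> is first replaced by an almost everywhere equal Borel function, which is then a
  dominated limit of simple functions.\<close>

lemma L2_unit_interval_step_closure:
  assumes f: "f \<in> L2 unit_interval"
  shows "f \<in> step_closure"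
proof -
  have fm: "f \<in> borel_measurable unit_interval" using f by (rule L2_measurable)
  then have "(\<lambda>s. indicator {0..1} s *\<^sub>R f s) \<in> borel_measurable lebesgue"
    by (subst (asm) borel_measurable_restrict_space_iff) auto
  then have "(\<lambda>s. indicator {0..1} s * f s) \<in> borel_measurable (completion lborel)" by simp
  then obtain g where g: "g \<in> borel_measurable lborel" "AE s in lborel. indicator {0..1} s * f s = g s"
    using completion_ex_borel_measurable_real by blast
  have gm[measurable]: "g \<in> borel_measurable borel" using g(1) by simp
  have gU: "g \<in> borel_measurable unit_interval" by (rule borel_measurable_unit_interval[OF gm])
  have "AE s in lebesgue. indicator {0..1} s * f s = g s" by (rule AE_completion[OF g(2)])
  then have eq: "AE s in unit_interval. f s = g s"
    by (simp add: AE_restrict_space_iff) (auto elim!: eventually_mono)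
  have gL: "g \<in> L2 unit_interval" by (rule L2_cong_AE[OF f gU eq])
  \<comment> \<open>The third property bounds the approximants by twice the absolute value of
    \<open>g\<close>, which is the dominating function used below.\<close>
  obtain F where F: "\<And>i. simple_function borel (F i)" "\<And>x. (\<lambda>i. F i x) \<longlonglongrightarrow> g x"
      "\<And>i x. dist (F i x) 0 \<le> 2 * dist (g x) 0"
    using borel_measurable_implies_sequence_metric[OF gm, of 0] by auto
  have "F i \<in> step_closure" for i
  proof -
    have "F i = (\<lambda>s. \<Sum>y\<in>range (F i). y * indicator (F i -` {y}) s)"
    proof
      fix s
      have "(\<Sum>y\<in>range (F i). y * indicator (F i -` {y}) s) = (\<Sum>y\<in>range (F i). if y = F i s then y else 0)"
        by (intro sum.cong) (auto simp: indicator_def)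
      also have "\<dots> = F i s" using F(1)[of i] by (subst sum.delta) (auto simp: simple_function_def)
      finally show "F i s = (\<Sum>y\<in>range (F i). y * indicator (F i -` {y}) s)" by simp
    qed
    moreover have "F i -` {y} \<in> sets borel" for y
      using measurable_sets[OF borel_measurable_simple_function[OF F(1)[of i]], of "{y}"] by simp
    ultimately show ?thesis
      using step_closure_sum[of "range (F i)" "\<lambda>y s. y * indicator (F i -` {y}) s"]
        step_closure_cmult[OF indicator_step_closure] by simp
  qed
  then have "g \<in> step_closure"
    by (rule step_closure_dominated[where F = F and w = "\<lambda>s. 2 * g s"])
      (use F gL gU in \<open>auto intro!: L2_cmult simp: dist_real_def abs_mult\<close>)
  then show ?thesis
    by (rule step_closure_cong_AE[OF _ fm]) (use eq in auto)
qed

lemma L2_unit_interval_step_sequence: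
  assumes f: "f \<in> L2 unit_interval"
  obtains \<psi> where "\<And>m. \<psi> m \<in> step_functions" "L2_tendsto unit_interval \<psi> f"
proof -
  have "\<forall>m. \<exists>\<psi>\<in>step_functions. (\<integral>s. (f s - \<psi> s)\<^sup>2 \<partial>unit_interval) < 1 / real (Suc m)"
    using L2_unit_interval_step_closure[OF f] unfolding step_closure_def by simp
  then obtain \<psi> where \<psi>: "\<And>m. \<psi> m \<in> step_functions"
      "\<And>m. (\<integral>s. (f s - \<psi> m s)\<^sup>2 \<partial>unit_interval) < 1 / real (Suc m)" by metis
  have "(\<lambda>m. \<integral>s. (\<psi> m s - f s)\<^sup>2 \<partial>unit_interval) \<longlonglongrightarrow> 0"
  proof (rule tendsto_sandwich[OF always_eventually always_eventually tendsto_const])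
    show "\<forall>m. (\<integral>s. (\<psi> m s - f s)\<^sup>2 \<partial>unit_interval) \<le> 1 / real (Suc m)"
      using \<psi>(2) by (auto simp: power2_commute intro: less_imp_le)
    show "(\<lambda>m. 1 / real (Suc m)) \<longlonglongrightarrow> 0" using LIMSEQ_inverse_real_of_nat by (simp add: inverse_eq_divide)
  qed simp
  then have "L2_tendsto unit_interval \<psi> f" using \<psi> f step_functions_L2 by (simp add: L2_tendsto_def)
  then show ?thesis using that \<psi> by blast
qed

text \<open>Summation by parts with nodes and coefficients chosen before \<open>h\<close>. The same
  identity can thus be used for a Brownian path, where it produces independent increments, and for
  initial indicators, where it produces disjoint intervals; variance and squared norm then match
  term by term.\<close>

lemma step_combination_increments:
  fixes c :: "real \<Rightarrow> real"
  assumes "finite S" "S \<subseteq> {0..1}"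
  obtains N \<tau> d where "strict_mono_on {..N} \<tau>" "\<tau> ` {..N} \<subseteq> {0..1::real}"
    "\<forall>h :: real \<Rightarrow> real. (\<Sum>t\<in>S. c t * (h t - h 0)) = (\<Sum>i<N. d i * (h (\<tau> (Suc i)) - h (\<tau> i)))"
proof -
  define xs where "xs = sorted_list_of_set (insert 0 S)"
  define N where "N = length xs - 1"
  define \<tau> where "\<tau> i = xs ! i" for i
  have set_xs: "set xs = insert 0 S"
    unfolding xs_def by (rule set_sorted_list_of_set) (use assms in simp)
  have "xs \<noteq> []" using set_xs by auto
  then have len: "length xs = Suc N" unfolding N_def by (cases xs) auto
  have sorted: "sorted_wrt (<) xs" unfolding xs_def by (rule strict_sorted_list_of_set)
  have mono: "\<tau> i < \<tau> j" if "i < j" "j \<le> N" for i j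
    unfolding \<tau>_def using sorted_wrt_nth_less[OF sorted that(1)] that len by simp
  have im: "\<tau> ` {..N} = insert 0 S"
    unfolding \<tau>_def set_xs[symmetric] set_conv_nth len by (auto simp: less_Suc_eq_le)
  have \<tau>0: "\<tau> 0 = 0"
  proof -
    have "0 \<in> \<tau> ` {..N}" using im by simp
    then obtain j where j: "j \<le> N" "\<tau> j = 0" by auto
    have "\<tau> 0 \<in> insert 0 S" unfolding im[symmetric] by simp
    then have nonneg: "0 \<le> \<tau> 0" using assms(2) by auto
    show ?thesis
    proof (rule ccontr)
      assume "\<tau> 0 \<noteq> 0"
      then have "0 < j" using j(2) by (cases "j = 0") simp_all
      from mono[OF this j(1)] nonneg j(2) show False by linarith
    qed
  qed
  \<comment> \<open>An increment starting at \<open>\<tau> i\<close> occurs in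
    \<open>h t - h 0\<close> exactly for the nodes \<open>t\<close> beyond \<open>\<tau> i\<close>,
    so their coefficients are collected.\<close>
  define d where "d i = (\<Sum>t\<in>S. if \<tau> i < t then c t else 0)" for i
  have main: "(\<Sum>t\<in>S. c t * (h t - h 0)) = (\<Sum>i<N. d i * (h (\<tau> (Suc i)) - h (\<tau> i)))" for h :: "real \<Rightarrow> real"
  proof -
    have "h t - h 0 = (\<Sum>i<N. if \<tau> i < t then h (\<tau> (Suc i)) - h (\<tau> i) else 0)" if "t \<in> S" for t
    proof -
      have "t \<in> \<tau> ` {..N}" using that im by simp
      then obtain j where j: "j \<le> N" "\<tau> j = t" by auto
      have iff: "\<tau> i < t \<longleftrightarrow> i < j" if "i < N" for i
      proof (cases "i < j")
        case True
        then show ?thesis using mono[of i j] j by simp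
      next
        case False
        then have "\<tau> j \<le> \<tau> i" using mono[of j i] that by (cases "j = i") (simp_all add: less_imp_le)
        then show ?thesis using False j by simp
      qed
      have "h t - h 0 = (\<Sum>i<j. h (\<tau> (Suc i)) - h (\<tau> i))"
        unfolding sum_lessThan_telescope[of "\<lambda>i. h (\<tau> i)" j] j(2) \<tau>0 ..
      also have "\<dots> = (\<Sum>i<N. if i < j then h (\<tau> (Suc i)) - h (\<tau> i) else 0)"
        by (rule sum.mono_neutral_cong_left) (use j(1) in simp_all)
      also have "\<dots> = (\<Sum>i<N. if \<tau> i < t then h (\<tau> (Suc i)) - h (\<tau> i) else 0)"
        by (intro sum.cong) (auto simp: iff)
      finally show ?thesis .
    qed
    then have "(\<Sum>t\<in>S. c t * (h t - h 0)) =
        (\<Sum>t\<in>S. \<Sum>i<N. (if \<tau> i < t then c t else 0) * (h (\<tau> (Suc i)) - h (\<tau> i)))"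
      by (auto simp: sum_distrib_left intro!: sum.cong)
    also have "\<dots> = (\<Sum>i<N. d i * (h (\<tau> (Suc i)) - h (\<tau> i)))"
      unfolding d_def sum_distrib_right by (rule sum.swap)
    finally show ?thesis .
  qed
  show ?thesis
  proof (rule that[of N \<tau> d])
    show "strict_mono_on {..N} \<tau>" using mono by (auto simp: strict_mono_on_def)
    show "\<tau> ` {..N} \<subseteq> {0..1}" using im assms by auto
  qed (use main in blast)
qed

section \<open>The Gaussian isometry\<close>

lemma inner_L2_commute: "inner_L2 f g = inner_L2 g f"
  by (simp add: inner_L2_def mult.commute)

lemma inner_L2_add_left:
  assumes "f \<in> L2 unit_interval" "g \<in> L2 unit_interval" "h \<in> L2 unit_interval"
  shows "inner_L2 (\<lambda>s. f s + g s) h = inner_L2 f h + inner_L2 g h"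
  using assms by (simp add: inner_L2_def distrib_right L2_integrable_mult)

lemma inner_L2_cmult_left: "inner_L2 (\<lambda>s. a * f s) g = a * inner_L2 f g"
  by (simp add: inner_L2_def mult.assoc)

lemma inner_L2_square_add:
  assumes "f \<in> L2 unit_interval" "g \<in> L2 unit_interval"
  shows "inner_L2 (\<lambda>s. f s + g s) (\<lambda>s. f s + g s) = inner_L2 f f + 2 * inner_L2 f g + inner_L2 g g"
proof -
  have "(\<lambda>s. (f s + g s) * (f s + g s)) = (\<lambda>s. f s * f s + 2 * (f s * g s) + g s * g s)"
    by (simp add: algebra_simps)
  then show ?thesis using assms by (simp add: inner_L2_def L2_integrable_mult)
qed

text \<open>Completing the square: an exponential tilt shifts the mean and leaves the variance
  alone, so the integral of the tilted density is just the prefactor.\<close>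

lemma normal_density_mult_exp:
  assumes "0 < \<sigma>"
  shows "normal_density 0 \<sigma> x * exp (c * x) = exp (c\<^sup>2 * \<sigma>\<^sup>2 / 2) * normal_density (c * \<sigma>\<^sup>2) \<sigma> x"
proof -
  have "- (x - 0)\<^sup>2 / (2 * \<sigma>\<^sup>2) + c * x = c\<^sup>2 * \<sigma>\<^sup>2 / 2 + - (x - c * \<sigma>\<^sup>2)\<^sup>2 / (2 * \<sigma>\<^sup>2)"
    using assms by (simp add: field_simps power2_eq_square)
  then have "exp (- (x - 0)\<^sup>2 / (2 * \<sigma>\<^sup>2)) * exp (c * x) =
      exp (c\<^sup>2 * \<sigma>\<^sup>2 / 2) * exp (- (x - c * \<sigma>\<^sup>2)\<^sup>2 / (2 * \<sigma>\<^sup>2))"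
    by (simp only: mult_exp_exp)
  then show ?thesis by (simp add: normal_density_def)
qed

lemma (in prob_space) normal_exp_moment:
  assumes X: "distributed M lborel X (normal_density 0 \<sigma>)" and "0 < \<sigma>"
  shows "integrable M (\<lambda>\<omega>. exp (c * X \<omega>))" "expectation (\<lambda>\<omega>. exp (c * X \<omega>)) = exp (c\<^sup>2 * \<sigma>\<^sup>2 / 2)"
proof -
  have e: "(\<lambda>x. normal_density 0 \<sigma> x * exp (c * x)) = (\<lambda>x. exp (c\<^sup>2 * \<sigma>\<^sup>2 / 2) * normal_density (c * \<sigma>\<^sup>2) \<sigma> x)"
    using normal_density_mult_exp[OF assms(2)] by auto
  show "integrable M (\<lambda>\<omega>. exp (c * X \<omega>))"
    using distributed_integrable[OF X, of "\<lambda>x. exp (c * x)"] assms(2) unfolding e by simp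
  show "expectation (\<lambda>\<omega>. exp (c * X \<omega>)) = exp (c\<^sup>2 * \<sigma>\<^sup>2 / 2)"
    using distributed_integral[OF X, of "\<lambda>x. exp (c * x)"] assms(2) unfolding e by simp
qed

lemma integral_unit_interval_Ioc:
  assumes "0 \<le> a" "a \<le> b" "b \<le> 1"
  shows "(\<integral>s. indicator {a<..b} s \<partial>unit_interval) = b - a"
proof -
  have "measure unit_interval {a<..b} = b - a"
    using assms by (subst measure_restrict_space) auto
  moreover have "{a<..b} \<inter> space unit_interval = {a<..b}"
    using assms by (auto simp: space_restrict_space)
  ultimately show ?thesis by simp
qed

lemma inner_L2_increments:
  assumes \<tau>: "strict_mono_on {..N} \<tau>" "\<tau> ` {..N} \<subseteq> {0..1::real}"
    and \<psi>: "\<And>s. \<psi> s = (\<Sum>i<N. d i * (indicator {0<..\<tau> (Suc i)} s - indicator {0<..\<tau> i} s))"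
  shows "inner_L2 \<psi> \<psi> = (\<Sum>i<N. (d i)\<^sup>2 * (\<tau> (Suc i) - \<tau> i))"
proof -
  let ?I = "\<lambda>i s. indicator {\<tau> i<..\<tau> (Suc i)} s :: real"
  have mono: "\<tau> i < \<tau> j" if "i < j" "j \<le> N" for i j
    using \<tau>(1) that by (auto simp: strict_mono_on_def)
  have rng: "0 \<le> \<tau> i" "\<tau> i \<le> 1" if "i \<le> N" for i using \<tau>(2) that by auto
  have I: "indicator {0<..\<tau> (Suc i)} s - indicator {0<..\<tau> i} s = ?I i s" if "i < N" for i s
    using indicator_Ioc_add[of "\<tau> i" "\<tau> (Suc i)" s] mono[of i "Suc i"] rng[of i] that by simp
  have disj: "?I i s * ?I j s = 0" if "i < j" "j < N" for i j s
  proof -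
    have "\<tau> (Suc i) \<le> \<tau> j" using mono[of "Suc i" j] that by (cases "Suc i = j") auto
    then show ?thesis by (auto simp: indicator_def)
  qed
  have "\<psi> s * \<psi> s = (\<Sum>i<N. (d i)\<^sup>2 * ?I i s)" for s
  proof -
    have "\<psi> s = (\<Sum>i<N. d i * ?I i s)" unfolding \<psi> by (intro sum.cong) (auto simp: I)
    then have "\<psi> s * \<psi> s = (\<Sum>i<N. \<Sum>j<N. d i * ?I i s * (d j * ?I j s))" by (simp only: sum_product)
    also have "\<dots> = (\<Sum>i<N. \<Sum>j<N. if j = i then (d i)\<^sup>2 * ?I i s else 0)"
    proof (intro sum.cong refl)
      fix i j assume "i \<in> {..<N}" "j \<in> {..<N}"
      then show "d i * ?I i s * (d j * ?I j s) = (if j = i then (d i)\<^sup>2 * ?I i s else 0)"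
      proof (cases "i = j")
        case True
        then show ?thesis by (simp add: power2_eq_square split: split_indicator)
      next
        case False
        then have "?I i s * ?I j s = 0"
          using disj[of i j s] disj[of j i s] \<open>i \<in> {..<N}\<close> \<open>j \<in> {..<N}\<close>
          unfolding mult.commute[of "?I j s"] by (cases "i < j") simp_all
        then have "d i * d j * (?I i s * ?I j s) = 0" by simp
        then show ?thesis using False by (simp only: mult_ac) simp
      qed
    qed
    finally show ?thesis by simp
  qed
  then have "inner_L2 \<psi> \<psi> = (\<integral>s. (\<Sum>i<N. (d i)\<^sup>2 * ?I i s) \<partial>unit_interval)"
    by (simp add: inner_L2_def)
  also have "\<dots> = (\<Sum>i<N. \<integral>s. (d i)\<^sup>2 * ?I i s \<partial>unit_interval)"
    by (intro Bochner_Integration.integral_sum integrable_mult_right unit_interval.L2_integrable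
        indicator_L2_unit_interval) auto
  also have "\<dots> = (\<Sum>i<N. (d i)\<^sup>2 * (\<tau> (Suc i) - \<tau> i))"
  proof (intro sum.cong refl)
    fix i assume "i \<in> {..<N}"
    then have "(\<integral>s. ?I i s \<partial>unit_interval) = \<tau> (Suc i) - \<tau> i"
      using mono[of i "Suc i"] rng[of i] rng[of "Suc i"] by (intro integral_unit_interval_Ioc) auto
    then show "(\<integral>s. (d i)\<^sup>2 * ?I i s \<partial>unit_interval) = (d i)\<^sup>2 * (\<tau> (Suc i) - \<tau> i)" by simp
  qed
  finally show ?thesis .
qed

lemma exp_diff_abs_le: "\<bar>exp x - exp y\<bar> \<le> \<bar>x - y\<bar> * (exp x + exp y)" for x y :: real
proof -
  have *: "exp b - exp a \<le> (b - a) * (exp b + exp a)" if "a \<le> b" for a b :: real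
  proof -
    \<comment> \<open>The tangent of \<open>exp\<close> at 0 lies below the graph; multiplied by
      \<open>exp b\<close> it bounds the increment from \<open>a\<close> to
      \<open>b\<close>.\<close>
    have "1 + (a - b) \<le> exp (a - b)" by (rule exp_ge_add_one_self)
    then have "exp b * (1 + (a - b)) \<le> exp b * exp (a - b)" by (intro mult_left_mono) auto
    then have "exp b - exp a \<le> (b - a) * exp b" by (simp add: algebra_simps flip: exp_add)
    moreover have "0 \<le> (b - a) * exp a" using that by simp
    ultimately show ?thesis unfolding distrib_left by linarith
  qed
  show ?thesis
  proof (cases "x \<le> y")
    case True
    then have "\<bar>exp x - exp y\<bar> = exp y - exp x" "\<bar>x - y\<bar> = y - x" by simp_all
    then show ?thesis using *[OF True] by (simp add: add.commute)
  next
    case False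
    then have "\<bar>exp x - exp y\<bar> = exp x - exp y" "\<bar>x - y\<bar> = x - y" by simp_all
    then show ?thesis using *[of y x] False by simp
  qed
qed

text \<open>The second moment is read off from the coefficient of degree two. With the sign of the
  variance reversed, \<open>hermite_coeff\<close> lists the Taylor coefficients of the Gaussian
  moment generating function.\<close>

lemma (in prob_space) exp_imp_second_moment:
  assumes [measurable]: "X \<in> borel_measurable M"
    and "\<And>s. integrable M (\<lambda>\<omega>. exp (s * X \<omega>))" "\<And>s. expectation (\<lambda>\<omega>. exp (s * X \<omega>)) = exp (s\<^sup>2 * v / 2)"
  shows "X \<in> L2 M" "expectation (\<lambda>\<omega>. (X \<omega>)\<^sup>2) = v"
proof -
  have int: "integrable M (\<lambda>\<omega>. 1 * exp (s * X \<omega>))" for s using assms(2) by simp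
  have "integrable M (\<lambda>\<omega>. (X \<omega>)\<^sup>2)" using exp_moments_integrable[OF _ _ int, of 2] by simp
  then show "X \<in> L2 M" by (intro L2I) auto
  have "(\<lambda>k. hermite_coeff (- v) k * s ^ k) sums exp (s\<^sup>2 * v / 2)" for s
    using hermite_coeff_sums[of "- v" s] by simp
  moreover have "(\<lambda>k. expectation (\<lambda>\<omega>. 1 * X \<omega> ^ k) / fact k * s ^ k) sums exp (s\<^sup>2 * v / 2)" for s
    using exp_moments_sums_real[OF _ _ int, of s] assms(3) by simp
  ultimately have "hermite_coeff (- v) 2 = expectation (\<lambda>\<omega>. 1 * X \<omega> ^ 2) / fact 2"
    by (rule powser_eq_imp_coeff_eq)
  then show "expectation (\<lambda>\<omega>. (X \<omega>)\<^sup>2) = v" by (simp add: hermite_coeff_def)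
qed

section \<open>Exponential moments of Brownian increments and the Wiener isometry\<close>

context brownian_motion
begin

lemma increments_exp:
  assumes \<tau>: "strict_mono_on {..N} \<tau>" "\<tau> ` {..N} \<subseteq> {0..1::real}"
  shows "integrable M (\<lambda>\<omega>. exp (\<Sum>i<N. d i * (W (\<tau> (Suc i)) \<omega> - W (\<tau> i) \<omega>)))"
    and "expectation (\<lambda>\<omega>. exp (\<Sum>i<N. d i * (W (\<tau> (Suc i)) \<omega> - W (\<tau> i) \<omega>))) =
      exp ((\<Sum>i<N. (d i)\<^sup>2 * (\<tau> (Suc i) - \<tau> i)) / 2)"
proof -
  let ?X = "\<lambda>i \<omega>. W (\<tau> (Suc i)) \<omega> - W (\<tau> i) \<omega>"
  have mono: "\<tau> i < \<tau> j" if "i < j" "j \<le> N" for i j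
    using \<tau>(1) that by (auto simp: strict_mono_on_def)
  have rng: "0 \<le> \<tau> i" "\<tau> i \<le> 1" if "i \<le> N" for i using \<tau>(2) that by auto
  have e: "integrable M (\<lambda>\<omega>. exp (d i * ?X i \<omega>))"
    "expectation (\<lambda>\<omega>. exp (d i * ?X i \<omega>)) = exp ((d i)\<^sup>2 * (\<tau> (Suc i) - \<tau> i) / 2)" if "i < N" for i
  proof -
    have m: "\<tau> i < \<tau> (Suc i)" using mono that by simp
    have "distributed M lborel (?X i) (normal_density 0 (sqrt (\<tau> (Suc i) - \<tau> i)))"
      by (rule W_normal_increments) (use m rng that in auto)
    note * = normal_exp_moment[OF this, of "d i"]
    show "integrable M (\<lambda>\<omega>. exp (d i * ?X i \<omega>))"
      "expectation (\<lambda>\<omega>. exp (d i * ?X i \<omega>)) = exp ((d i)\<^sup>2 * (\<tau> (Suc i) - \<tau> i) / 2)"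
      using * m by simp_all
  qed
  have "indep_vars (\<lambda>_. borel) ?X {..<N}" by (rule W_indep_increments[OF \<tau>])
  then have ind: "indep_vars (\<lambda>_. borel) (\<lambda>i \<omega>. exp (d i * ?X i \<omega>)) {..<N}"
    by (rule indep_vars_compose2[where Y = "\<lambda>i x. exp (d i * x)"]) simp
  have p: "exp (\<Sum>i<N. d i * ?X i \<omega>) = (\<Prod>i<N. exp (d i * ?X i \<omega>))" for \<omega> by (rule exp_sum) simp
  show "integrable M (\<lambda>\<omega>. exp (\<Sum>i<N. d i * ?X i \<omega>))"
    unfolding p by (rule indep_vars_integrable[OF _ ind]) (use e in auto)
  have "expectation (\<lambda>\<omega>. exp (\<Sum>i<N. d i * ?X i \<omega>)) = (\<Prod>i<N. expectation (\<lambda>\<omega>. exp (d i * ?X i \<omega>)))"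
    unfolding p by (rule indep_vars_lebesgue_integral[OF _ ind]) (use e in auto)
  also have "\<dots> = (\<Prod>i<N. exp ((d i)\<^sup>2 * (\<tau> (Suc i) - \<tau> i) / 2))"
    by (intro prod.cong) (auto simp: e)
  also have "\<dots> = exp ((\<Sum>i<N. (d i)\<^sup>2 * (\<tau> (Suc i) - \<tau> i)) / 2)"
    by (simp add: exp_sum sum_divide_distrib)
  finally show "expectation (\<lambda>\<omega>. exp (\<Sum>i<N. d i * ?X i \<omega>)) =
      exp ((\<Sum>i<N. (d i)\<^sup>2 * (\<tau> (Suc i) - \<tau> i)) / 2)" .
qed

text \<open>One choice of increments represents both the random variable and the step function, so
  the variance produced by independence is the squared norm of the integrand. For the random
  variable this representation holds only almost surely, because \<open>W 0\<close> vanishes only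
  almost surely.\<close>

lemma indicator_comb_exp:
  assumes S: "finite S" "S \<subseteq> {0..1}"
  shows "integrable M (\<lambda>\<omega>. exp (\<Sum>t\<in>S. c t * W t \<omega>))"
    and "expectation (\<lambda>\<omega>. exp (\<Sum>t\<in>S. c t * W t \<omega>)) = exp (inner_L2 (indicator_comb S c) (indicator_comb S c) / 2)"
proof -
  have [measurable]: "t \<in> S \<Longrightarrow> W t \<in> borel_measurable M" for t using S W_measurable by auto
  obtain N \<tau> d where \<tau>: "strict_mono_on {..N} \<tau>" "\<tau> ` {..N} \<subseteq> {0..1::real}"
    and inc: "\<forall>h :: real \<Rightarrow> real. (\<Sum>t\<in>S. c t * (h t - h 0)) = (\<Sum>i<N. d i * (h (\<tau> (Suc i)) - h (\<tau> i)))"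
    by (rule step_combination_increments[OF S, of c])
  have AE: "AE \<omega> in M. exp (\<Sum>i<N. d i * (W (\<tau> (Suc i)) \<omega> - W (\<tau> i) \<omega>)) = exp (\<Sum>t\<in>S. c t * W t \<omega>)"
    using W_0
  proof eventually_elim
    case (elim \<omega>)
    then show ?case using inc[rule_format, of "\<lambda>t. W t \<omega>"] by simp
  qed
  note e = increments_exp[OF \<tau>, of d]
  have m: "(\<lambda>\<omega>. exp (\<Sum>t\<in>S. c t * W t \<omega>)) \<in> borel_measurable M" by measurable
  show "integrable M (\<lambda>\<omega>. exp (\<Sum>t\<in>S. c t * W t \<omega>))"
    by (rule integrable_cong_AE_imp[OF e(1) m]) (use AE in \<open>auto elim: eventually_mono\<close>)
  have "indicator_comb S c s = (\<Sum>i<N. d i * (indicator {0<..\<tau> (Suc i)} s - indicator {0<..\<tau> i} s))" for s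
    unfolding inc[rule_format, of "\<lambda>t. indicator {0<..t} s", symmetric] by (simp add: indicator_comb_def)
  then have "inner_L2 (indicator_comb S c) (indicator_comb S c) = (\<Sum>i<N. (d i)\<^sup>2 * (\<tau> (Suc i) - \<tau> i))"
    by (rule inner_L2_increments[OF \<tau>])
  moreover have "expectation (\<lambda>\<omega>. exp (\<Sum>t\<in>S. c t * W t \<omega>)) =
      expectation (\<lambda>\<omega>. exp (\<Sum>i<N. d i * (W (\<tau> (Suc i)) \<omega> - W (\<tau> i) \<omega>)))"
    by (rule integral_cong_AE[OF m borel_measurable_integrable[OF e(1)]])
      (use AE in \<open>auto elim: eventually_mono\<close>)
  ultimately show "expectation (\<lambda>\<omega>. exp (\<Sum>t\<in>S. c t * W t \<omega>)) =
      exp (inner_L2 (indicator_comb S c) (indicator_comb S c) / 2)"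
    using e(2) by simp
qed

text \<open>A step function has many representations by nodes and coefficients. Keeping the
  integrand and its integral together as a pair, built from the same data, makes linear operations
  available before the integral is known to be well defined.\<close>

definition elementary :: "(real \<Rightarrow> real) \<Rightarrow> ('a \<Rightarrow> real) \<Rightarrow> bool" where
  "elementary \<phi> X \<longleftrightarrow> (\<exists>S c. finite S \<and> S \<subseteq> {0..1} \<and> \<phi> = indicator_comb S c \<and> X = (\<lambda>\<omega>. \<Sum>t\<in>S. c t * W t \<omega>))"

lemma elementary_step_functions: "elementary \<phi> X \<Longrightarrow> \<phi> \<in> step_functions"
  by (auto simp: elementary_def step_functions_def)

lemma elementary_cmult: "elementary \<phi> X \<Longrightarrow> elementary (\<lambda>s. a * \<phi> s) (\<lambda>\<omega>. a * X \<omega>)"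
proof -
  assume "elementary \<phi> X"
  then obtain S c where S: "finite S" "S \<subseteq> {0..1}" "\<phi> = indicator_comb S c" "X = (\<lambda>\<omega>. \<Sum>t\<in>S. c t * W t \<omega>)"
    unfolding elementary_def by blast
  have "(\<lambda>s. a * \<phi> s) = indicator_comb S (\<lambda>t. a * c t)"
    unfolding S indicator_comb_def fun_eq_iff sum_distrib_left mult.assoc by simp
  moreover have "(\<lambda>\<omega>. a * X \<omega>) = (\<lambda>\<omega>. \<Sum>t\<in>S. a * c t * W t \<omega>)"
    unfolding S by (simp add: sum_distrib_left mult.assoc)
  ultimately show ?thesis unfolding elementary_def using S(1,2)
    by (intro exI[of _ S] exI[of _ "\<lambda>t. a * c t"]) simp
qed

lemma elementary_add:
  assumes "elementary \<phi> X" "elementary \<psi> Y"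
  shows "elementary (\<lambda>s. \<phi> s + \<psi> s) (\<lambda>\<omega>. X \<omega> + Y \<omega>)"
proof -
  obtain S c where S: "finite S" "S \<subseteq> {0..1}" "\<phi> = indicator_comb S c" "X = (\<lambda>\<omega>. \<Sum>t\<in>S. c t * W t \<omega>)"
    using assms(1) unfolding elementary_def by blast
  obtain S' c' where S': "finite S'" "S' \<subseteq> {0..1}" "\<psi> = indicator_comb S' c'" "Y = (\<lambda>\<omega>. \<Sum>t\<in>S'. c' t * W t \<omega>)"
    using assms(2) unfolding elementary_def by blast
  show ?thesis unfolding elementary_def
  proof (intro exI conjI)
    show "finite (S \<union> S')" "S \<union> S' \<subseteq> {0..1}" using S S' by auto
    show "(\<lambda>s. \<phi> s + \<psi> s) = indicator_comb (S \<union> S') (\<lambda>t. (if t \<in> S then c t else 0) + (if t \<in> S' then c' t else 0))"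
      unfolding S S' indicator_comb_def by (intro ext linear_comb_union S S')
    show "(\<lambda>\<omega>. X \<omega> + Y \<omega>) = (\<lambda>\<omega>. \<Sum>t\<in>S \<union> S'. ((if t \<in> S then c t else 0) + (if t \<in> S' then c' t else 0)) * W t \<omega>)"
      unfolding S S' by (intro ext linear_comb_union S S')
  qed
qed

lemma elementary_sum:
  assumes "\<And>i. i \<in> I \<Longrightarrow> elementary (\<phi> i) (X i)"
  shows "elementary (\<lambda>s. \<Sum>i\<in>I. \<phi> i s) (\<lambda>\<omega>. \<Sum>i\<in>I. X i \<omega>)"
  using assms
proof (induction I rule: infinite_finite_induct)
  case (insert i I)
  then show ?case by (auto intro: elementary_add)
next
  case empty
  show ?case unfolding elementary_def by (rule exI[of _ "{}"], rule exI[of _ "\<lambda>_. 0"]) (auto simp: indicator_comb_def)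
next
  case (infinite I)
  show ?case unfolding elementary_def using infinite by (intro exI[of _ "{}"] exI[of _ "\<lambda>_. 0"]) (auto simp: indicator_comb_def)
qed

lemma elementary_indicator: "t \<in> {0..1} \<Longrightarrow> elementary (indicator {0<..t}) (W t)"
  unfolding elementary_def
  by (rule exI[of _ "{t}"], rule exI[of _ "\<lambda>_. 1"]) (auto simp: indicator_comb_def)

lemma elementary_measurable: "elementary \<phi> X \<Longrightarrow> X \<in> borel_measurable M"
proof -
  assume "elementary \<phi> X"
  then obtain S c where S: "finite S" "S \<subseteq> {0..1}" "X = (\<lambda>\<omega>. \<Sum>t\<in>S. c t * W t \<omega>)"
    unfolding elementary_def by blast
  have [measurable]: "t \<in> S \<Longrightarrow> W t \<in> borel_measurable M" for t using S W_measurable by auto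
  show ?thesis unfolding S by measurable
qed

lemma elementary_exp:
  assumes "elementary \<phi> X"
  shows "integrable M (\<lambda>\<omega>. exp (s * X \<omega>))" "expectation (\<lambda>\<omega>. exp (s * X \<omega>)) = exp (s\<^sup>2 * inner_L2 \<phi> \<phi> / 2)"
proof -
  have "elementary (\<lambda>r. s * \<phi> r) (\<lambda>\<omega>. s * X \<omega>)" by (rule elementary_cmult[OF assms])
  then obtain S c where S: "finite S" "S \<subseteq> {0..1}" "(\<lambda>r. s * \<phi> r) = indicator_comb S c"
    "(\<lambda>\<omega>. s * X \<omega>) = (\<lambda>\<omega>. \<Sum>t\<in>S. c t * W t \<omega>)" unfolding elementary_def by blast
  have X: "s * X \<omega> = (\<Sum>t\<in>S. c t * W t \<omega>)" for \<omega> using S(4) by (rule fun_cong)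
  show "integrable M (\<lambda>\<omega>. exp (s * X \<omega>))" unfolding X by (rule indicator_comb_exp[OF S(1,2)])
  have "expectation (\<lambda>\<omega>. exp (s * X \<omega>)) = exp (inner_L2 (\<lambda>r. s * \<phi> r) (\<lambda>r. s * \<phi> r) / 2)"
    unfolding X S(3) by (rule indicator_comb_exp[OF S(1,2)])
  also have "inner_L2 (\<lambda>r. s * \<phi> r) (\<lambda>r. s * \<phi> r) = s\<^sup>2 * inner_L2 \<phi> \<phi>"
    by (simp add: inner_L2_def power2_eq_square mult_ac)
  finally show "expectation (\<lambda>\<omega>. exp (s * X \<omega>)) = exp (s\<^sup>2 * inner_L2 \<phi> \<phi> / 2)" .
qed

lemma elementary_L2:
  assumes "elementary \<phi> X"
  shows "X \<in> L2 M" "expectation (\<lambda>\<omega>. (X \<omega>)\<^sup>2) = inner_L2 \<phi> \<phi>"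
  using exp_imp_second_moment[OF elementary_measurable elementary_exp, OF assms assms assms] by auto

text \<open>The graph of the Wiener integral: the closure of the elementary integrals, as a relation
  between integrands and representatives, so that no choice is involved.\<close>

definition wiener_pair :: "(real \<Rightarrow> real) \<Rightarrow> ('a \<Rightarrow> real) \<Rightarrow> bool" where
  "wiener_pair f X \<longleftrightarrow> (\<exists>\<phi> Y. (\<forall>m. elementary (\<phi> m) (Y m)) \<and>
     L2_tendsto unit_interval \<phi> f \<and> L2_tendsto M Y X)"

lemma wiener_pair_L2:
  assumes "wiener_pair f X" shows "f \<in> L2 unit_interval" "X \<in> L2 M"
  using assms by (auto simp: wiener_pair_def L2_tendsto_def)

lemma wiener_pair_measurable: "wiener_pair f X \<Longrightarrow> X \<in> borel_measurable M"
  using wiener_pair_L2 L2_measurable by blast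

lemma elementary_wiener_pair: "elementary \<phi> X \<Longrightarrow> wiener_pair \<phi> X"
  unfolding wiener_pair_def
  by (rule exI[of _ "\<lambda>_. \<phi>"], rule exI[of _ "\<lambda>_. X"])
    (auto intro: L2_tendsto_const elementary_L2 step_functions_L2 elementary_step_functions)

lemma wiener_pair_cmult: "wiener_pair f X \<Longrightarrow> wiener_pair (\<lambda>s. a * f s) (\<lambda>\<omega>. a * X \<omega>)"
  unfolding wiener_pair_def
  using elementary_cmult[of _ _ a] L2_tendsto_cmult[of unit_interval _ f a] L2_tendsto_cmult[of M _ X a]
  by meson

lemma wiener_pair_add:
  assumes "wiener_pair f X" "wiener_pair g Y"
  shows "wiener_pair (\<lambda>s. f s + g s) (\<lambda>\<omega>. X \<omega> + Y \<omega>)"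
proof -
  obtain \<phi> U where U: "\<And>m. elementary (\<phi> m) (U m)" "L2_tendsto unit_interval \<phi> f" "L2_tendsto M U X"
    using assms(1) unfolding wiener_pair_def by blast
  obtain \<psi> V where V: "\<And>m. elementary (\<psi> m) (V m)" "L2_tendsto unit_interval \<psi> g" "L2_tendsto M V Y"
    using assms(2) unfolding wiener_pair_def by blast
  show ?thesis unfolding wiener_pair_def
    using elementary_add[OF U(1) V(1)] L2_tendsto_add[OF U(2) V(2)] L2_tendsto_add[OF U(3) V(3)]
    by (intro exI[of _ "\<lambda>m s. \<phi> m s + \<psi> m s"] exI[of _ "\<lambda>m \<omega>. U m \<omega> + V m \<omega>"]) auto
qed

lemma wiener_pair_diff:
  assumes "wiener_pair f X" "wiener_pair g Y"
  shows "wiener_pair (\<lambda>s. f s - g s) (\<lambda>\<omega>. X \<omega> - Y \<omega>)"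
  using wiener_pair_add[OF assms(1) wiener_pair_cmult[OF assms(2), of "-1"]] by simp

lemma wiener_pair_zero: "wiener_pair (\<lambda>_. 0) (\<lambda>_. 0)"
  using wiener_pair_cmult[OF elementary_wiener_pair[OF elementary_indicator[of 0]], of 0] by simp

text \<open>Along an almost surely convergent subsequence, Fatou's lemma bounds the exponential moments
  of the limit; the inequality \<open>\<bar>exp x - exp y\<bar> \<le> \<bar>x - y\<bar> * (exp x + exp y)\<close> then turns
  \<open>L\<^sup>2\<close> convergence into convergence of the exponential moments.\<close>

lemma wiener_pair_exp_integrable:
  assumes "wiener_pair f X"
  shows "integrable M (\<lambda>\<omega>. exp (X \<omega>))"
proof -
  obtain \<phi> U where U: "\<And>m. elementary (\<phi> m) (U m)" "L2_tendsto unit_interval \<phi> f" "L2_tendsto M U X"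
    using assms unfolding wiener_pair_def by blast
  obtain r where r: "strict_mono r" "AE \<omega> in M. (\<lambda>n. U (r n) \<omega>) \<longlonglongrightarrow> X \<omega>"
    by (rule L2_tendsto_AE_subseq[OF U(3)])
  have "(\<lambda>n. inner_L2 (\<phi> n) (\<phi> n)) \<longlonglongrightarrow> inner_L2 f f"
    unfolding inner_L2_def by (rule L2_tendsto_inner[OF U(2) U(2)])
  then have "Bseq (\<lambda>n. inner_L2 (\<phi> n) (\<phi> n))" using convergentI Bseq_eq_bounded convergent_imp_Bseq by blast
  then obtain K where K: "\<And>n. inner_L2 (\<phi> n) (\<phi> n) \<le> K"
    unfolding Bseq_def by (metis abs_le_D1 real_norm_def)
  show ?thesis
  proof (rule Fatou_real)
    show "integrable M (\<lambda>\<omega>. exp (U (r n) \<omega>))" for n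
      using elementary_exp(1)[OF U(1), of 1 "r n"] by simp
    show "AE \<omega> in M. (\<lambda>n. exp (U (r n) \<omega>)) \<longlonglongrightarrow> exp (X \<omega>)"
      using r(2) by eventually_elim (intro tendsto_exp)
    show "\<forall>\<^sub>F n in sequentially. expectation (\<lambda>\<omega>. exp (U (r n) \<omega>)) \<le> exp (K / 2)"
      using elementary_exp(2)[OF U(1), of 1] K by (intro always_eventually allI) simp
  qed (use wiener_pair_measurable[OF assms] in auto)
qed

text \<open>The square of \<open>exp (X \<omega>)\<close> is the exponential of
  \<open>2 * X \<omega>\<close>, which is again a Wiener integral.\<close>

lemma wiener_pair_exp_L2: "wiener_pair f X \<Longrightarrow> (\<lambda>\<omega>. exp (X \<omega>)) \<in> L2 M"
  using wiener_pair_exp_integrable[OF wiener_pair_cmult[of f X 2]] wiener_pair_measurable[of f X]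
  by (auto simp: L2_def power2_eq_square simp flip: exp_add)

lemma wiener_pair_exp:
  assumes "wiener_pair f X"
  shows "expectation (\<lambda>\<omega>. exp (X \<omega>)) = exp (inner_L2 f f / 2)"
proof -
  obtain \<phi> U where U: "\<And>m. elementary (\<phi> m) (U m)" "L2_tendsto unit_interval \<phi> f" "L2_tendsto M U X"
    using assms unfolding wiener_pair_def by blast
  note UX = U(3)[unfolded L2_tendsto_def]
  have inner: "(\<lambda>n. inner_L2 (\<phi> n) (\<phi> n)) \<longlonglongrightarrow> inner_L2 f f"
    unfolding inner_L2_def by (rule L2_tendsto_inner[OF U(2) U(2)])
  \<comment> \<open>An upper bound for the second moment of
    \<open>exp (U n \<omega>) + exp (X \<omega>)\<close>. It converges, so Cauchy-Schwarz leaves a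
    null sequence times a convergent one.\<close>
  define C where "C n = 2 * exp (2 * inner_L2 (\<phi> n) (\<phi> n)) + 2 * expectation (\<lambda>\<omega>. (exp (X \<omega>))\<^sup>2)" for n
  have expU: "expectation (\<lambda>\<omega>. exp (U n \<omega>)) = exp (inner_L2 (\<phi> n) (\<phi> n) / 2)" for n
    using elementary_exp(2)[OF U(1), of 1] by simp
  have expU2: "expectation (\<lambda>\<omega>. (exp (U n \<omega>))\<^sup>2) = exp (2 * inner_L2 (\<phi> n) (\<phi> n))" for n
    using elementary_exp(2)[OF U(1), of 2 n] by (simp add: power2_eq_square flip: exp_add)
  have UL: "(\<lambda>\<omega>. exp (U n \<omega>)) \<in> L2 M" for n
    by (rule wiener_pair_exp_L2[OF elementary_wiener_pair[OF U(1)]])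
  have XL: "(\<lambda>\<omega>. exp (X \<omega>)) \<in> L2 M" by (rule wiener_pair_exp_L2[OF assms])
  have bound: "(expectation (\<lambda>\<omega>. exp (U n \<omega>)) - expectation (\<lambda>\<omega>. exp (X \<omega>)))\<^sup>2 \<le>
      expectation (\<lambda>\<omega>. (U n \<omega> - X \<omega>)\<^sup>2) * C n" for n
  proof -
    have D: "(\<lambda>\<omega>. \<bar>U n \<omega> - X \<omega>\<bar>) \<in> L2 M" using L2_diff[of "U n" M X] UX by (auto simp: L2_def)
    have S: "(\<lambda>\<omega>. exp (U n \<omega>) + exp (X \<omega>)) \<in> L2 M" by (intro L2_add UL XL)
    have "\<bar>expectation (\<lambda>\<omega>. exp (U n \<omega>)) - expectation (\<lambda>\<omega>. exp (X \<omega>))\<bar> =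
        \<bar>expectation (\<lambda>\<omega>. exp (U n \<omega>) - exp (X \<omega>))\<bar>"
      using L2_integrable[OF UL] L2_integrable[OF XL] by simp
    also have "\<dots> \<le> expectation (\<lambda>\<omega>. \<bar>exp (U n \<omega>) - exp (X \<omega>)\<bar>)" by (rule integral_abs_bound)
    also have "\<dots> \<le> expectation (\<lambda>\<omega>. \<bar>U n \<omega> - X \<omega>\<bar> * (exp (U n \<omega>) + exp (X \<omega>)))"
      by (intro integral_mono integrable_abs Bochner_Integration.integrable_diff L2_integrable UL XL
          L2_integrable_mult D S exp_diff_abs_le)
    finally have "\<bar>expectation (\<lambda>\<omega>. exp (U n \<omega>)) - expectation (\<lambda>\<omega>. exp (X \<omega>))\<bar>\<^sup>2 \<le>
        (expectation (\<lambda>\<omega>. \<bar>U n \<omega> - X \<omega>\<bar> * (exp (U n \<omega>) + exp (X \<omega>))))\<^sup>2"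
      by (intro power_mono) auto
    also have "\<dots> \<le> expectation (\<lambda>\<omega>. \<bar>U n \<omega> - X \<omega>\<bar>\<^sup>2) * expectation (\<lambda>\<omega>. (exp (U n \<omega>) + exp (X \<omega>))\<^sup>2)"
      by (rule L2_Cauchy_Schwarz[OF D S])
    also have "\<dots> \<le> expectation (\<lambda>\<omega>. \<bar>U n \<omega> - X \<omega>\<bar>\<^sup>2) * C n"
      using L2_integral_square_add_le[OF UL XL, of n] unfolding C_def expU2[symmetric]
      by (intro mult_left_mono) auto
    finally show ?thesis by simp
  qed
  have "(\<lambda>n. expectation (\<lambda>\<omega>. (U n \<omega> - X \<omega>)\<^sup>2) * C n) \<longlonglongrightarrow>
      0 * (2 * exp (2 * inner_L2 f f) + 2 * expectation (\<lambda>\<omega>. (exp (X \<omega>))\<^sup>2))"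
    unfolding C_def using UX inner by (intro tendsto_intros) auto
  then have C0: "(\<lambda>n. expectation (\<lambda>\<omega>. (U n \<omega> - X \<omega>)\<^sup>2) * C n) \<longlonglongrightarrow> 0" by simp
  have "(\<lambda>n. (expectation (\<lambda>\<omega>. exp (U n \<omega>)) - expectation (\<lambda>\<omega>. exp (X \<omega>)))\<^sup>2) \<longlonglongrightarrow> 0"
    by (rule tendsto_sandwich[OF _ _ tendsto_const C0]; rule always_eventually) (use bound in auto)
  then have "(\<lambda>n. expectation (\<lambda>\<omega>. exp (U n \<omega>))) \<longlonglongrightarrow> expectation (\<lambda>\<omega>. exp (X \<omega>))"
    by (simp add: LIM_zero_iff)
  moreover have "(\<lambda>n. expectation (\<lambda>\<omega>. exp (U n \<omega>))) \<longlonglongrightarrow> exp (inner_L2 f f / 2)"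
    unfolding expU using inner by (intro tendsto_intros) auto
  ultimately show ?thesis by (rule LIMSEQ_unique)
qed

lemma wiener_pair_isometry:
  assumes "wiener_pair f X"
  shows "expectation (\<lambda>\<omega>. (X \<omega>)\<^sup>2) = inner_L2 f f"
proof (rule exp_imp_second_moment(2)[OF wiener_pair_measurable[OF assms]])
  fix s
  note * = wiener_pair_cmult[OF assms, of s]
  show "integrable M (\<lambda>\<omega>. exp (s * X \<omega>))" by (rule wiener_pair_exp_integrable[OF *])
  have "inner_L2 (\<lambda>r. s * f r) (\<lambda>r. s * f r) = s\<^sup>2 * inner_L2 f f"
    by (simp add: inner_L2_def power2_eq_square mult_ac)
  then show "expectation (\<lambda>\<omega>. exp (s * X \<omega>)) = exp (s\<^sup>2 * inner_L2 f f / 2)"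
    using wiener_pair_exp[OF *] by simp
qed

lemma wiener_pair_unique:
  assumes "wiener_pair f X" "wiener_pair f Y"
  shows "AE \<omega> in M. X \<omega> = Y \<omega>"
proof -
  note D = wiener_pair_diff[OF assms]
  have "expectation (\<lambda>\<omega>. (X \<omega> - Y \<omega>)\<^sup>2) = 0"
    using wiener_pair_isometry[OF D] by (simp add: inner_L2_def)
  then have "AE \<omega> in M. (X \<omega> - Y \<omega>)\<^sup>2 = 0"
    using L2_integrable_square[OF wiener_pair_L2(2)[OF D]] by (subst (asm) integral_nonneg_eq_0_iff_AE) auto
  then show ?thesis by eventually_elim simp
qed

section \<open>Existence of the Wiener integral and its relation to the closure of elementary
  pairs\<close>

lemma step_elementary:
  assumes "mono_on {..N} t" "t ` {..N} \<subseteq> {0..1}"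
  shows "elementary (step_fun N t c) (step_integral W N t c)"
proof -
  have el: "elementary (\<lambda>s. c i * (indicator {0<..t (Suc i)} s + (-1) * indicator {0<..t i} s))
      (\<lambda>\<omega>. c i * (W (t (Suc i)) \<omega> + (-1) * W (t i) \<omega>))" if "i \<in> {..<N}" for i
  proof -
    have "t i \<in> {0..1}" "t (Suc i) \<in> {0..1}"
      using subsetD[OF assms(2) imageI, of i] subsetD[OF assms(2) imageI, of "Suc i"] that by simp_all
    then show ?thesis by (intro elementary_cmult elementary_add elementary_indicator)
  qed
  have ind: "indicator {0<..t (Suc i)} s + (-1) * indicator {0<..t i} s = (indicator {t i<..t (Suc i)} s :: real)"
    if "i \<in> {..<N}" for i s
  proof -
    have "t i \<le> t (Suc i)" using assms that by (auto simp: mono_on_def)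
    moreover have "t i \<in> {0..1}" using subsetD[OF assms(2) imageI, of i] that by simp
    ultimately have "t i \<le> t (Suc i)" "0 \<le> t i" by simp_all
    from indicator_Ioc_add[OF this(2,1), of s] show ?thesis by simp
  qed
  have "step_fun N t c = (\<lambda>s. \<Sum>i<N. c i * (indicator {0<..t (Suc i)} s + (-1) * indicator {0<..t i} s))"
    unfolding step_fun_def by (intro ext sum.cong refl) (simp only: ind)
  moreover have "step_integral W N t c = (\<lambda>\<omega>. \<Sum>i<N. c i * (W (t (Suc i)) \<omega> + (-1) * W (t i) \<omega>))"
    by (auto simp: step_integral_def)
  ultimately show ?thesis by (simp only:) (rule elementary_sum[OF el])
qed

lemma is_wiener_integral_imp_pair:
  assumes "is_wiener_integral M W f X"
  shows "wiener_pair f X"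
proof -
  obtain N t c where *: "\<forall>m. mono_on {..N m} (t m) \<and> t m ` {..N m} \<subseteq> {0..1}"
    "L2_tendsto unit_interval (\<lambda>m. step_fun (N m) (t m) (c m)) f"
    "L2_tendsto M (\<lambda>m. step_integral W (N m) (t m) (c m)) X"
    using assms unfolding is_wiener_integral_def by blast
  show ?thesis unfolding wiener_pair_def
    by (rule exI[of _ "\<lambda>m. step_fun (N m) (t m) (c m)"],
        rule exI[of _ "\<lambda>m. step_integral W (N m) (t m) (c m)"])
      (use * step_elementary in simp)
qed

text \<open>The definition of the integral uses ordered partitions, the density argument uses
  arbitrary node sets; summation by parts, applied to the initial indicators, translates the latter
  into the former.\<close>

lemma step_function_is_step_fun:
  assumes "\<psi> \<in> step_functions"
  shows "\<exists>N t c. mono_on {..N} t \<and> t ` {..N} \<subseteq> {0..1} \<and> step_fun N t c = \<psi>"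
proof -
  obtain S c where S: "\<psi> = indicator_comb S c" "finite S" "S \<subseteq> {0..1}"
    using assms unfolding step_functions_def by blast
  obtain N \<tau> d where \<tau>: "strict_mono_on {..N} \<tau>" "\<tau> ` {..N} \<subseteq> {0..1::real}"
    and inc: "\<forall>h :: real \<Rightarrow> real. (\<Sum>t\<in>S. c t * (h t - h 0)) = (\<Sum>i<N. d i * (h (\<tau> (Suc i)) - h (\<tau> i)))"
    by (rule step_combination_increments[OF S(2,3), of c])
  have "step_fun N \<tau> d s = \<psi> s" for s
  proof -
    have ind: "indicator {0<..\<tau> (Suc i)} s - indicator {0<..\<tau> i} s = (indicator {\<tau> i<..\<tau> (Suc i)} s :: real)"
      if "i < N" for i
    proof -
      have "\<tau> i < \<tau> (Suc i)" using \<tau>(1) that by (auto simp: strict_mono_on_def)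
      moreover have "\<tau> i \<in> {0..1}" using subsetD[OF \<tau>(2) imageI, of i] that by simp
      ultimately show ?thesis using indicator_Ioc_add[of "\<tau> i" "\<tau> (Suc i)" s] by simp
    qed
    have "step_fun N \<tau> d s = (\<Sum>i<N. d i * (indicator {0<..\<tau> (Suc i)} s - indicator {0<..\<tau> i} s))"
      unfolding step_fun_def by (intro sum.cong refl) (simp only: ind lessThan_iff)
    then show ?thesis
      unfolding inc[rule_format, of "\<lambda>t. indicator {0<..t} s", symmetric] by (simp add: S indicator_comb_def)
  qed
  then show ?thesis using \<tau> strict_mono_on_imp_mono_on by blast
qed

text \<open>The isometry turns an approximating sequence of integrands into a Cauchy sequence of
  integrals, and completeness gives the limit. This ensures that the selection in
  \<open>wiener_integral\<close> returns a genuine integral.\<close>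

lemma is_wiener_integral_exists:
  assumes f: "f \<in> L2 unit_interval"
  shows "\<exists>X. is_wiener_integral M W f X"
proof -
  obtain \<psi> where \<psi>: "\<And>m. \<psi> m \<in> step_functions" "L2_tendsto unit_interval \<psi> f"
    using L2_unit_interval_step_sequence[OF f] by blast
  have "\<forall>m. \<exists>N t c. mono_on {..N} t \<and> t ` {..N} \<subseteq> {0..1} \<and> step_fun N t c = \<psi> m"
    using step_function_is_step_fun[OF \<psi>(1)] by blast
  then obtain N t c where *: "\<And>m. mono_on {..N m} (t m)" "\<And>m. t m ` {..N m} \<subseteq> {0..1}"
    "\<And>m. step_fun (N m) (t m) (c m) = \<psi> m" by metis
  let ?X = "\<lambda>m. step_integral W (N m) (t m) (c m)"
  have el: "elementary (\<psi> m) (?X m)" for m using step_elementary[OF *(1,2), of m "c m"] *(3) by simp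
  note \<psi>L = \<psi>(2)[unfolded L2_tendsto_def]
  obtain X where "L2_tendsto M ?X X"
  proof (rule L2_complete)
    show "?X m \<in> L2 M" for m by (rule elementary_L2[OF el])
    fix e :: real assume "e > 0"
    then have "eventually (\<lambda>m. (\<integral>s. (\<psi> m s - f s)\<^sup>2 \<partial>unit_interval) < e / 4) sequentially"
      using \<psi>L by (intro order_tendstoD(2)[of _ 0]) auto
    then obtain K where K: "\<And>m. m \<ge> K \<Longrightarrow> (\<integral>s. (\<psi> m s - f s)\<^sup>2 \<partial>unit_interval) < e / 4"
      unfolding eventually_sequentially by blast
    have "expectation (\<lambda>\<omega>. (?X m \<omega> - ?X n \<omega>)\<^sup>2) < e" if "m \<ge> K" "n \<ge> K" for m n
    proof -
      have "wiener_pair (\<lambda>s. \<psi> m s - \<psi> n s) (\<lambda>\<omega>. ?X m \<omega> - ?X n \<omega>)"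
        by (intro wiener_pair_diff elementary_wiener_pair el)
      then have "expectation (\<lambda>\<omega>. (?X m \<omega> - ?X n \<omega>)\<^sup>2) = (\<integral>s. (\<psi> m s - \<psi> n s)\<^sup>2 \<partial>unit_interval)"
        by (subst wiener_pair_isometry) (simp_all add: inner_L2_def power2_eq_square)
      also have "(\<lambda>s. (\<psi> m s - \<psi> n s)\<^sup>2) = (\<lambda>s. ((\<psi> m s - f s) + (f s - \<psi> n s))\<^sup>2)" by simp
      also have "(\<integral>s. ((\<psi> m s - f s) + (f s - \<psi> n s))\<^sup>2 \<partial>unit_interval) \<le>
          2 * (\<integral>s. (\<psi> m s - f s)\<^sup>2 \<partial>unit_interval) + 2 * (\<integral>s. (f s - \<psi> n s)\<^sup>2 \<partial>unit_interval)"
        using \<psi>L by (intro L2_integral_square_add_le L2_diff) auto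
      also have "(\<integral>s. (f s - \<psi> n s)\<^sup>2 \<partial>unit_interval) = (\<integral>s. (\<psi> n s - f s)\<^sup>2 \<partial>unit_interval)"
        by (simp add: power2_commute)
      finally show ?thesis using K[OF that(1)] K[OF that(2)] by linarith
    qed
    then show "\<exists>K. \<forall>m\<ge>K. \<forall>n\<ge>K. expectation (\<lambda>\<omega>. (?X m \<omega> - ?X n \<omega>)\<^sup>2) < e" by blast
  qed
  then have "is_wiener_integral M W f X"
    unfolding is_wiener_integral_def
    by (intro exI[of _ N] exI[of _ t] exI[of _ c]) (use * \<psi>(2) in simp)
  then show ?thesis by blast
qed

lemma wiener_integral_pair: "f \<in> L2 unit_interval \<Longrightarrow> wiener_pair f (wiener_integral M W f)"
  unfolding wiener_integral_def
  by (rule is_wiener_integral_imp_pair[OF someI_ex[OF is_wiener_integral_exists]])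

end

section \<open>Hermite polynomials of Wiener integrals\<close>

context brownian_motion
begin

lemma wiener_pair_exp_mult:
  assumes "wiener_pair f X" "wiener_pair g Y"
  shows "integrable M (\<lambda>\<omega>. exp (Y \<omega>) * exp (s * X \<omega>))"
    and "expectation (\<lambda>\<omega>. exp (Y \<omega>) * exp (s * X \<omega>)) =
      exp (inner_L2 g g / 2) * (exp (s * inner_L2 f g) * exp (s\<^sup>2 * inner_L2 f f / 2))"
proof -
  have p: "wiener_pair (\<lambda>r. g r + s * f r) (\<lambda>\<omega>. Y \<omega> + s * X \<omega>)"
    by (intro wiener_pair_add wiener_pair_cmult assms)
  show "integrable M (\<lambda>\<omega>. exp (Y \<omega>) * exp (s * X \<omega>))"
    using wiener_pair_exp_integrable[OF p] by (simp add: exp_add)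
  have L: "(\<lambda>r. s * f r) \<in> L2 unit_interval" "g \<in> L2 unit_interval"
    using assms by (auto intro: L2_cmult dest: wiener_pair_L2)
  have "inner_L2 (\<lambda>r. g r + s * f r) (\<lambda>r. g r + s * f r) =
      inner_L2 g g + 2 * (s * inner_L2 f g) + s\<^sup>2 * inner_L2 f f"
    using inner_L2_square_add[OF L(2,1)] inner_L2_cmult_left[of s f] inner_L2_commute[of g "\<lambda>r. s * f r"]
      inner_L2_commute[of f "\<lambda>r. s * f r"] by (simp add: power2_eq_square)
  then show "expectation (\<lambda>\<omega>. exp (Y \<omega>) * exp (s * X \<omega>)) =
      exp (inner_L2 g g / 2) * (exp (s * inner_L2 f g) * exp (s\<^sup>2 * inner_L2 f f / 2))"
    using wiener_pair_exp[OF p] by (simp add: add_divide_distrib exp_add)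
qed

text \<open>When the variance parameter equals the squared norm of \<open>f\<close>, the Gaussian
  factor of the Hermite generating function cancels the variance term of \<open>X\<close>. Only
  \<open>exp (s * inner_L2 f g)\<close> and a constant remain, and comparing coefficients gives the
  formula.\<close>

lemma whermite_exp:
  assumes f: "wiener_pair f X" and g: "wiener_pair g Y"
  shows "integrable M (\<lambda>\<omega>. exp (Y \<omega>) * whermite v k (X \<omega>))"
    and "expectation (\<lambda>\<omega>. exp (Y \<omega>) * whermite (inner_L2 f f) k (X \<omega>)) =
      inner_L2 f g ^ k / fact k * exp (inner_L2 g g / 2)"
proof -
  have [measurable]: "X \<in> borel_measurable M" "Y \<in> borel_measurable M"
    using assms by (auto dest: wiener_pair_measurable)
  note * = wiener_pair_exp_mult[OF assms]
  show "integrable M (\<lambda>\<omega>. exp (Y \<omega>) * whermite v k (X \<omega>))"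
    by (rule integrable_mult_whermite[OF _ _ *(1)]) auto
  have "(\<lambda>k. expectation (\<lambda>\<omega>. exp (Y \<omega>) * whermite (inner_L2 f f) k (X \<omega>)) * s ^ k) sums
      (exp (inner_L2 g g / 2) * exp (s * inner_L2 f g))" for s
  proof -
    have "expectation (\<lambda>\<omega>. exp (Y \<omega>) * exp (s * X \<omega>)) * exp (- (s\<^sup>2 * inner_L2 f f / 2)) =
        exp (inner_L2 g g / 2) * exp (s * inner_L2 f g)"
      unfolding *(2) by (simp add: exp_minus)
    then show ?thesis using whermite_sums[OF _ _ *(1), of "inner_L2 f f" s] by simp
  qed
  moreover have "(\<lambda>k. inner_L2 f g ^ k / fact k * exp (inner_L2 g g / 2) * s ^ k) sums
      (exp (inner_L2 g g / 2) * exp (s * inner_L2 f g))" for s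
    using sums_mult[OF exp_converges[of "s * inner_L2 f g"], of "exp (inner_L2 g g / 2)"]
    by (simp add: power_mult_distrib field_simps)
  ultimately show "expectation (\<lambda>\<omega>. exp (Y \<omega>) * whermite (inner_L2 f f) k (X \<omega>)) =
      inner_L2 f g ^ k / fact k * exp (inner_L2 g g / 2)"
    by (rule powser_eq_imp_coeff_eq)
qed

lemma whermite_mult_integrable:
  assumes f: "wiener_pair f X" and g: "wiener_pair g Y"
  shows "integrable M (\<lambda>\<omega>. whermite w j (Y \<omega>) * whermite v k (X \<omega>))"
proof (rule integrable_mult_whermite)
  show "X \<in> borel_measurable M" using f by (rule wiener_pair_measurable)
  show "(\<lambda>\<omega>. whermite w j (Y \<omega>)) \<in> borel_measurable M"
    using wiener_pair_measurable[OF g] by measurable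
  show "integrable M (\<lambda>\<omega>. whermite w j (Y \<omega>) * exp (s * X \<omega>))" for s
    using whermite_exp(1)[OF g wiener_pair_cmult[OF f], of s w j] by (simp add: mult.commute)
qed

text \<open>The general series is applied once more, now weighted by a Hermite polynomial of
  \<open>Y\<close>. After the Gaussian cancellation a single monomial in \<open>s\<close> is left,
  so all other degrees vanish. The division by \<open>fact j\<close> reflects the normalisation of
  \<open>whermite\<close>: two factors \<open>1 / fact j\<close> meet one
  \<open>fact j\<close>.\<close>

lemma whermite_orthogonal:
  assumes f: "wiener_pair f X" and g: "wiener_pair g Y"
  shows "expectation (\<lambda>\<omega>. whermite (inner_L2 g g) j (Y \<omega>) * whermite (inner_L2 f f) k (X \<omega>)) =
    (if k = j then inner_L2 f g ^ j / fact j else 0)"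
proof -
  have [measurable]: "X \<in> borel_measurable M" "Y \<in> borel_measurable M"
    using assms by (auto dest: wiener_pair_measurable)
  have int: "integrable M (\<lambda>\<omega>. whermite (inner_L2 g g) j (Y \<omega>) * exp (s * X \<omega>))" for s
    using whermite_exp(1)[OF g wiener_pair_cmult[OF f], of s "inner_L2 g g" j] by (simp add: mult.commute)
  have E: "expectation (\<lambda>\<omega>. whermite (inner_L2 g g) j (Y \<omega>) * exp (s * X \<omega>)) =
      inner_L2 f g ^ j / fact j * s ^ j * exp (s\<^sup>2 * inner_L2 f f / 2)" for s
  proof -
    have "inner_L2 g (\<lambda>r. s * f r) = s * inner_L2 f g"
      by (metis inner_L2_cmult_left inner_L2_commute)
    moreover have "inner_L2 (\<lambda>r. s * f r) (\<lambda>r. s * f r) = s\<^sup>2 * inner_L2 f f"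
      by (simp add: inner_L2_def power2_eq_square mult_ac)
    ultimately show ?thesis
      using whermite_exp(2)[OF g wiener_pair_cmult[OF f], of s j]
      by (simp add: mult.commute power_mult_distrib)
  qed
  have "(\<lambda>k. expectation (\<lambda>\<omega>. whermite (inner_L2 g g) j (Y \<omega>) * whermite (inner_L2 f f) k (X \<omega>)) * s ^ k) sums
      (inner_L2 f g ^ j / fact j * s ^ j)" for s
  proof -
    have "expectation (\<lambda>\<omega>. whermite (inner_L2 g g) j (Y \<omega>) * exp (s * X \<omega>)) * exp (- (s\<^sup>2 * inner_L2 f f / 2))
        = inner_L2 f g ^ j / fact j * s ^ j"
      unfolding E by (simp add: exp_minus)
    then show ?thesis using whermite_sums[OF _ _ int, of "inner_L2 f f" s] by simp
  qed
  moreover have "(\<lambda>k. (if k = j then inner_L2 f g ^ j / fact j else 0) * s ^ k) sums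
      (inner_L2 f g ^ j / fact j * s ^ j)" for s
    using sums_single[of j "\<lambda>k. inner_L2 f g ^ j / fact j * s ^ k"] by (simp add: if_distrib[of "\<lambda>x. x * _"] cong: if_cong)
  ultimately show ?thesis by (rule powser_eq_imp_coeff_eq)
qed

lemma whermite_L2:
  assumes "wiener_pair f X" shows "(\<lambda>\<omega>. whermite v k (X \<omega>)) \<in> L2 M"
  using whermite_mult_integrable[OF assms assms, of v k v k] wiener_pair_measurable[OF assms]
  by (intro L2I) (simp_all add: power2_eq_square)

section \<open>Wick exponentials determine square-integrable functionals\<close>

lemma wick_exp_expectation:
  "expectation (\<lambda>\<omega>. Z \<omega> * wick_exp M W g \<omega>) =
    expectation (\<lambda>\<omega>. Z \<omega> * exp (wiener_integral M W g \<omega>)) * exp (- (inner_L2 g g / 2))"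
  unfolding wick_exp_def exp_diff exp_minus by (simp add: field_simps flip: integral_mult_left_zero)

lemma whermite_wick_exp:
  assumes "wiener_pair f X" "g \<in> L2 unit_interval"
  shows "expectation (\<lambda>\<omega>. whermite (inner_L2 f f) k (X \<omega>) * wick_exp M W g \<omega>) = inner_L2 f g ^ k / fact k"
proof -
  note g = wiener_integral_pair[OF assms(2)]
  show ?thesis
    using whermite_exp(2)[OF assms(1) g, of k] wick_exp_expectation[of "\<lambda>\<omega>. whermite (inner_L2 f f) k (X \<omega>)" g]
    by (simp add: mult.commute exp_minus)
qed

lemma W_measurable_subset: "T \<subseteq> {0..1} \<Longrightarrow> t \<in> T \<Longrightarrow> W t \<in> borel_measurable M"
  using W_measurable by auto

lemma subalgebra_generated: "T \<subseteq> {0..1} \<Longrightarrow> subalgebra M (generated_sigma M W T)"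
  by (rule subalgebra_generated_sigma) (rule W_measurable_subset)

text \<open>The predicate \<open>V\<close> selects the integrands whose Wick exponentials are
  tested. It is constantly true when totality is proved; for conditional expectations it demands
  equal inner products with two given functions. In either case it need only contain 0 and be stable
  under adding multiples of the indicators belonging to \<open>T\<close>.\<close>

lemma orthogonal_generated_sigma:
  assumes Z: "Z \<in> L2 M" and T: "T \<subseteq> {0..1}"
    and V0: "V (\<lambda>_. 0)"
    and V1: "\<And>\<phi> t s. V \<phi> \<Longrightarrow> \<phi> \<in> L2 unit_interval \<Longrightarrow> t \<in> T \<Longrightarrow> V (\<lambda>r. \<phi> r + s * indicator {0<..t} r)"
    and zero: "\<And>\<phi>. V \<phi> \<Longrightarrow> \<phi> \<in> L2 unit_interval \<Longrightarrow> expectation (\<lambda>\<omega>. Z \<omega> * wick_exp M W \<phi> \<omega>) = 0"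
    and B: "B \<in> sets (generated_sigma M W T)"
  shows "(LINT \<omega>:B|M. Z \<omega>) = 0"
proof (rule exponential_orthogonal_imp_set_integral_zero[where V = "{v. \<exists>\<phi>. wiener_pair \<phi> v \<and> V \<phi>}" and T = T])
  show Zm: "Z \<in> borel_measurable M" using Z by (rule L2_measurable)
  show "W t \<in> borel_measurable M" if "t \<in> T" for t using W_measurable_subset[OF T that] .
  show "v \<in> borel_measurable M" if "v \<in> {v. \<exists>\<phi>. wiener_pair \<phi> v \<and> V \<phi>}" for v
    using that by (auto dest: wiener_pair_measurable)
  show "(\<lambda>_. 0) \<in> {v. \<exists>\<phi>. wiener_pair \<phi> v \<and> V \<phi>}" using wiener_pair_zero V0 by blast
  show "(\<lambda>\<omega>. v \<omega> + s * W t \<omega>) \<in> {v. \<exists>\<phi>. wiener_pair \<phi> v \<and> V \<phi>}"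
    if v: "v \<in> {v. \<exists>\<phi>. wiener_pair \<phi> v \<and> V \<phi>}" and t: "t \<in> T" for v t s
  proof -
    obtain \<phi> where \<phi>: "wiener_pair \<phi> v" "V \<phi>" using v by blast
    have "wiener_pair (\<lambda>r. \<phi> r + s * indicator {0<..t} r) (\<lambda>\<omega>. v \<omega> + s * W t \<omega>)"
      using t T by (intro wiener_pair_add \<phi> wiener_pair_cmult elementary_wiener_pair elementary_indicator) auto
    moreover have "V (\<lambda>r. \<phi> r + s * indicator {0<..t} r)"
      by (rule V1[OF \<phi>(2) wiener_pair_L2(1)[OF \<phi>(1)] t])
    ultimately show ?thesis by blast
  qed
  fix v assume "v \<in> {v. \<exists>\<phi>. wiener_pair \<phi> v \<and> V \<phi>}"
  then obtain \<phi> where \<phi>: "wiener_pair \<phi> v" "V \<phi>" by blast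
  note \<phi>L = wiener_pair_L2(1)[OF \<phi>(1)]
  note I = wiener_integral_pair[OF \<phi>L]
  show "integrable M (\<lambda>\<omega>. Z \<omega> * exp (v \<omega>))"
    by (rule L2_integrable_mult[OF Z wiener_pair_exp_L2[OF \<phi>(1)]])
  have "expectation (\<lambda>\<omega>. Z \<omega> * exp (v \<omega>)) = expectation (\<lambda>\<omega>. Z \<omega> * exp (wiener_integral M W \<phi> \<omega>))"
    using wiener_pair_unique[OF \<phi>(1) I] Zm wiener_pair_measurable[OF \<phi>(1)] wiener_pair_measurable[OF I]
    by (intro integral_cong_AE) (auto elim: eventually_mono)
  also have "\<dots> = 0" using zero[OF \<phi>(2) \<phi>L] wick_exp_expectation[of Z \<phi>] by simp
  finally show "expectation (\<lambda>\<omega>. Z \<omega> * exp (v \<omega>)) = 0" .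
qed (rule B)

text \<open>Every event agrees, up to a null set, with one generated by \<open>W\<close>, because of
  the completion assumption. Integrals of \<open>Z\<close> over arbitrary events thus reduce to
  generated ones, and an integrable function whose integrals over all events vanish is null.\<close>

lemma wick_exp_total:
  assumes Z: "Z \<in> L2 M"
    and zero: "\<And>g. g \<in> L2 unit_interval \<Longrightarrow> expectation (\<lambda>\<omega>. Z \<omega> * wick_exp M W g \<omega>) = 0"
  shows "AE \<omega> in M. Z \<omega> = 0"
proof (rule density_zero[OF L2_integrable[OF Z]])
  let ?F = "generated_sigma M W {0..1}"
  have sub: "subalgebra M ?F" by (rule subalgebra_generated) simp
  fix A assume "A \<in> sets M"
  then have "A \<in> sets (completion (restr_to_subalg M ?F))" using sets_eq_completion by simp
  then obtain S N N' where A: "A = S \<union> N" "N \<subseteq> N'" "N' \<in> null_sets (restr_to_subalg M ?F)"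
      "S \<in> sets (restr_to_subalg M ?F)"
    by (auto simp: sets_completion)
  have S: "S \<in> sets ?F" using A(4) sets_restr_to_subalg[OF sub] by simp
  then have SM: "S \<in> sets M" using sub by (auto simp: subalgebra_def)
  have N': "N' \<in> null_sets M" using A(3) null_sets_restr_to_subalg[OF sub] by auto
  have "AE \<omega> in M. \<omega> \<notin> N'" by (rule AE_not_in[OF N'])
  then have "AE \<omega> in M. indicator A \<omega> *\<^sub>R Z \<omega> = indicator S \<omega> *\<^sub>R Z \<omega>"
    by eventually_elim (use A in \<open>auto simp: indicator_def\<close>)
  then have "(LINT \<omega>:A|M. Z \<omega>) = (LINT \<omega>:S|M. Z \<omega>)"
    unfolding set_lebesgue_integral_def
    by (rule integral_cong_AE[rotated 2]) (use \<open>A \<in> sets M\<close> SM L2_measurable[OF Z] in auto)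
  also have "\<dots> = 0"
    by (rule orthogonal_generated_sigma[OF Z _ _ _ _ S, where V = "\<lambda>_. True"]) (use zero in auto)
  finally show "(LINT \<omega>:A|M. Z \<omega>) = 0" .
qed

lemma wick_exp_L2:
  assumes "g \<in> L2 unit_interval" shows "wick_exp M W g \<in> L2 M"
proof -
  have "wick_exp M W g = (\<lambda>\<omega>. exp (- (inner_L2 g g / 2)) * exp (wiener_integral M W g \<omega>))"
    by (rule ext) (simp add: wick_exp_def flip: exp_add)
  then show ?thesis using L2_cmult[OF wiener_pair_exp_L2[OF wiener_integral_pair[OF assms]]] by simp
qed

text \<open>The Hermite polynomial of the next degree satisfies the defining pairing identity, so
  the selection in \<open>wick_product\<close> has a witness; totality of the Wick exponentials
  identifies the selected function with it almost surely. Membership in L2 travels through the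
  induction because it provides the measurability of the previous power.\<close>

lemma wick_power_whermite:
  assumes f: "f \<in> L2 unit_interval"
  shows "wick_power M W (wiener_integral M W f) k \<in> L2 M \<and>
    (AE \<omega> in M. wick_power M W (wiener_integral M W f) k \<omega> =
      fact k * whermite (inner_L2 f f) k (wiener_integral M W f \<omega>))"
proof (induction k)
  case 0
  show ?case by (simp add: whermite_0 L2_def)
next
  case (Suc k)
  let ?X = "wiener_integral M W f" and ?v = "inner_L2 f f"
  let ?P = "wick_power M W ?X k" and ?Z = "wick_product M W ?X (wick_power M W ?X k)"
  let ?H = "\<lambda>\<omega>. fact (Suc k) * whermite ?v (Suc k) (?X \<omega>)"
  note X = wiener_integral_pair[OF f]
  have eX: "expectation (\<lambda>\<omega>. ?X \<omega> * wick_exp M W g \<omega>) = inner_L2 f g"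
    if "g \<in> L2 unit_interval" for g
    using whermite_wick_exp[OF X that, of "Suc 0"] by (simp add: whermite_1)
  have eP: "expectation (\<lambda>\<omega>. ?P \<omega> * wick_exp M W g \<omega>) = inner_L2 f g ^ k"
    if g: "g \<in> L2 unit_interval" for g
  proof -
    have "expectation (\<lambda>\<omega>. ?P \<omega> * wick_exp M W g \<omega>) =
        expectation (\<lambda>\<omega>. fact k * (whermite ?v k (?X \<omega>) * wick_exp M W g \<omega>))"
      using Suc.IH L2_measurable[OF wick_exp_L2[OF g]] L2_measurable[OF conjunct1[OF Suc.IH]]
        wiener_pair_measurable[OF X]
      by (intro integral_cong_AE) (auto elim: eventually_mono)
    then show ?thesis using whermite_wick_exp[OF X g, of k] by simp
  qed
  have H: "?H \<in> L2 M" by (intro L2_cmult whermite_L2[OF X])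
  have eH: "expectation (\<lambda>\<omega>. ?H \<omega> * wick_exp M W g \<omega>) = inner_L2 f g ^ Suc k"
    if g: "g \<in> L2 unit_interval" for g
  proof -
    have "expectation (\<lambda>\<omega>. ?H \<omega> * wick_exp M W g \<omega>) =
        fact (Suc k) * expectation (\<lambda>\<omega>. whermite ?v (Suc k) (?X \<omega>) * wick_exp M W g \<omega>)"
      by (simp add: mult.assoc del: fact_Suc)
    then show ?thesis using whermite_wick_exp[OF X g, of "Suc k"] by (simp del: fact_Suc)
  qed
  have "is_wick_product M W ?X ?P ?H"
    unfolding is_wick_product_def using H eX eP eH by simp
  then have "is_wick_product M W ?X ?P ?Z" unfolding wick_product_def
    by (rule someI[where P = "is_wick_product M W ?X ?P"])
  then have Z: "?Z \<in> L2 M"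
    and eZ: "\<And>g. g \<in> L2 unit_interval \<Longrightarrow> expectation (\<lambda>\<omega>. ?Z \<omega> * wick_exp M W g \<omega>) = inner_L2 f g ^ Suc k"
    unfolding is_wick_product_def using eX eP by auto
  have "AE \<omega> in M. ?Z \<omega> - ?H \<omega> = 0"
  proof (rule wick_exp_total)
    show "(\<lambda>\<omega>. ?Z \<omega> - ?H \<omega>) \<in> L2 M" by (intro L2_diff Z H)
    fix g assume g: "g \<in> L2 unit_interval"
    show "expectation (\<lambda>\<omega>. (?Z \<omega> - ?H \<omega>) * wick_exp M W g \<omega>) = 0"
      unfolding left_diff_distrib
      using L2_integrable_mult[OF Z wick_exp_L2[OF g]] L2_integrable_mult[OF H wick_exp_L2[OF g]] eZ[OF g] eH[OF g]
      by simp
  qed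
  then show ?case using Z by simp
qed

section \<open>Series of Wick powers\<close>

text \<open>The factor \<open>fact k\<close> undoes the normalisation of \<open>whermite\<close>, so
  the coefficients are those of the Wick powers. The random variable is arbitrary, which allows a
  representative that is measurable for the grid.\<close>

definition hermite_sum :: "real \<Rightarrow> (nat \<Rightarrow> real) \<Rightarrow> ('a \<Rightarrow> real) \<Rightarrow> nat \<Rightarrow> 'a \<Rightarrow> real" where
  "hermite_sum v a X n \<omega> = (\<Sum>k<n. a k * fact k * whermite v k (X \<omega>))"

lemma hermite_sum_L2: "wiener_pair f X \<Longrightarrow> hermite_sum v a X n \<in> L2 M"
  unfolding hermite_sum_def[abs_def] by (intro L2_sum L2_cmult whermite_L2)

lemma wick_term_sum_AE:
  assumes "f \<in> L2 unit_interval"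
  shows "AE \<omega> in M. (\<Sum>k<n. wick_term M W f a k \<omega>) = hermite_sum (inner_L2 f f) a (wiener_integral M W f) n \<omega>"
proof -
  have "AE \<omega> in M. \<forall>k. wick_power M W (wiener_integral M W f) k \<omega> =
      fact k * whermite (inner_L2 f f) k (wiener_integral M W f \<omega>)"
    using wick_power_whermite[OF assms] by (simp add: AE_all_countable)
  then show ?thesis by eventually_elim (simp add: wick_term_def hermite_sum_def mult.assoc)
qed

lemma wick_term_sum_measurable:
  assumes "f \<in> L2 unit_interval"
  shows "(\<lambda>\<omega>. \<Sum>k<n. wick_term M W f a k \<omega>) \<in> borel_measurable M"
  unfolding wick_term_def
  by (intro borel_measurable_sum borel_measurable_times L2_measurable)
    (use wick_power_whermite[OF assms] in \<open>auto simp: L2_def\<close>)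

lemma L2_sums_wick_term_iff:
  assumes f: "f \<in> L2 unit_interval"
  shows "L2_sums M (wick_term M W f a) F \<longleftrightarrow>
    L2_tendsto M (hermite_sum (inner_L2 f f) a (wiener_integral M W f)) F"
proof
  let ?H = "hermite_sum (inner_L2 f f) a (wiener_integral M W f)"
  have Hm: "?H n \<in> borel_measurable M" for n
    by (rule L2_measurable[OF hermite_sum_L2[OF wiener_integral_pair[OF f]]])
  note AE = wick_term_sum_AE[OF f]
  {
    assume "L2_sums M (wick_term M W f a) F"
    then have *: "L2_tendsto M (\<lambda>n \<omega>. \<Sum>k<n. wick_term M W f a k \<omega>) F" by (simp add: L2_sums_def)
    then have "F \<in> borel_measurable M" by (auto simp: L2_tendsto_def L2_def)
    then show "L2_tendsto M ?H F"
      by (intro L2_tendsto_cong_AE[OF * Hm]) (use AE in auto)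
  }
  {
    assume *: "L2_tendsto M ?H F"
    then have "F \<in> borel_measurable M" by (auto simp: L2_tendsto_def L2_def)
    then have "L2_tendsto M (\<lambda>n \<omega>. \<Sum>k<n. wick_term M W f a k \<omega>) F"
      by (intro L2_tendsto_cong_AE[OF * wick_term_sum_measurable[OF f]])
        (use AE in \<open>simp_all add: eq_commute\<close>)
    then show "L2_sums M (wick_term M W f a) F" by (simp add: L2_sums_def)
  }
qed

lemma hermite_sum_inner:
  assumes f: "wiener_pair f X" and g: "wiener_pair g Y"
  shows "expectation (\<lambda>\<omega>. hermite_sum (inner_L2 f f) a X n \<omega> * hermite_sum (inner_L2 g g) b Y n \<omega>) =
    (\<Sum>k<n. fact k * a k * b k * inner_L2 f g ^ k)"
proof -
  let ?h = "\<lambda>j k \<omega>. whermite (inner_L2 g g) j (Y \<omega>) * whermite (inner_L2 f f) k (X \<omega>)"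
  have "hermite_sum (inner_L2 f f) a X n \<omega> * hermite_sum (inner_L2 g g) b Y n \<omega> =
      (\<Sum>k<n. \<Sum>j<n. (a k * fact k * (b j * fact j)) * ?h j k \<omega>)" for \<omega>
    unfolding hermite_sum_def sum_product by (intro sum.cong refl) (simp add: mult_ac)
  then have "expectation (\<lambda>\<omega>. hermite_sum (inner_L2 f f) a X n \<omega> * hermite_sum (inner_L2 g g) b Y n \<omega>) =
      (\<Sum>k<n. \<Sum>j<n. (a k * fact k * (b j * fact j)) * expectation (?h j k))"
    by (simp add: Bochner_Integration.integral_sum integrable_mult_right whermite_mult_integrable[OF f g])
  also have "\<dots> = (\<Sum>k<n. \<Sum>j<n. if j = k then (a k * fact k * (b k * fact k)) * (inner_L2 f g ^ k / fact k) else 0)"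
    unfolding whermite_orthogonal[OF f g] by (intro sum.cong refl) auto
  also have "\<dots> = (\<Sum>k<n. fact k * a k * b k * inner_L2 f g ^ k)"
    by (simp add: field_simps)
  finally show ?thesis .
qed

lemma wick_series_inner_sums:
  assumes f: "f \<in> L2 unit_interval" and g: "g \<in> L2 unit_interval"
    and F: "L2_sums M (wick_term M W f a) F" and G: "L2_sums M (wick_term M W g b) G"
  shows "(\<lambda>k. fact k * a k * b k * inner_L2 f g ^ k) sums expectation (\<lambda>\<omega>. F \<omega> * G \<omega>)"
  using L2_tendsto_inner[OF F[unfolded L2_sums_wick_term_iff[OF f]] G[unfolded L2_sums_wick_term_iff[OF g]]]
  unfolding hermite_sum_inner[OF wiener_integral_pair[OF f] wiener_integral_pair[OF g]] sums_def .

text \<open>By orthogonality the squared distance of two partial sums is a block of the given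
  numerical series, so completeness applies. It makes the selection in
  \<open>wick_derivative\<close> meaningful.\<close>

lemma wick_series_exists:
  assumes f: "f \<in> L2 unit_interval"
    and sm: "summable (\<lambda>k. fact k * (a k)\<^sup>2 * inner_L2 f f ^ k)"
  shows "\<exists>D. L2_sums M (wick_term M W f a) D"
proof -
  let ?v = "inner_L2 f f" and ?X = "wiener_integral M W f"
  note X = wiener_integral_pair[OF f]
  have diff: "expectation (\<lambda>\<omega>. (hermite_sum ?v a ?X n \<omega> - hermite_sum ?v a ?X m \<omega>)\<^sup>2) =
      (\<Sum>k=m..<n. fact k * (a k)\<^sup>2 * ?v ^ k)" if "m \<le> n" for m n
  proof -
    \<comment> \<open>With the coefficients below \<open>m\<close> set to zero, the difference of
      two partial sums is itself a Hermite sum, and the inner product formula covers it.\<close>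
    let ?a = "\<lambda>k. if m \<le> k then a k else 0"
    have "hermite_sum ?v a ?X n \<omega> - hermite_sum ?v a ?X m \<omega> = hermite_sum ?v ?a ?X n \<omega>" for \<omega>
    proof -
      have "hermite_sum ?v a ?X n \<omega> - hermite_sum ?v a ?X m \<omega> = (\<Sum>k=m..<n. a k * fact k * whermite ?v k (?X \<omega>))"
        unfolding hermite_sum_def lessThan_atLeast0 using that by (intro sum_diff_nat_ivl) auto
      also have "\<dots> = hermite_sum ?v ?a ?X n \<omega>"
        unfolding hermite_sum_def by (intro sum.mono_neutral_cong_left) auto
      finally show ?thesis .
    qed
    then have "expectation (\<lambda>\<omega>. (hermite_sum ?v a ?X n \<omega> - hermite_sum ?v a ?X m \<omega>)\<^sup>2) =
        (\<Sum>k<n. fact k * ?a k * ?a k * ?v ^ k)"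
      using hermite_sum_inner[OF X X, of ?a n ?a] by (simp add: power2_eq_square)
    also have "\<dots> = (\<Sum>k=m..<n. fact k * (a k)\<^sup>2 * ?v ^ k)"
      by (rule sum.mono_neutral_cong_right) (auto simp: power2_eq_square)
    finally show ?thesis .
  qed
  obtain D where "L2_tendsto M (hermite_sum ?v a ?X) D"
  proof (rule L2_complete)
    show "hermite_sum ?v a ?X n \<in> L2 M" for n by (rule hermite_sum_L2[OF X])
    fix e :: real assume "e > 0"
    then obtain K where K: "\<And>m n. m \<ge> K \<Longrightarrow> norm (\<Sum>k=m..<n. fact k * (a k)\<^sup>2 * ?v ^ k) < e"
      using sm unfolding summable_Cauchy by blast
    have "expectation (\<lambda>\<omega>. (hermite_sum ?v a ?X m \<omega> - hermite_sum ?v a ?X n \<omega>)\<^sup>2) < e"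
      if "m \<ge> K" "n \<ge> K" for m n
    proof (cases "n \<le> m")
      case True
      then show ?thesis using diff[OF True] K[of n m] that by simp
    next
      case False
      then have "m \<le> n" by simp
      then show ?thesis using diff[OF \<open>m \<le> n\<close>] K[of m n] that by (simp add: power2_commute)
    qed
    then show "\<exists>K. \<forall>m\<ge>K. \<forall>n\<ge>K. expectation (\<lambda>\<omega>. (hermite_sum ?v a ?X m \<omega> - hermite_sum ?v a ?X n \<omega>)\<^sup>2) < e"
      by blast
  qed
  then show ?thesis using L2_sums_wick_term_iff[OF f] by blast
qed

end

text \<open>The root condition bounds \<open>fact k * \<bar>a k\<bar>\<close> by a geometric
  sequence for positive \<open>k\<close> only; the factor \<open>K\<close> absorbs the coefficient
  \<open>a 0\<close>.\<close>

lemma wick_analytic_coeff_bound: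
  assumes "wick_analytic M W f a F"
  obtains K C where "0 \<le> K" "0 \<le> C" "\<And>k. \<bar>a k\<bar> \<le> K * C ^ k / fact k"
proof -
  obtain B where B: "\<And>k. k \<ge> 1 \<Longrightarrow> root k (fact k * \<bar>a k\<bar>) \<le> B"
    using assms unfolding wick_analytic_def bdd_above_def by auto
  define C where "C = max B 0"
  define K where "K = max \<bar>a 0\<bar> 1"
  have "\<bar>a k\<bar> \<le> K * C ^ k / fact k" for k
  proof (cases "k = 0")
    case True
    then show ?thesis by (simp add: K_def)
  next
    case False
    then have k: "k > 0" by simp
    have "fact k * \<bar>a k\<bar> = root k (fact k * \<bar>a k\<bar>) ^ k" using k by (simp add: real_root_pow_pos2)
    also have "\<dots> \<le> C ^ k"
      using B[of k] k by (intro power_mono) (auto simp: C_def)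
    also have "\<dots> \<le> K * C ^ k"
      using mult_right_mono[of 1 K "C ^ k"] by (simp add: K_def C_def)
    finally show ?thesis by (simp add: field_simps)
  qed
  then show ?thesis using that[of K C] by (auto simp: K_def C_def)
qed

section \<open>Conditional expectations of Hermite sums\<close>

text \<open>Jensen's inequality for the square; it makes conditional expectation a contraction on
  L2.\<close>

lemma (in sigma_finite_subalgebra) real_cond_exp_L2:
  assumes "finite_measure M" and X: "X \<in> L2 M" "integrable M X"
  shows "real_cond_exp M F X \<in> L2 M"
    and "(\<integral>\<omega>. (real_cond_exp M F X \<omega>)\<^sup>2 \<partial>M) \<le> (\<integral>\<omega>. (X \<omega>)\<^sup>2 \<partial>M)"
proof -
  have q: "integrable M (\<lambda>\<omega>. (X \<omega>)\<^sup>2)" by (rule L2_integrable_square[OF X(1)])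
  have convex: "convex_on UNIV (\<lambda>x::real. x\<^sup>2)" by (rule convex_power2)
  have jensen: "AE \<omega> in M. (real_cond_exp M F X \<omega>)\<^sup>2 \<le> real_cond_exp M F (\<lambda>\<omega>. (X \<omega>)\<^sup>2) \<omega>"
    by (rule real_cond_exp_jensens_inequality(2)[where I = UNIV and q = "\<lambda>x. x\<^sup>2"])
      (use X q convex in auto)
  have int: "integrable M (\<lambda>\<omega>. (real_cond_exp M F X \<omega>)\<^sup>2)"
    by (rule integrable_convex_cond_exp[where I = UNIV and q = "\<lambda>x. x\<^sup>2"])
      (use X q convex in auto)
  then show "real_cond_exp M F X \<in> L2 M" by (intro L2I) auto
  have "(\<integral>\<omega>. (real_cond_exp M F X \<omega>)\<^sup>2 \<partial>M) \<le> (\<integral>\<omega>. real_cond_exp M F (\<lambda>\<omega>. (X \<omega>)\<^sup>2) \<omega> \<partial>M)"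
    by (rule integral_mono_AE[OF int real_cond_exp_int(1)[OF q] jensen])
  then show "(\<integral>\<omega>. (real_cond_exp M F X \<omega>)\<^sup>2 \<partial>M) \<le> (\<integral>\<omega>. (X \<omega>)\<^sup>2 \<partial>M)"
    by (simp add: real_cond_exp_int(2)[OF q])
qed

context brownian_motion
begin

lemma sigma_finite_generated:
  assumes "T \<subseteq> {0..1}" shows "sigma_finite_subalgebra M (generated_sigma M W T)"
proof -
  have "finite_measure_subalgebra M (generated_sigma M W T)"
    by unfold_locales (rule subalgebra_generated[OF assms])
  then show ?thesis by (rule finite_measure_subalgebra_is_sigma_finite)
qed

lemma hermite_sum_wick_exp:
  assumes "wiener_pair f X" "g \<in> L2 unit_interval"
  shows "expectation (\<lambda>\<omega>. hermite_sum (inner_L2 f f) a X n \<omega> * wick_exp M W g \<omega>) =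
    (\<Sum>k<n. a k * inner_L2 f g ^ k)"
proof -
  have "integrable M (\<lambda>\<omega>. whermite (inner_L2 f f) k (X \<omega>) * wick_exp M W g \<omega>)" for k
    by (intro L2_integrable_mult whermite_L2[OF assms(1)] wick_exp_L2[OF assms(2)])
  then have "expectation (\<lambda>\<omega>. hermite_sum (inner_L2 f f) a X n \<omega> * wick_exp M W g \<omega>) =
      (\<Sum>k<n. a k * fact k * expectation (\<lambda>\<omega>. whermite (inner_L2 f f) k (X \<omega>) * wick_exp M W g \<omega>))"
    unfolding hermite_sum_def sum_distrib_right mult.assoc
    by (subst Bochner_Integration.integral_sum) (auto simp: mult.assoc)
  then show ?thesis by (simp add: whermite_wick_exp[OF assms])
qed

text \<open>The pairing of a Hermite sum with a Wick exponential sees its integrand only through one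
  inner product. The test class can therefore be taken as all \<open>h\<close> with
  \<open>inner_L2 f h = inner_L2 \<phi> h\<close>; it is stable under adding the indicators of
  \<open>T\<close>, and no description of the grid step functions is required.\<close>

lemma cond_exp_hermite_sum:
  assumes f: "wiener_pair f X" and \<phi>: "wiener_pair \<phi> Y" and T: "T \<subseteq> {0..1}"
    and Y: "Y \<in> borel_measurable (generated_sigma M W T)"
    and proj: "\<And>t. t \<in> T \<Longrightarrow> inner_L2 f (indicator {0<..t}) = inner_L2 \<phi> (indicator {0<..t})"
  shows "AE \<omega> in M. real_cond_exp M (generated_sigma M W T) (hermite_sum (inner_L2 f f) a X n) \<omega> =
    hermite_sum (inner_L2 \<phi> \<phi>) a Y n \<omega>"
proof -
  let ?G = "generated_sigma M W T"
  let ?P = "hermite_sum (inner_L2 f f) a X n" and ?Q = "hermite_sum (inner_L2 \<phi> \<phi>) a Y n"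
  interpret sigma_finite_subalgebra M ?G by (rule sigma_finite_generated[OF T])
  have P: "?P \<in> L2 M" and Q: "?Q \<in> L2 M" using f \<phi> by (auto intro: hermite_sum_L2)
  have PQ: "(\<lambda>\<omega>. ?P \<omega> - ?Q \<omega>) \<in> L2 M" by (rule L2_diff[OF P Q])
  note fL = wiener_pair_L2(1)[OF f] and \<phi>L = wiener_pair_L2(1)[OF \<phi>]
  show ?thesis
  proof (rule real_cond_exp_charact)
    fix B assume B: "B \<in> sets ?G"
    have "(LINT \<omega>:B|M. ?P \<omega> - ?Q \<omega>) = 0"
    proof (rule orthogonal_generated_sigma[OF PQ T _ _ _ B, where V = "\<lambda>h. inner_L2 f h = inner_L2 \<phi> h"])
      show "inner_L2 f (\<lambda>_. 0) = inner_L2 \<phi> (\<lambda>_. 0)" by (simp add: inner_L2_def)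
      show "inner_L2 f (\<lambda>r. h r + s * indicator {0<..t} r) = inner_L2 \<phi> (\<lambda>r. h r + s * indicator {0<..t} r)"
        if "inner_L2 f h = inner_L2 \<phi> h" "h \<in> L2 unit_interval" "t \<in> T" for h t s
      proof -
        have I: "indicator {0<..t} \<in> L2 unit_interval" by (rule indicator_L2_unit_interval) simp
        have "inner_L2 (\<lambda>r. h r + s * indicator {0<..t} r) u = inner_L2 h u + s * inner_L2 (indicator {0<..t}) u"
          if "u \<in> L2 unit_interval" for u
          using inner_L2_add_left[OF \<open>h \<in> L2 unit_interval\<close> L2_cmult[OF I, of s] that] by (simp add: inner_L2_cmult_left)
        then show ?thesis using fL \<phi>L that(1) proj[OF that(3)]
          by (simp add: inner_L2_commute[of f] inner_L2_commute[of \<phi>])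
      qed
      show "expectation (\<lambda>\<omega>. (?P \<omega> - ?Q \<omega>) * wick_exp M W h \<omega>) = 0"
        if "inner_L2 f h = inner_L2 \<phi> h" "h \<in> L2 unit_interval" for h
        using that hermite_sum_wick_exp[OF f that(2), of a n] hermite_sum_wick_exp[OF \<phi> that(2), of a n]
        by (simp add: left_diff_distrib L2_integrable_mult[OF P wick_exp_L2] L2_integrable_mult[OF Q wick_exp_L2])
    qed
    moreover have BM: "B \<in> sets M" using B subalg by (auto simp: subalgebra_def)
    have "set_integrable M B ?P" "set_integrable M B ?Q"
      unfolding set_integrable_def
      by (rule integrable_mult_indicator[OF BM L2_integrable[OF P]],
          rule integrable_mult_indicator[OF BM L2_integrable[OF Q]])
    ultimately show "(LINT \<omega>:B|M. ?P \<omega>) = (LINT \<omega>:B|M. ?Q \<omega>)"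
      by (simp add: set_integral_diff)
  next
    show "?Q \<in> borel_measurable ?G" unfolding hermite_sum_def[abs_def] using Y by measurable
  qed (auto intro: L2_integrable P Q)
qed

text \<open>Conditional expectations are identified for finite Hermite sums; the contraction
  property transfers this to the full series.\<close>

lemma cond_exp_L2_tendsto:
  assumes T: "T \<subseteq> {0..1}" and P: "L2_tendsto M P F"
    and Q: "\<And>n. Q n \<in> borel_measurable M"
    and PQ: "\<And>n. AE \<omega> in M. real_cond_exp M (generated_sigma M W T) (P n) \<omega> = Q n \<omega>"
  shows "L2_tendsto M Q (real_cond_exp M (generated_sigma M W T) F)"
proof -
  let ?E = "real_cond_exp M (generated_sigma M W T)"
  interpret sigma_finite_subalgebra M "generated_sigma M W T" by (rule sigma_finite_generated[OF T])
  have fin: "finite_measure M" by unfold_locales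
  have PL: "P n \<in> L2 M" and FL: "F \<in> L2 M" for n using P by (auto simp: L2_tendsto_def)
  have DL: "(\<lambda>\<omega>. P n \<omega> - F \<omega>) \<in> L2 M" for n by (rule L2_diff[OF PL FL])
  note Pi = L2_integrable[OF PL] and Fi = L2_integrable[OF FL]
  have EF: "?E F \<in> L2 M" by (rule real_cond_exp_L2(1)[OF fin FL Fi])
  have QL: "Q n \<in> L2 M" for n
    by (rule L2_cong_AE[OF real_cond_exp_L2(1)[OF fin PL Pi] Q PQ])
  have "expectation (\<lambda>\<omega>. (Q n \<omega> - ?E F \<omega>)\<^sup>2) \<le> expectation (\<lambda>\<omega>. (P n \<omega> - F \<omega>)\<^sup>2)" for n
  proof -
    have "AE \<omega> in M. (Q n \<omega> - ?E F \<omega>)\<^sup>2 = (?E (\<lambda>\<omega>. P n \<omega> - F \<omega>) \<omega>)\<^sup>2"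
      using PQ[of n] real_cond_exp_diff[OF Pi[of n] Fi] by eventually_elim simp
    then have "expectation (\<lambda>\<omega>. (Q n \<omega> - ?E F \<omega>)\<^sup>2) = expectation (\<lambda>\<omega>. (?E (\<lambda>\<omega>. P n \<omega> - F \<omega>) \<omega>)\<^sup>2)"
      by (rule integral_cong_AE[rotated 2]) (use Q in auto)
    also have "\<dots> \<le> expectation (\<lambda>\<omega>. (P n \<omega> - F \<omega>)\<^sup>2)"
      by (rule real_cond_exp_L2(2)[OF fin DL L2_integrable[OF DL]])
    finally show ?thesis .
  qed
  moreover have "(\<lambda>n. expectation (\<lambda>\<omega>. (P n \<omega> - F \<omega>)\<^sup>2)) \<longlonglongrightarrow> 0" using P by (simp add: L2_tendsto_def)
  ultimately have "(\<lambda>n. expectation (\<lambda>\<omega>. (Q n \<omega> - ?E F \<omega>)\<^sup>2)) \<longlonglongrightarrow> 0"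
    by (intro tendsto_sandwich[OF _ _ tendsto_const, of 0 "\<lambda>n. expectation (\<lambda>\<omega>. (Q n \<omega> - ?E F \<omega>)\<^sup>2)" sequentially
        "\<lambda>n. expectation (\<lambda>\<omega>. (P n \<omega> - F \<omega>)\<^sup>2)"] always_eventually) auto
  then show ?thesis using QL EF by (simp add: L2_tendsto_def)
qed

text \<open>Multiplying out gives four expectations. By \<open>inner\<close> the two mixed ones
  equal the one of both projections, so with signs -, -, + a single subtracted power of
  \<open>inner_L2 \<phi> \<psi>\<close> survives.\<close>

lemma approximation_error_sums:
  assumes f: "f \<in> L2 unit_interval" and g: "g \<in> L2 unit_interval"
    and F: "L2_sums M (wick_term M W f a) F" and G: "L2_sums M (wick_term M W g b) G"
    and T: "T \<subseteq> {0..1}"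
    and \<phi>: "wiener_pair \<phi> X" "X \<in> borel_measurable (generated_sigma M W T)"
    and \<psi>: "wiener_pair \<psi> Y" "Y \<in> borel_measurable (generated_sigma M W T)"
    and proj: "\<And>t. t \<in> T \<Longrightarrow> inner_L2 f (indicator {0<..t}) = inner_L2 \<phi> (indicator {0<..t})"
      "\<And>t. t \<in> T \<Longrightarrow> inner_L2 g (indicator {0<..t}) = inner_L2 \<psi> (indicator {0<..t})"
    and inner: "inner_L2 f \<psi> = inner_L2 \<phi> \<psi>" "inner_L2 \<phi> g = inner_L2 \<phi> \<psi>"
  shows "(\<lambda>k. fact k * a k * b k * (inner_L2 f g ^ k - inner_L2 \<phi> \<psi> ^ k)) sums
    expectation (\<lambda>\<omega>. (F \<omega> - real_cond_exp M (generated_sigma M W T) F \<omega>) *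
      (G \<omega> - real_cond_exp M (generated_sigma M W T) G \<omega>))"
proof -
  let ?E = "real_cond_exp M (generated_sigma M W T)"
  note If = wiener_integral_pair[OF f] and Ig = wiener_integral_pair[OF g]
  let ?P = "hermite_sum (inner_L2 f f) a (wiener_integral M W f)" and ?Q = "hermite_sum (inner_L2 \<phi> \<phi>) a X"
  let ?R = "hermite_sum (inner_L2 g g) b (wiener_integral M W g)" and ?S = "hermite_sum (inner_L2 \<psi> \<psi>) b Y"
  have P: "L2_tendsto M ?P F" using F unfolding L2_sums_wick_term_iff[OF f] .
  have R: "L2_tendsto M ?R G" using G unfolding L2_sums_wick_term_iff[OF g] .
  note L = hermite_sum_L2[OF If] hermite_sum_L2[OF \<phi>(1)] hermite_sum_L2[OF Ig] hermite_sum_L2[OF \<psi>(1)]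
  have Q: "L2_tendsto M ?Q (?E F)"
    by (rule cond_exp_L2_tendsto[OF T P L2_measurable[OF L(2)] cond_exp_hermite_sum[OF If \<phi>(1) T \<phi>(2) proj(1)]])
  have S: "L2_tendsto M ?S (?E G)"
    by (rule cond_exp_L2_tendsto[OF T R L2_measurable[OF L(4)] cond_exp_hermite_sum[OF Ig \<psi>(1) T \<psi>(2) proj(2)]])
  have "expectation (\<lambda>\<omega>. (?P n \<omega> - ?Q n \<omega>) * (?R n \<omega> - ?S n \<omega>)) =
      (\<Sum>k<n. fact k * a k * b k * (inner_L2 f g ^ k - inner_L2 \<phi> \<psi> ^ k))" for n
  proof -
    have "expectation (\<lambda>\<omega>. (?P n \<omega> - ?Q n \<omega>) * (?R n \<omega> - ?S n \<omega>)) =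
        expectation (\<lambda>\<omega>. ?P n \<omega> * ?R n \<omega> - ?P n \<omega> * ?S n \<omega> - ?Q n \<omega> * ?R n \<omega> + ?Q n \<omega> * ?S n \<omega>)"
      by (simp add: algebra_simps)
    also have "\<dots> = expectation (\<lambda>\<omega>. ?P n \<omega> * ?R n \<omega>) - expectation (\<lambda>\<omega>. ?P n \<omega> * ?S n \<omega>)
        - expectation (\<lambda>\<omega>. ?Q n \<omega> * ?R n \<omega>) + expectation (\<lambda>\<omega>. ?Q n \<omega> * ?S n \<omega>)"
      by (simp add: L L2_integrable_mult)
    also have "\<dots> = (\<Sum>k<n. fact k * a k * b k * (inner_L2 f g ^ k - inner_L2 \<phi> \<psi> ^ k))"
      by (simp add: hermite_sum_inner If Ig \<phi>(1) \<psi>(1) inner right_diff_distrib sum_subtractf)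
    finally show ?thesis .
  qed
  then show ?thesis
    using L2_tendsto_inner[OF L2_tendsto_diff[OF P Q] L2_tendsto_diff[OF R S]]
    by (simp add: sums_def)
qed

end

section \<open>Averages over a uniform grid\<close>

definition cell :: "nat \<Rightarrow> nat \<Rightarrow> real set" where
  "cell n i = {real i / real n<..real (Suc i) / real n}"

text \<open>Since \<open>real n\<close> is the inverse cell length, each coefficient is the mean of
  \<open>f\<close> over a cell.\<close>

definition grid_projection :: "nat \<Rightarrow> (real \<Rightarrow> real) \<Rightarrow> real \<Rightarrow> real" where
  "grid_projection n f s = (\<Sum>i<n. real n * inner_L2 f (indicator (cell n i)) * indicator (cell n i) s)"

lemma inner_L2_sum_right:
  assumes "h \<in> L2 unit_interval" "\<And>i. i \<in> I \<Longrightarrow> u i \<in> L2 unit_interval"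
  shows "inner_L2 h (\<lambda>s. \<Sum>i\<in>I. c i * u i s) = (\<Sum>i\<in>I. c i * inner_L2 h (u i))"
proof -
  have "inner_L2 h (\<lambda>s. \<Sum>i\<in>I. c i * u i s) = (\<integral>s. (\<Sum>i\<in>I. c i * (h s * u i s)) \<partial>unit_interval)"
    unfolding inner_L2_def by (simp add: sum_distrib_left mult_ac)
  also have "\<dots> = (\<Sum>i\<in>I. \<integral>s. c i * (h s * u i s) \<partial>unit_interval)"
    using assms by (intro Bochner_Integration.integral_sum integrable_mult_right L2_integrable_mult) auto
  finally show ?thesis by (simp add: inner_L2_def)
qed

lemma cell_L2: "indicator (cell n i) \<in> L2 unit_interval"
  unfolding cell_def by (rule indicator_L2_unit_interval) simp

lemma inner_cell_cell:
  assumes "i < n" "j < n"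
  shows "inner_L2 (indicator (cell n i)) (indicator (cell n j)) = (if i = j then 1 / real n else 0)"
proof (cases "i = j")
  case True
  have "inner_L2 (indicator (cell n i)) (indicator (cell n i)) = (\<integral>s. indicator (cell n i) s \<partial>unit_interval)"
    unfolding inner_L2_def by (simp add: indicator_inter_arith[symmetric])
  also have "\<dots> = real (Suc i) / real n - real i / real n"
    unfolding cell_def using assms by (intro integral_unit_interval_Ioc) (simp_all add: field_simps)
  finally show ?thesis using True assms by (simp add: field_simps)
next
  case False
  have disj: "cell n i \<inter> cell n j = {}" if "i < j" for i j
  proof -
    have "real (Suc i) / real n \<le> real j / real n" using that assms by (intro divide_right_mono) auto
    then show ?thesis by (force simp: cell_def)
  qed
  have "cell n i \<inter> cell n j = {}" using disj[of i j] disj[of j i] False by (cases "i < j") auto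
  then have "indicator (cell n i) s * indicator (cell n j) s = (0::real)" for s
    by (auto simp: indicator_def)
  then have "inner_L2 (indicator (cell n i)) (indicator (cell n j)) = 0"
    unfolding inner_L2_def by (simp only: integral_zero)
  then show ?thesis using False by simp
qed

lemma sum_cells:
  assumes "k \<le> n" "0 < n"
  shows "(\<Sum>i<k. indicator (cell n i) s) = (indicator {0<..real k / real n} s :: real)"
  using assms(1)
proof (induction k)
  case (Suc k)
  have "indicator {0<..real k / real n} s + indicator (cell n k) s = (indicator {0<..real (Suc k) / real n} s :: real)"
  proof -
    have "0 \<le> real k / real n" "real k / real n \<le> real (Suc k) / real n"
      using assms(2) by (auto simp: divide_right_mono)
    then show ?thesis unfolding cell_def by (rule indicator_Ioc_add)
  qed
  then show ?case using Suc by simp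
qed simp

lemma grid_projection_L2: "grid_projection n f \<in> L2 unit_interval"
  unfolding grid_projection_def[abs_def] by (intro L2_sum L2_cmult cell_L2)

lemma inner_grid_projection_cell:
  assumes "j < n"
  shows "inner_L2 (grid_projection n f) (indicator (cell n j)) = inner_L2 f (indicator (cell n j))"
proof -
  have "inner_L2 (indicator (cell n j)) (grid_projection n f) =
      (\<Sum>i<n. real n * inner_L2 f (indicator (cell n i)) * inner_L2 (indicator (cell n j)) (indicator (cell n i)))"
    unfolding grid_projection_def[abs_def] by (rule inner_L2_sum_right) (rule cell_L2)+
  also have "\<dots> = (\<Sum>i<n. if i = j then inner_L2 f (indicator (cell n j)) else 0)"
    using assms by (intro sum.cong refl) (simp add: inner_cell_cell)
  finally show ?thesis using assms by (simp add: inner_L2_commute)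
qed

lemma inner_grid_projection_initial:
  assumes "f \<in> L2 unit_interval" "k \<le> n" "0 < n"
  shows "inner_L2 f (indicator {0<..real k / real n}) =
    inner_L2 (grid_projection n f) (indicator {0<..real k / real n})"
proof -
  have eq: "indicator {0<..real k / real n} = (\<lambda>s. \<Sum>i<k. 1 * indicator (cell n i) s :: real)"
    using sum_cells[OF assms(2,3)] by auto
  show ?thesis unfolding eq inner_L2_sum_right[OF assms(1) cell_L2] inner_L2_sum_right[OF grid_projection_L2 cell_L2]
    using assms(2) by (intro sum.cong refl) (simp add: inner_grid_projection_cell)
qed

lemma inner_grid_projection:
  assumes "f \<in> L2 unit_interval"
  shows "inner_L2 f (grid_projection n g) =
    (\<Sum>i<n. real n * inner_L2 g (indicator (cell n i)) * inner_L2 f (indicator (cell n i)))"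
  unfolding grid_projection_def[abs_def] by (rule inner_L2_sum_right[OF assms]) (rule cell_L2)

lemma inner_grid_projection_both:
  "inner_L2 (grid_projection n f) (grid_projection n g) =
    (\<Sum>i<n. real n * inner_L2 f (indicator (cell n i)) * inner_L2 g (indicator (cell n i)))"
  unfolding inner_grid_projection[OF grid_projection_L2]
  by (intro sum.cong refl) (simp add: inner_grid_projection_cell)

text \<open>\<open>W 0\<close> does not belong to the grid and vanishes only almost surely, so it is replaced by \<open>0\<close>.\<close>

lemma (in brownian_motion) grid_projection_elementary:
  assumes "0 < n"
  obtains X where "elementary (grid_projection n f) X"
    "X \<in> borel_measurable (generated_sigma M W ((\<lambda>i. real i / real n) ` {1..n}))"
proof -
  let ?T = "(\<lambda>i. real i / real n) ` {1..n}"
  define V where "V i = (if i = 0 then (\<lambda>_. 0) else W (real i / real n))" for i :: nat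
  have Vel: "elementary (indicator {0<..real i / real n}) (V i)" if "i \<le> n" for i
  proof (cases "i = 0")
    case True
    have "indicator {0<..real i / real n} = (\<lambda>s. 0 * indicator {0<..0} s :: real)" "V i = (\<lambda>\<omega>. 0 * W 0 \<omega>)"
      using True by (auto simp: V_def)
    then show ?thesis using elementary_cmult[OF elementary_indicator[of 0], of 0] by simp
  next
    case False
    then show ?thesis using elementary_indicator[of "real i / real n"] that assms by (simp add: V_def)
  qed
  have Vm: "V i \<in> borel_measurable (generated_sigma M W ?T)" if "i \<le> n" for i
  proof (cases "i = 0")
    case False
    then have "real i / real n \<in> ?T" using that by auto
    from measurable_generated_sigma[OF this] show ?thesis using False by (simp add: V_def)
  qed (simp add: V_def)
  let ?c = "\<lambda>i. real n * inner_L2 f (indicator (cell n i))"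
  define X where "X \<omega> = (\<Sum>i<n. ?c i * (V (Suc i) \<omega> + (-1) * V i \<omega>))" for \<omega>
  have "elementary (\<lambda>s. \<Sum>i<n. ?c i * (indicator {0<..real (Suc i) / real n} s + (-1) * indicator {0<..real i / real n} s)) X"
    unfolding X_def[abs_def] by (intro elementary_sum elementary_cmult elementary_add Vel) auto
  moreover have "(\<lambda>s. \<Sum>i<n. ?c i * (indicator {0<..real (Suc i) / real n} s + (-1) * indicator {0<..real i / real n} s))
      = grid_projection n f"
  proof -
    have "indicator {0<..real (Suc i) / real n} s + (-1) * indicator {0<..real i / real n} s = (indicator (cell n i) s :: real)"
      for i s
    proof -
      have "0 \<le> real i / real n" "real i / real n \<le> real (Suc i) / real n"
        using assms by (auto simp: divide_right_mono)
      from indicator_Ioc_add[OF this, of s] show ?thesis unfolding cell_def by simp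
    qed
    then show ?thesis unfolding grid_projection_def[abs_def] by (simp only:)
  qed
  moreover have "X \<in> borel_measurable (generated_sigma M W ?T)"
    unfolding X_def[abs_def]
    by (intro borel_measurable_sum borel_measurable_times borel_measurable_add borel_measurable_const Vm) auto
  ultimately show ?thesis using that by simp
qed

lemma (in brownian_motion) optimal_approx_error_sums:
  assumes "0 < n" and f: "f \<in> L2 unit_interval" and g: "g \<in> L2 unit_interval"
    and F: "L2_sums M (wick_term M W f a) F" and G: "L2_sums M (wick_term M W g b) G"
  shows "(\<lambda>k. fact k * a k * b k *
      (inner_L2 f g ^ k - inner_L2 (grid_projection n f) (grid_projection n g) ^ k)) sums
    expectation (\<lambda>\<omega>. (F \<omega> - optimal_approx M W n F \<omega>) * (G \<omega> - optimal_approx M W n G \<omega>))"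
proof -
  let ?T = "(\<lambda>i. real i / real n) ` {1..n}"
  obtain X where X: "elementary (grid_projection n f) X" "X \<in> borel_measurable (generated_sigma M W ?T)"
    by (rule grid_projection_elementary[OF assms(1)])
  obtain Y where Y: "elementary (grid_projection n g) Y" "Y \<in> borel_measurable (generated_sigma M W ?T)"
    by (rule grid_projection_elementary[OF assms(1)])
  have T: "?T \<subseteq> {0..1}" by auto
  have proj: "inner_L2 h (indicator {0<..t}) = inner_L2 (grid_projection n h) (indicator {0<..t})"
    if h: "h \<in> L2 unit_interval" and "t \<in> ?T" for h t
  proof -
    obtain k where "k \<le> n" "t = real k / real n" using \<open>t \<in> ?T\<close> by auto
    then show ?thesis using inner_grid_projection_initial[OF h \<open>k \<le> n\<close> assms(1)] by simp
  qed
  have 1: "inner_L2 f (grid_projection n g) = inner_L2 (grid_projection n f) (grid_projection n g)"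
    unfolding inner_grid_projection[OF f] inner_grid_projection_both by (simp add: mult_ac)
  have 2: "inner_L2 (grid_projection n f) g = inner_L2 (grid_projection n f) (grid_projection n g)"
    unfolding inner_L2_commute[of _ g] inner_grid_projection[OF g] inner_grid_projection_both by (simp add: mult_ac)
  show ?thesis unfolding optimal_approx_def
    by (rule approximation_error_sums[OF f g F G T elementary_wiener_pair[OF X(1)] X(2)
          elementary_wiener_pair[OF Y(1)] Y(2) proj[OF f] proj[OF g] 1 2])
qed

section \<open>Covariance of nearly affine functions on a short interval\<close>

lemma abs_integral_le_const:
  fixes u :: "real \<Rightarrow> real"
  assumes "a \<le> b" "continuous_on {a..b} u" "\<And>s. s \<in> {a..b} \<Longrightarrow> \<bar>u s\<bar> \<le> K"
  shows "\<bar>integral {a..b} u\<bar> \<le> K * (b - a)"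
  using integral_bound[of a b u K] assms by simp

text \<open>With \<open>m\<close> the midpoint, the affine parts contribute \<open>p * q * (b - a) ^ 3 / 12\<close> and every
  other term contains a remainder.\<close>

lemma covariance_affine_estimate:
  fixes f g :: "real \<Rightarrow> real"
  assumes ab: "a < b" and cf: "continuous_on {a..b} f" and cg: "continuous_on {a..b} g"
    and rf: "\<And>s. s \<in> {a..b} \<Longrightarrow> \<bar>f s - f a - p * (s - a)\<bar> \<le> d * (b - a)"
    and rg: "\<And>s. s \<in> {a..b} \<Longrightarrow> \<bar>g s - g a - q * (s - a)\<bar> \<le> e * (b - a)"
    and B: "\<bar>p\<bar> \<le> B" "\<bar>q\<bar> \<le> B"
  shows "\<bar>integral {a..b} (\<lambda>s. f s * g s) - integral {a..b} f * integral {a..b} g / (b - a) - p * q * (b - a) ^ 3 / 12\<bar>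
    \<le> (b - a) ^ 3 * (B * e + B * d + 2 * d * e)"
proof -
  define h where "h = b - a"
  have h: "h > 0" using ab by (simp add: h_def)
  define u where "u s = s - (a + b) / 2" for s
  define r where "r s = f s - f a - p * (s - a)" for s
  define \<rho> where "\<rho> s = g s - g a - q * (s - a)" for s
  \<comment> \<open>The value at the midpoint of the affine approximation. Centring there makes the
    linear term \<open>u\<close> integrate to zero.\<close>
  define \<alpha> where "\<alpha> = f a + p * h / 2"
  define \<beta> where "\<beta> = g a + q * h / 2"
  have f: "f s = \<alpha> + (p * u s + r s)" for s
    by (simp add: \<alpha>_def u_def r_def h_def field_simps)
  have g: "g s = \<beta> + (q * u s + \<rho> s)" for s
    by (simp add: \<beta>_def u_def \<rho>_def h_def field_simps)
  have cu: "continuous_on {a..b} u" unfolding u_def by (intro continuous_intros)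
  have cr: "continuous_on {a..b} r" unfolding r_def by (intro continuous_intros cf)
  have c\<rho>: "continuous_on {a..b} \<rho>" unfolding \<rho>_def by (intro continuous_intros cg)
  have int: "k integrable_on {a..b}" if "continuous_on {a..b} k" for k :: "real \<Rightarrow> real"
    using that by (rule integrable_continuous_interval)
  let ?I = "\<lambda>k. integral {a..b} (k :: real \<Rightarrow> real)"
  \<comment> \<open>At the left endpoint the remainder vanishes, so its bound is
    nonnegative.\<close>
  have d0: "0 \<le> d * h" using rf[of a] ab by (simp add: h_def)
  have e0: "0 \<le> e * h" using rg[of a] ab by (simp add: h_def)
  have I1: "?I (\<lambda>s. c) = c * h" for c using ab by (simp add: h_def)
  have "((\<lambda>s. s - (a + b) / 2) has_integral ((b - (a + b) / 2)\<^sup>2 / 2 - (a - (a + b) / 2)\<^sup>2 / 2)) {a..b}"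
    using ab by (intro fundamental_theorem_of_calculus)
      (auto intro!: derivative_eq_intros simp flip: has_real_derivative_iff_has_vector_derivative)
  then have "?I u = (b - (a + b) / 2)\<^sup>2 / 2 - (a - (a + b) / 2)\<^sup>2 / 2"
    unfolding u_def by (rule integral_unique)
  also have "\<dots> = 0" by (simp add: field_simps power2_eq_square)
  finally have Iu: "?I u = 0" .
  have "((\<lambda>s. (s - (a + b) / 2) * (s - (a + b) / 2)) has_integral ((b - (a + b) / 2) ^ 3 / 3 - (a - (a + b) / 2) ^ 3 / 3)) {a..b}"
    using ab by (intro fundamental_theorem_of_calculus)
      (auto intro!: derivative_eq_intros simp: power2_eq_square simp flip: has_real_derivative_iff_has_vector_derivative)
  then have "?I (\<lambda>s. u s * u s) = (b - (a + b) / 2) ^ 3 / 3 - (a - (a + b) / 2) ^ 3 / 3"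
    unfolding u_def by (rule integral_unique)
  also have "b - (a + b) / 2 = h / 2" by (simp add: h_def field_simps)
  also have "a - (a + b) / 2 = - (h / 2)" by (simp add: h_def field_simps)
  finally have Iuu: "?I (\<lambda>s. u s * u s) = h ^ 3 / 12" by (simp add: power3_eq_cube)
  define R where "R = ?I r"
  define R' where "R' = ?I \<rho>"
  define A1 where "A1 = ?I (\<lambda>s. u s * \<rho> s)"
  define A2 where "A2 = ?I (\<lambda>s. u s * r s)"
  define A3 where "A3 = ?I (\<lambda>s. r s * \<rho> s)"
  have If: "?I f = \<alpha> * h + R"
  proof -
    have "?I f = ?I (\<lambda>s. \<alpha> + (p * u s + r s))" by (simp add: f[symmetric])
    also have "\<dots> = ?I (\<lambda>s. \<alpha>) + (p * ?I u + ?I r)"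
      by (simp add: Henstock_Kurzweil_Integration.integral_add int cu cr continuous_intros)
    finally show ?thesis by (simp add: I1 Iu R_def h_def ab less_imp_le)
  qed
  have Ig: "?I g = \<beta> * h + R'"
  proof -
    have "?I g = ?I (\<lambda>s. \<beta> + (q * u s + \<rho> s))" by (simp add: g[symmetric])
    also have "\<dots> = ?I (\<lambda>s. \<beta>) + (q * ?I u + ?I \<rho>)"
      by (simp add: Henstock_Kurzweil_Integration.integral_add int cu c\<rho> continuous_intros)
    finally show ?thesis by (simp add: I1 Iu R'_def h_def ab less_imp_le)
  qed
  have Ifg: "?I (\<lambda>s. f s * g s) = \<alpha> * \<beta> * h + \<alpha> * R' + \<beta> * R + p * q * h ^ 3 / 12 + p * A1 + q * A2 + A3"
  proof -
    have "f s * g s = \<alpha> * \<beta> + (\<alpha> * q + \<beta> * p) * u s + \<alpha> * \<rho> s + \<beta> * r s + (p * q) * (u s * u s)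
        + p * (u s * \<rho> s) + q * (u s * r s) + r s * \<rho> s" for s
      unfolding f g by (simp add: algebra_simps)
    then have "?I (\<lambda>s. f s * g s) = ?I (\<lambda>s. \<alpha> * \<beta>) + (\<alpha> * q + \<beta> * p) * ?I u + \<alpha> * ?I \<rho> + \<beta> * ?I r
        + (p * q) * ?I (\<lambda>s. u s * u s) + p * ?I (\<lambda>s. u s * \<rho> s) + q * ?I (\<lambda>s. u s * r s) + ?I (\<lambda>s. r s * \<rho> s)"
      by (simp add: Henstock_Kurzweil_Integration.integral_add int cu cr c\<rho> continuous_intros)
    then show ?thesis by (simp add: Iu Iuu R_def R'_def A1_def A2_def A3_def h_def ab less_imp_le)
  qed
  have br: "\<bar>r s\<bar> \<le> d * h" "\<bar>\<rho> s\<bar> \<le> e * h" "\<bar>u s\<bar> \<le> h" if "s \<in> {a..b}" for s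
    using rf[OF that] rg[OF that] that ab by (auto simp: r_def \<rho>_def u_def h_def abs_le_iff field_simps)
  have bR: "\<bar>R\<bar> \<le> d * h * h" unfolding R_def h_def
    by (rule abs_integral_le_const) (use br cr ab in \<open>auto simp: h_def\<close>)
  have bR': "\<bar>R'\<bar> \<le> e * h * h" unfolding R'_def h_def
    by (rule abs_integral_le_const) (use br c\<rho> ab in \<open>auto simp: h_def\<close>)
  have bA1: "\<bar>A1\<bar> \<le> h * (e * h) * h" unfolding A1_def
    using abs_integral_le_const[of a b "\<lambda>s. u s * \<rho> s" "h * (e * h)"] br cu c\<rho> ab h
    by (simp add: h_def[symmetric] abs_mult mult_mono continuous_on_mult less_imp_le)
  have bA2: "\<bar>A2\<bar> \<le> h * (d * h) * h" unfolding A2_def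
    using abs_integral_le_const[of a b "\<lambda>s. u s * r s" "h * (d * h)"] br cu cr ab h
    by (simp add: h_def[symmetric] abs_mult mult_mono continuous_on_mult less_imp_le)
  have bA3: "\<bar>A3\<bar> \<le> d * h * (e * h) * h" unfolding A3_def
    using abs_integral_le_const[of a b "\<lambda>s. r s * \<rho> s" "d * h * (e * h)"] br c\<rho> cr ab d0
    by (simp add: h_def[symmetric] abs_mult mult_mono continuous_on_mult less_imp_le)
  have bRR: "\<bar>R * R' / h\<bar> \<le> h ^ 3 * (d * e)"
  proof -
    have "\<bar>R\<bar> * \<bar>R'\<bar> \<le> (d * h * h) * (e * h * h)"
      using bR bR' d0 h by (intro mult_mono) auto
    then have "\<bar>R\<bar> * \<bar>R'\<bar> / h \<le> (d * h * h) * (e * h * h) / h" using h by (intro divide_right_mono) auto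
    then show ?thesis using h by (simp add: abs_mult power3_eq_cube mult_ac)
  qed
  have bp: "\<bar>p * A1\<bar> \<le> h ^ 3 * (B * e)"
  proof -
    have "\<bar>p\<bar> * \<bar>A1\<bar> \<le> B * (h * (e * h) * h)" using bA1 B by (intro mult_mono) auto
    then show ?thesis by (simp add: abs_mult power3_eq_cube mult_ac)
  qed
  have bq: "\<bar>q * A2\<bar> \<le> h ^ 3 * (B * d)"
  proof -
    have "\<bar>q\<bar> * \<bar>A2\<bar> \<le> B * (h * (d * h) * h)" using bA2 B by (intro mult_mono) auto
    then show ?thesis by (simp add: abs_mult power3_eq_cube mult_ac)
  qed
  have b3: "\<bar>A3\<bar> \<le> h ^ 3 * (d * e)" using bA3 by (simp add: power3_eq_cube mult_ac)
  \<comment> \<open>All terms with \<open>\<alpha>\<close> or \<open>\<beta>\<close> cancel, as a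
    covariance ignores constants; the size of \<open>f\<close> and \<open>g\<close> does not enter
    the estimate.\<close>
  have "?I (\<lambda>s. f s * g s) - ?I f * ?I g / h - p * q * h ^ 3 / 12 = p * A1 + q * A2 + A3 - R * R' / h"
    unfolding Ifg If Ig using h by (simp add: field_simps)
  also have "\<bar>\<dots>\<bar> \<le> h ^ 3 * (B * e) + h ^ 3 * (B * d) + h ^ 3 * (d * e) + h ^ 3 * (d * e)"
  proof -
    have "\<bar>w + x + y - z\<bar> \<le> a + b + c + d"
      if "\<bar>w\<bar> \<le> a" "\<bar>x\<bar> \<le> b" "\<bar>y\<bar> \<le> c" "\<bar>z\<bar> \<le> d" for w x y z a b c d :: real
      using that by linarith
    from this[OF bp bq b3 bRR] show ?thesis .
  qed
  also have "\<dots> = h ^ 3 * (B * e + B * d + 2 * d * e)" by (simp add: algebra_simps)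
  finally show ?thesis by (simp add: h_def)
qed

section \<open>Oscillation of a function of bounded variation\<close>

lemma mono_on_atMost_Suc:
  fixes t :: "nat \<Rightarrow> real"
  assumes "\<And>j. j < N \<Longrightarrow> t j \<le> t (Suc j)"
  shows "mono_on {..N} t"
proof (rule mono_onI)
  fix i j assume "i \<in> {..N}" "j \<in> {..N}" "i \<le> j"
  from \<open>i \<le> j\<close> \<open>j \<in> {..N}\<close> show "t i \<le> t j"
  proof (induction j rule: dec_induct)
    case (step m)
    then show ?case using assms[of m] by simp
  qed simp
qed

text \<open>Inserting one point per cell into the grid gives an ordered sequence; each summand is
  one of its increments, and the remaining increments only enlarge the sum.\<close>

lemma bounded_variation_grid:
  fixes h :: "real \<Rightarrow> real"
  assumes "\<And>n t. mono_on {..n} t \<Longrightarrow> t ` {..n} \<subseteq> {0..1} \<Longrightarrow> (\<Sum>i<n. \<bar>h (t (Suc i)) - h (t i)\<bar>) \<le> B"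
    and \<xi>: "\<And>i. i < n \<Longrightarrow> \<xi> i \<in> {real i / real n..real (Suc i) / real n}"
  shows "(\<Sum>i<n. \<bar>h (\<xi> i) - h (real i / real n)\<bar>) \<le> B"
proof -
  \<comment> \<open>Even indices carry the grid points and odd indices the inserted points.\<close>
  define t where "t j = (if even j then real (j div 2) / real n else \<xi> (j div 2))" for j
  have t: "t (2 * i) = real i / real n" "t (Suc (2 * i)) = \<xi> i" "t (Suc (Suc (2 * i))) = real (Suc i) / real n" for i
    by (simp_all add: t_def)
  have "mono_on {..2 * n} t"
  proof (rule mono_on_atMost_Suc)
    fix j assume j: "j < 2 * n"
    show "t j \<le> t (Suc j)"
    proof (cases "even j")
      case True
      then obtain i where "j = 2 * i" by blast
      then show ?thesis using \<xi>[of i] j by (simp add: t)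
    next
      case False
      then obtain i where "j = Suc (2 * i)" using oddE by fastforce
      then show ?thesis using \<xi>[of i] j by (simp add: t)
    qed
  qed
  moreover have "t ` {..2 * n} \<subseteq> {0..1}"
  proof
    fix x assume "x \<in> t ` {..2 * n}"
    then obtain j where j: "j \<le> 2 * n" "x = t j" by auto
    show "x \<in> {0..1}"
    proof (cases "even j")
      case True
      then obtain i where i: "j = 2 * i" by blast
      then have "x = real i / real n" using j(2) t(1)[of i] by simp
      then show ?thesis using j(1) i by (cases "n = 0") auto
    next
      case False
      then obtain i where i: "j = Suc (2 * i)" using oddE by fastforce
      then have "i < n" using j by linarith
      then have "0 \<le> real i / real n" "real (Suc i) / real n \<le> 1" by auto
      moreover have "x = \<xi> i" using j(2) i t(2)[of i] by simp
      moreover have "real i / real n \<le> \<xi> i" "\<xi> i \<le> real (Suc i) / real n" using \<xi>[OF \<open>i < n\<close>] by simp_all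
      ultimately show ?thesis unfolding atLeastAtMost_iff by linarith
    qed
  qed
  ultimately have "(\<Sum>j<2 * n. \<bar>h (t (Suc j)) - h (t j)\<bar>) \<le> B" by (rule assms(1))
  moreover have "(\<Sum>j<2 * n. k j) = (\<Sum>i<n. k (2 * i) + k (Suc (2 * i)))" for k :: "nat \<Rightarrow> real"
    by (induction n) (simp_all add: algebra_simps)
  moreover have "(\<Sum>i<n. \<bar>h (\<xi> i) - h (real i / real n)\<bar>) \<le>
      (\<Sum>i<n. \<bar>h (t (Suc (2 * i))) - h (t (2 * i))\<bar> + \<bar>h (t (Suc (Suc (2 * i)))) - h (t (Suc (2 * i)))\<bar>)"
    by (intro sum_mono) (simp add: t)
  ultimately show ?thesis by simp
qed

lemma bounded_variation_imp_bounded: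
  assumes "bounded_variation_on_unit h"
  obtains K where "0 \<le> K" "\<And>s. s \<in> {0..1} \<Longrightarrow> \<bar>h s\<bar> \<le> K"
proof -
  obtain B where B: "\<And>n t. mono_on {..n} t \<Longrightarrow> t ` {..n} \<subseteq> {0..1} \<Longrightarrow> (\<Sum>i<n. \<bar>h (t (Suc i)) - h (t i)\<bar>) \<le> B"
    using assms unfolding bounded_variation_on_unit_def by blast
  \<comment> \<open>The whole interval taken as the only cell, with \<open>s\<close> as the inserted
    point.\<close>
  have b: "\<bar>h s - h 0\<bar> \<le> B" if "s \<in> {0..1}" for s
    using bounded_variation_grid[OF B, where n = 1 and \<xi> = "\<lambda>_. s"] that by simp
  have "\<bar>h s\<bar> \<le> \<bar>h 0\<bar> + B" if "s \<in> {0..1}" for s using b[OF that] by linarith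
  moreover have "0 \<le> \<bar>h 0\<bar> + B" using b[of 0] by simp
  ultimately show ?thesis using that by blast
qed

text \<open>Choosing in every cell a point that realises half of the oscillation turns the sum of the
  oscillations into a variation sum.\<close>

lemma bounded_variation_oscillation:
  assumes "bounded_variation_on_unit h"
  obtains C where "\<And>n. 0 < n \<Longrightarrow> \<exists>d. (\<forall>i<n. \<forall>s\<in>{real i / real n..real (Suc i) / real n}.
      \<bar>h s - h (real i / real n)\<bar> \<le> d i) \<and> (\<forall>i. 0 \<le> d i) \<and> (\<Sum>i<n. d i) \<le> C"
proof -
  obtain B where B: "\<And>n t. mono_on {..n} t \<Longrightarrow> t ` {..n} \<subseteq> {0..1} \<Longrightarrow> (\<Sum>i<n. \<bar>h (t (Suc i)) - h (t i)\<bar>) \<le> B"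
    using assms unfolding bounded_variation_on_unit_def by blast
  obtain K where K: "0 \<le> K" "\<And>s. s \<in> {0..1} \<Longrightarrow> \<bar>h s\<bar> \<le> K"
    using bounded_variation_imp_bounded[OF assms] by blast
  have "\<exists>d. (\<forall>i<n. \<forall>s\<in>{real i / real n..real (Suc i) / real n}.
      \<bar>h s - h (real i / real n)\<bar> \<le> d i) \<and> (\<forall>i. 0 \<le> d i) \<and> (\<Sum>i<n. d i) \<le> 2 * B" if n: "0 < n" for n
  proof -
    let ?J = "\<lambda>i. {real i / real n..real (Suc i) / real n}"
    let ?v = "\<lambda>i s. \<bar>h s - h (real i / real n)\<bar>"
    have J01: "?J i \<subseteq> {0..1}" if "i < n" for i
    proof -
      have "0 \<le> real i / real n" "real (Suc i) / real n \<le> 1" using that by auto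
      then show ?thesis by auto
    qed
    have left: "real i / real n \<in> ?J i" for i using n by (auto simp: divide_right_mono)
    have "\<exists>x. x \<in> ?J i \<and> (\<forall>s\<in>?J i. ?v i s \<le> 2 * ?v i x)" if i: "i < n" for i
    \<comment> \<open>The derivative is not known to attain its oscillation. Half of a supremum is
      exceeded somewhere only if the supremum is positive; if the oscillation is zero, the left
      endpoint serves.\<close>
    proof (cases "\<exists>s\<in>?J i. ?v i s > 0")
      case True
      then obtain s0 where s0: "s0 \<in> ?J i" "?v i s0 > 0" by blast
      have bdd: "bdd_above (?v i ` ?J i)"
      proof (rule bdd_aboveI2)
        fix s assume "s \<in> ?J i"
        then have "\<bar>h s\<bar> \<le> K" "\<bar>h (real i / real n)\<bar> \<le> K" using K(2) J01[OF i] left[of i] by blast+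
        then show "?v i s \<le> 2 * K" by linarith
      qed
      define S where "S = (SUP s\<in>?J i. ?v i s)"
      have "?v i s0 \<le> S" unfolding S_def by (rule cSUP_upper[OF s0(1) bdd])
      then have "S / 2 < S" using s0(2) by simp
      then obtain x where x: "x \<in> ?J i" "S / 2 < ?v i x"
        using less_cSUP_iff[OF _ bdd, of "S / 2"] s0(1) unfolding S_def by blast
      have "?v i s \<le> 2 * ?v i x" if "s \<in> ?J i" for s
        using cSUP_upper[OF that bdd] x(2) unfolding S_def by simp
      then show ?thesis using x(1) by blast
    next
      case False
      have "?v i s \<le> 2 * ?v i (real i / real n)" if "s \<in> ?J i" for s
      proof -
        have "?v i s \<le> 0" using False that by (meson not_le)
        then show ?thesis by simp
      qed
      then show ?thesis using left by blast
    qed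
    then obtain \<xi> where \<xi>: "\<And>i. i < n \<Longrightarrow> \<xi> i \<in> ?J i" "\<And>i s. i < n \<Longrightarrow> s \<in> ?J i \<Longrightarrow> ?v i s \<le> 2 * ?v i (\<xi> i)"
      by metis
    have "(\<Sum>i<n. ?v i (\<xi> i)) \<le> B" by (rule bounded_variation_grid[OF B \<xi>(1)])
    then have "(\<Sum>i<n. 2 * ?v i (\<xi> i)) \<le> 2 * B" by (simp flip: sum_distrib_left)
    then show ?thesis using \<xi>(2) by (intro exI[of _ "\<lambda>i. 2 * ?v i (\<xi> i)"]) auto
  qed
  then show ?thesis using that by blast
qed

section \<open>The grid error of the inner product\<close>

lemma has_BV_derivative_continuous: "has_BV_derivative f f' \<Longrightarrow> continuous_on {0..1} f"
  unfolding has_BV_derivative_def using DERIV_continuous_on by blast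

text \<open>The derivative is a pointwise limit of difference quotients. Clamping the argument
  extends \<open>f\<close> to a continuous function on the line, which makes every quotient
  Borel.\<close>

lemma borel_measurable_derivative:
  assumes "has_BV_derivative f f'"
  shows "f' \<in> borel_measurable unit_interval"
proof -
  define F where "F s = f (max 0 (min s 1))" for s
  have cont: "continuous_on UNIV F"
    unfolding F_def by (rule continuous_on_compose2[OF has_BV_derivative_continuous[OF assms]])
      (auto intro!: continuous_intros)
  have F[measurable]: "F \<in> borel_measurable borel" by (rule borel_measurable_continuous_onI[OF cont])
  \<comment> \<open>Right-hand quotients leave the unit interval at 1, so that point is cut out here
    and its value is added at the end.\<close>
  define D where "D n s = indicator {0..<1} s * ((F (s + 1 / real (Suc n)) - F s) / (1 / real (Suc n)))" for n s
  have D: "D n \<in> borel_measurable borel" for n unfolding D_def by measurable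
  have lim: "(\<lambda>n. D n s) \<longlonglongrightarrow> indicator {0..<1} s * f' s" for s
  proof (cases "s \<in> {0..<1}")
    case True
    have z: "(\<lambda>n. 1 / real (Suc n)) \<longlonglongrightarrow> 0"
      using LIMSEQ_inverse_real_of_nat by (simp add: inverse_eq_divide)
    have "(f has_real_derivative f' s) (at s within {0..1})"
      using assms True unfolding has_BV_derivative_def by auto
    then have der: "((\<lambda>y. (f y - f s) / (y - s)) \<longlongrightarrow> f' s) (at s within {0..1})"
      by (simp add: has_field_derivative_iff)
    have ev: "eventually (\<lambda>n. s + 1 / real (Suc n) \<le> 1) sequentially"
    proof -
      have "eventually (\<lambda>n. 1 / real (Suc n) < 1 - s) sequentially"
        using z True by (intro order_tendstoD(2)) auto
      then show ?thesis by eventually_elim simp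
    qed
    have "filterlim (\<lambda>n. s + 1 / real (Suc n)) (at s within {0..1}) sequentially"
      unfolding filterlim_at
    proof
      show "\<forall>\<^sub>F n in sequentially. s + 1 / real (Suc n) \<in> {0..1} \<and> s + 1 / real (Suc n) \<noteq> s"
        using ev True by (auto elim!: eventually_mono simp: add_nonneg_nonneg)
      show "(\<lambda>n. s + 1 / real (Suc n)) \<longlonglongrightarrow> s" using tendsto_add[OF tendsto_const z, of s] by simp
    qed
    from filterlim_compose[OF der this]
    have "(\<lambda>n. (f (s + 1 / real (Suc n)) - f s) / (1 / real (Suc n))) \<longlonglongrightarrow> f' s" by simp
    moreover have "\<forall>\<^sub>F n in sequentially. (f (s + 1 / real (Suc n)) - f s) / (1 / real (Suc n)) = D n s"
      using ev
    proof eventually_elim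
      case (elim n)
      have "0 \<le> s + 1 / real (Suc n)" using True by simp
      then have "F (s + 1 / real (Suc n)) = f (s + 1 / real (Suc n))" "F s = f s"
        using elim True by (simp_all add: F_def)
      then show ?case using True by (simp add: D_def)
    qed
    ultimately have "(\<lambda>n. D n s) \<longlonglongrightarrow> f' s" by (rule Lim_transform_eventually)
    then show ?thesis using True by simp
  qed (simp add: D_def)
  have "(\<lambda>s. indicator {0..<1} s * f' s) \<in> borel_measurable borel"
    by (rule borel_measurable_LIMSEQ_real[OF lim D])
  then have "(\<lambda>s. indicator {0..<1} s * f' s) \<in> borel_measurable unit_interval"
    by (rule borel_measurable_unit_interval)
  moreover have "(\<lambda>s. indicator {1} s * f' 1) \<in> borel_measurable unit_interval"
    by (rule borel_measurable_unit_interval) simp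
  ultimately have "(\<lambda>s. indicator {0..<1} s * f' s + indicator {1} s * f' 1) \<in> borel_measurable unit_interval"
    by (rule borel_measurable_add)
  then show ?thesis
    by (rule measurable_cong[THEN iffD1, rotated]) (auto simp: space_restrict_space indicator_def)
qed

lemma inner_L2_Ioc:
  assumes c: "continuous_on {0..1} f" and ab: "0 \<le> a" "a \<le> b" "b \<le> 1"
  shows "inner_L2 f (indicator {a<..b}) = integral {a..b} f"
proof -
  note f = continuous_L2_unit_interval[OF c]
  have "inner_L2 f (indicator {a<..b}) = integral {0..1} (\<lambda>s. f s * indicator {a<..b} s)"
    unfolding inner_L2_def
    by (rule lebesgue_integral_eq_integral[OF L2_integrable_mult[OF f indicator_L2_unit_interval]]) auto
  also have "\<dots> = integral {0..1} (\<lambda>s. if s \<in> {a..b} then f s else 0)"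
    by (rule integral_spike[of "{a}"]) (auto simp: indicator_def)
  also have "\<dots> = integral {a..b} f"
    using ab by (subst Henstock_Kurzweil_Integration.integral_restrict_Int) (simp add: Int_absorb1 max_def min_def)
  finally show ?thesis .
qed

lemma inner_L2_sum_cells:
  assumes "h \<in> L2 unit_interval" "0 < n"
  shows "(\<integral>s. h s \<partial>unit_interval) = (\<Sum>i<n. inner_L2 h (indicator (cell n i)))"
proof -
  have "AE s in unit_interval. s \<in> {0..1}"
    using AE_space[of unit_interval] by (simp add: space_restrict_space)
  with AE_unit_interval_neq[of 0] have "AE s in unit_interval. h s = h s * indicator {0<..1} s"
    by eventually_elim (auto simp: indicator_def)
  then have "(\<integral>s. h s \<partial>unit_interval) = inner_L2 h (indicator {0<..1})"
    unfolding inner_L2_def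
    by (rule integral_cong_AE[rotated 2])
      (use L2_measurable[OF assms(1)] L2_measurable[OF indicator_L2_unit_interval[of "{0<..1}"]] in simp_all)
  also have "indicator {0<..1} = (\<lambda>s. \<Sum>i<n. 1 * indicator (cell n i) s :: real)"
    using sum_cells[of n n] assms(2) by auto
  also have "inner_L2 h (\<lambda>s. \<Sum>i<n. 1 * indicator (cell n i) s) = (\<Sum>i<n. 1 * inner_L2 h (indicator (cell n i)))"
    by (rule inner_L2_sum_right[OF assms(1)]) (rule cell_L2)
  finally show ?thesis by simp
qed

lemma inner_cell_estimate:
  assumes h: "h \<in> L2 unit_interval" and i: "i < n" and K: "\<And>s. s \<in> cell n i \<Longrightarrow> \<bar>h s - c\<bar> \<le> K"
  shows "\<bar>inner_L2 h (indicator (cell n i)) - c / real n\<bar> \<le> K / real n"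
proof -
  note I = cell_L2[of n i]
  have one: "(\<integral>s. indicator (cell n i) s \<partial>unit_interval) = 1 / real n"
  proof -
    have "(\<integral>s. indicator (cell n i) s \<partial>unit_interval) = real (Suc i) / real n - real i / real n"
      unfolding cell_def using i by (intro integral_unit_interval_Ioc) (simp_all add: field_simps)
    then show ?thesis using i by (simp add: field_simps)
  qed
  have int: "integrable unit_interval (\<lambda>s. h s * indicator (cell n i) s)"
    "integrable unit_interval (\<lambda>s. indicator (cell n i) s :: real)"
    using L2_integrable_mult[OF h I] unit_interval.L2_integrable[OF I] by auto
  have "inner_L2 h (indicator (cell n i)) - c / real n = (\<integral>s. h s * indicator (cell n i) s - c * indicator (cell n i) s \<partial>unit_interval)"
    using int one by (simp add: inner_L2_def)
  also have "\<bar>\<dots>\<bar> \<le> (\<integral>s. \<bar>h s * indicator (cell n i) s - c * indicator (cell n i) s\<bar> \<partial>unit_interval)"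
    by (rule integral_abs_bound)
  also have "\<dots> \<le> (\<integral>s. K * indicator (cell n i) s \<partial>unit_interval)"
  proof (rule integral_mono)
    show "\<bar>h s * indicator (cell n i) s - c * indicator (cell n i) s\<bar> \<le> K * indicator (cell n i) s" for s
      using K[of s] by (cases "s \<in> cell n i") auto
  qed (use int in auto)
  also have "\<dots> = K / real n" using one by simp
  finally show ?thesis .
qed

text \<open>By the mean value theorem the increment of \<open>f\<close> is a value of
  \<open>f'\<close> times the step, so replacing that value by \<open>f' a\<close> costs at most the
  oscillation \<open>d\<close>.\<close>

lemma has_BV_derivative_remainder:
  assumes f: "has_BV_derivative f f'" and ab: "0 \<le> a" "b \<le> 1" and s: "s \<in> {a..b}"
    and d: "\<And>x. x \<in> {a..b} \<Longrightarrow> \<bar>f' x - f' a\<bar> \<le> d"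
  shows "\<bar>f s - f a - f' a * (s - a)\<bar> \<le> d * (b - a)"
proof -
  have "(f has_derivative (\<lambda>h. f' x * h)) (at x within {a..s})" if "a \<le> x" "x \<le> s" for x
  proof -
    have "(f has_real_derivative f' x) (at x within {0..1})"
      using f ab s that unfolding has_BV_derivative_def by auto
    then have "(f has_real_derivative f' x) (at x within {a..s})"
      by (rule has_field_derivative_subset) (use ab s in auto)
    then show ?thesis by (simp add: has_field_derivative_def)
  qed
  then obtain x where x: "x \<in> {a..s}" "f s - f a = f' x * (s - a)"
    using mvt_very_simple[of a s f "\<lambda>x h. f' x * h"] s by auto
  have "\<bar>f s - f a - f' a * (s - a)\<bar> = \<bar>f' x - f' a\<bar> * \<bar>s - a\<bar>"
    unfolding x(2) by (simp add: left_diff_distrib flip: abs_mult)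
  also have "\<dots> \<le> d * (b - a)"
    using d[of x] x s by (intro mult_mono) auto
  finally show ?thesis .
qed

text \<open>Both the scaled covariance on a cell and the integral of \<open>f' s * g' s\<close> over
  it are compared with the product of the derivatives at the left endpoint. Each comparison costs
  oscillations of the derivatives divided by n, and these add up over the cells.\<close>

lemma grid_projection_error:
  assumes f: "has_BV_derivative f f'" and g: "has_BV_derivative g g'"
  shows "(\<lambda>n. (real n)\<^sup>2 * (inner_L2 f g - inner_L2 (grid_projection n f) (grid_projection n g)))
    \<longlonglongrightarrow> 1 / 12 * inner_L2 f' g'"
proof -
  have BV: "bounded_variation_on_unit f'" "bounded_variation_on_unit g'"
    and fL: "f \<in> L2 unit_interval" and gL: "g \<in> L2 unit_interval"
    using f g by (auto simp: has_BV_derivative_def)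
  have cf: "continuous_on {0..1} f" and cg: "continuous_on {0..1} g"
    using f g by (auto intro: has_BV_derivative_continuous)
  obtain Kf where Kf: "0 \<le> Kf" "\<And>s. s \<in> {0..1} \<Longrightarrow> \<bar>f' s\<bar> \<le> Kf"
    using bounded_variation_imp_bounded[OF BV(1)] by blast
  obtain Kg where Kg: "0 \<le> Kg" "\<And>s. s \<in> {0..1} \<Longrightarrow> \<bar>g' s\<bar> \<le> Kg"
    using bounded_variation_imp_bounded[OF BV(2)] by blast
  define B where "B = max Kf Kg"
  have B: "0 \<le> B" "\<And>s. s \<in> {0..1} \<Longrightarrow> \<bar>f' s\<bar> \<le> B" "\<And>s. s \<in> {0..1} \<Longrightarrow> \<bar>g' s\<bar> \<le> B"
    using Kf Kg unfolding B_def by (auto simp: le_max_iff_disj)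
  obtain Cf where Cf: "\<And>n. 0 < n \<Longrightarrow> \<exists>d. (\<forall>i<n. \<forall>s\<in>{real i / real n..real (Suc i) / real n}.
      \<bar>f' s - f' (real i / real n)\<bar> \<le> d i) \<and> (\<forall>i. 0 \<le> d i) \<and> (\<Sum>i<n. d i) \<le> Cf"
    using bounded_variation_oscillation[OF BV(1)] by blast
  obtain Cg where Cg: "\<And>n. 0 < n \<Longrightarrow> \<exists>d. (\<forall>i<n. \<forall>s\<in>{real i / real n..real (Suc i) / real n}.
      \<bar>g' s - g' (real i / real n)\<bar> \<le> d i) \<and> (\<forall>i. 0 \<le> d i) \<and> (\<Sum>i<n. d i) \<le> Cg"
    using bounded_variation_oscillation[OF BV(2)] by blast
  have fg'L: "(\<lambda>s. f' s * g' s) \<in> L2 unit_interval"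
  proof (rule bounded_L2_unit_interval)
    show "(\<lambda>s. f' s * g' s) \<in> borel_measurable unit_interval"
      by (intro borel_measurable_times borel_measurable_derivative[OF f] borel_measurable_derivative[OF g])
    show "\<bar>f' s * g' s\<bar> \<le> B * B" if "s \<in> {0..1}" for s
      using B that unfolding abs_mult by (intro mult_mono) auto
  qed
  have cfg: "continuous_on {0..1} (\<lambda>s. f s * g s)" by (intro continuous_intros cf cg)
  \<comment> \<open>Obtained by summing the cellwise bounds: the oscillations of \<open>f'\<close>
    sum to at most \<open>Cf\<close>, those of \<open>g'\<close> to at most \<open>Cg\<close>. A
    product \<open>d i * e i\<close> is first reduced to \<open>Cg * d i\<close>.\<close>
  define D where "D = 2 * B * Cg + 2 * B * Cf + 2 * Cf * Cg"
  have bound: "\<bar>(real n)\<^sup>2 * (inner_L2 f g - inner_L2 (grid_projection n f) (grid_projection n g)) - 1 / 12 * inner_L2 f' g'\<bar>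
      \<le> D * (1 / real n)" if n: "0 < n" for n
  proof -
    let ?a = "\<lambda>i. real i / real n" and ?b = "\<lambda>i. real (Suc i) / real n"
    obtain d where d: "\<And>i s. i < n \<Longrightarrow> s \<in> {?a i..?b i} \<Longrightarrow> \<bar>f' s - f' (?a i)\<bar> \<le> d i"
        "\<And>i. 0 \<le> d i" "(\<Sum>i<n. d i) \<le> Cf" using Cf[OF n] by blast
    obtain e where e: "\<And>i s. i < n \<Longrightarrow> s \<in> {?a i..?b i} \<Longrightarrow> \<bar>g' s - g' (?a i)\<bar> \<le> e i"
        "\<And>i. 0 \<le> e i" "(\<Sum>i<n. e i) \<le> Cg" using Cg[OF n] by blast
    define cov where "cov i = integral {?a i..?b i} (\<lambda>s. f s * g s) -
      real n * integral {?a i..?b i} f * integral {?a i..?b i} g" for i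
    define J where "J i = inner_L2 (\<lambda>s. f' s * g' s) (indicator (cell n i))" for i
    have ab: "0 \<le> ?a i" "?a i < ?b i" "?b i \<le> 1" "?b i - ?a i = 1 / real n" if "i < n" for i
      using that n by (auto simp: divide_strict_right_mono diff_divide_distrib[symmetric])
    have sub: "{?a i..?b i} \<subseteq> {0..1}" if "i < n" for i using ab[OF that] by auto
    have cellI: "inner_L2 h (indicator (cell n i)) = integral {?a i..?b i} h"
      if "continuous_on {0..1} h" "i < n" for h i
      unfolding cell_def using ab[OF that(2)]
      by (intro inner_L2_Ioc[OF that(1)]) auto
    have "inner_L2 f g = (\<integral>s. f s * g s \<partial>unit_interval)" by (simp add: inner_L2_def)
    also have "\<dots> = (\<Sum>i<n. integral {?a i..?b i} (\<lambda>s. f s * g s))"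
      using inner_L2_sum_cells[OF continuous_L2_unit_interval[OF cfg] n] cellI[OF cfg] by simp
    finally have "inner_L2 f g - inner_L2 (grid_projection n f) (grid_projection n g) = (\<Sum>i<n. cov i)"
      unfolding inner_grid_projection_both cov_def sum_subtractf using cellI[OF cf] cellI[OF cg] by simp
    moreover have "inner_L2 f' g' = (\<Sum>i<n. J i)"
      using inner_L2_sum_cells[OF fg'L n] by (simp add: inner_L2_def J_def)
    ultimately have eq: "(real n)\<^sup>2 * (inner_L2 f g - inner_L2 (grid_projection n f) (grid_projection n g)) - 1 / 12 * inner_L2 f' g'
        = (\<Sum>i<n. (real n)\<^sup>2 * cov i - 1 / 12 * J i)"
      by (simp add: sum_subtractf sum_distrib_left)
    have cellwise: "\<bar>(real n)\<^sup>2 * cov i - 1 / 12 * J i\<bar> \<le> (2 * B * e i + 2 * B * d i + 2 * Cg * d i) * (1 / real n)"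
      if i: "i < n" for i
    proof -
      let ?h = "1 / real n"
      \<comment> \<open>The common reference value for the covariance and for the integral of the
        derivatives.\<close>
      define c where "c = f' (?a i) * g' (?a i)"
      have a01: "?a i \<in> {0..1}" using ab[OF i] by simp
      have "\<bar>integral {?a i..?b i} (\<lambda>s. f s * g s) - integral {?a i..?b i} f * integral {?a i..?b i} g / (?b i - ?a i)
          - f' (?a i) * g' (?a i) * (?b i - ?a i) ^ 3 / 12\<bar> \<le> (?b i - ?a i) ^ 3 * (B * e i + B * d i + 2 * d i * e i)"
      proof (rule covariance_affine_estimate)
        show "?a i < ?b i" by (rule ab(2)[OF i])
        show "continuous_on {?a i..?b i} f" "continuous_on {?a i..?b i} g"
          using cf cg sub[OF i] continuous_on_subset by blast+
        show "\<bar>f s - f (?a i) - f' (?a i) * (s - ?a i)\<bar> \<le> d i * (?b i - ?a i)" if "s \<in> {?a i..?b i}" for s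
          by (rule has_BV_derivative_remainder[OF f ab(1)[OF i] ab(3)[OF i] that d(1)[OF i]])
        show "\<bar>g s - g (?a i) - g' (?a i) * (s - ?a i)\<bar> \<le> e i * (?b i - ?a i)" if "s \<in> {?a i..?b i}" for s
          by (rule has_BV_derivative_remainder[OF g ab(1)[OF i] ab(3)[OF i] that e(1)[OF i]])
        show "\<bar>f' (?a i)\<bar> \<le> B" "\<bar>g' (?a i)\<bar> \<le> B" using B(2,3)[OF a01] by auto
      qed
      then have "\<bar>cov i - c * ?h ^ 3 / 12\<bar> \<le> ?h ^ 3 * (B * e i + B * d i + 2 * d i * e i)"
        unfolding ab(4)[OF i] cov_def c_def by (simp add: mult_ac)
      then have "(real n)\<^sup>2 * \<bar>cov i - c * ?h ^ 3 / 12\<bar> \<le> (real n)\<^sup>2 * (?h ^ 3 * (B * e i + B * d i + 2 * d i * e i))"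
        by (rule mult_left_mono) simp
      moreover have "(real n)\<^sup>2 * \<bar>cov i - c * ?h ^ 3 / 12\<bar> = \<bar>(real n)\<^sup>2 * cov i - c * ?h / 12\<bar>"
      proof -
        have "(real n)\<^sup>2 * \<bar>cov i - c * ?h ^ 3 / 12\<bar> = \<bar>(real n)\<^sup>2 * (cov i - c * ?h ^ 3 / 12)\<bar>"
          by (simp add: abs_mult)
        also have "(real n)\<^sup>2 * (cov i - c * ?h ^ 3 / 12) = (real n)\<^sup>2 * cov i - c * ?h / 12"
          using n by (simp add: field_simps power2_eq_square power3_eq_cube)
        finally show ?thesis .
      qed
      moreover have "(real n)\<^sup>2 * (?h ^ 3 * (B * e i + B * d i + 2 * d i * e i)) = (B * e i + B * d i + 2 * d i * e i) * ?h"
        using n by (simp add: field_simps power2_eq_square power3_eq_cube)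
      ultimately have 1: "\<bar>(real n)\<^sup>2 * cov i - c * ?h / 12\<bar> \<le> (B * e i + B * d i + 2 * d i * e i) * ?h" by simp
      have J: "\<bar>J i - c / real n\<bar> \<le> (B * e i + B * d i) / real n"
        unfolding J_def
      proof (rule inner_cell_estimate[OF fg'L i])
        fix s assume "s \<in> cell n i"
        then have s: "s \<in> {?a i..?b i}" by (simp add: cell_def)
        then have s01: "s \<in> {0..1}" using sub[OF i] by blast
        have "f' s * g' s - c = f' s * (g' s - g' (?a i)) + (f' s - f' (?a i)) * g' (?a i)"
          by (simp add: c_def algebra_simps)
        also have "\<bar>\<dots>\<bar> \<le> \<bar>f' s\<bar> * \<bar>g' s - g' (?a i)\<bar> + \<bar>f' s - f' (?a i)\<bar> * \<bar>g' (?a i)\<bar>"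
          by (rule order_trans[OF abs_triangle_ineq]) (simp add: abs_mult)
        also have "\<dots> \<le> B * e i + d i * B"
          using B(1) B(2)[OF s01] B(3)[OF a01] d(1)[OF i s] e(1)[OF i s] d(2)[of i]
          by (intro add_mono mult_mono) auto
        finally show "\<bar>f' s * g' s - c\<bar> \<le> B * e i + B * d i" by (simp add: mult.commute)
      qed
      \<comment> \<open>The factor 1/12 in the bound is given away, which keeps the two error bounds
        easy to add.\<close>
      have 2: "\<bar>1 / 12 * J i - c * ?h / 12\<bar> \<le> (B * e i + B * d i) * ?h"
      proof -
        have "\<bar>1 / 12 * u - w / 12\<bar> \<le> r" if "\<bar>u - w\<bar> \<le> r" for u w r :: real
          using that by linarith
        then show ?thesis using J by simp
      qed
      have "e i \<le> (\<Sum>i<n. e i)" using i e(2) by (intro member_le_sum) auto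
      then have "2 * d i * e i \<le> 2 * Cg * d i"
        using e(3) d(2)[of i] mult_left_mono[of "e i" Cg "2 * d i"] by (simp add: mult_ac)
      then have 3: "(B * e i + B * d i + 2 * d i * e i) * ?h \<le> (B * e i + B * d i + 2 * Cg * d i) * ?h"
        by (intro mult_right_mono) auto
      have 4: "(2 * B * e i + 2 * B * d i + 2 * Cg * d i) * ?h =
          (B * e i + B * d i + 2 * Cg * d i) * ?h + (B * e i + B * d i) * ?h" by (simp add: algebra_simps)
      have "\<bar>u - v\<bar> \<le> z" if "\<bar>u - w\<bar> \<le> r" "\<bar>v - w\<bar> \<le> r'" "r \<le> r''" "z = r'' + r'"
        for u v w r r' r'' z :: real using that by linarith
      from this[OF 1 2 3 4] show ?thesis .
    qed
    have "\<bar>\<Sum>i<n. (real n)\<^sup>2 * cov i - 1 / 12 * J i\<bar> \<le>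
        (\<Sum>i<n. (2 * B * e i + 2 * B * d i + 2 * Cg * d i) * (1 / real n))"
      by (rule order_trans[OF sum_abs]) (use cellwise in \<open>auto intro: sum_mono\<close>)
    also have "\<dots> = (2 * B * (\<Sum>i<n. e i) + 2 * B * (\<Sum>i<n. d i) + 2 * Cg * (\<Sum>i<n. d i)) * (1 / real n)"
      by (simp only: sum_distrib_right[symmetric] sum.distrib sum_distrib_left)
    also have "\<dots> \<le> D * (1 / real n)"
    proof (rule mult_right_mono)
      have "0 \<le> (\<Sum>i<n. e i)" by (rule sum_nonneg) (rule e(2))
      then have "0 \<le> Cg" using e(3) by linarith
      then have "2 * Cg * (\<Sum>i<n. d i) \<le> 2 * Cg * Cf" using d(3) by (intro mult_left_mono) auto
      moreover have "2 * B * (\<Sum>i<n. e i) \<le> 2 * B * Cg" using e(3) B(1) by (intro mult_left_mono) auto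
      moreover have "2 * B * (\<Sum>i<n. d i) \<le> 2 * B * Cf" using d(3) B(1) by (intro mult_left_mono) auto
      ultimately show "2 * B * (\<Sum>i<n. e i) + 2 * B * (\<Sum>i<n. d i) + 2 * Cg * (\<Sum>i<n. d i) \<le> D"
        unfolding D_def by (simp add: mult_ac)
    qed simp
    finally show ?thesis unfolding eq .
  qed
  have lim: "(\<lambda>n. D * (1 / real n)) \<longlonglongrightarrow> 0"
    by (rule tendsto_mult_right_zero[OF lim_1_over_n])
  have ev: "\<forall>\<^sub>F n in sequentially. norm ((real n)\<^sup>2 * (inner_L2 f g - inner_L2 (grid_projection n f) (grid_projection n g))
      - 1 / 12 * inner_L2 f' g') \<le> D * (1 / real n)"
    using eventually_gt_at_top[of 0] by eventually_elim (use bound in simp)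
  show ?thesis
    by (rule LIM_zero_cancel[OF Lim_null_comparison[OF ev lim]])
qed

section \<open>The limit of the approximation error\<close>

text \<open>The factor \<open>real (k + 1)\<close> cancels against \<open>fact (k + 1)\<close>, so
  the shifted coefficients obey the same kind of bound with \<open>K * C\<close> in place of
  \<open>K\<close>. The squared norms of the terms are then dominated by an exponential
  series.\<close>

lemma (in brownian_motion) wick_derivative_sums:
  assumes f: "f \<in> L2 unit_interval" and a: "\<And>k. \<bar>a k\<bar> \<le> K * C ^ k / fact k"
  shows "L2_sums M (wick_term M W f (\<lambda>k. real (k + 1) * a (k + 1))) (wick_derivative M W f a)"
proof -
  let ?v = "inner_L2 f f" and ?a = "\<lambda>k. real (k + 1) * a (k + 1)"
  have v: "0 \<le> ?v" by (simp add: inner_L2_def)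
  have "\<bar>?a k\<bar> \<le> K * C * C ^ k / fact k" for k
  proof -
    have "real (k + 1) * \<bar>a (k + 1)\<bar> \<le> real (k + 1) * (K * C ^ (k + 1) / fact (k + 1))"
      by (intro mult_left_mono a) simp
    also have "\<dots> = K * C * C ^ k / fact k"
    proof -
      have "m * (u / (m * w)) = u / w" if "m \<noteq> 0" for m u w :: real using that by simp
      from this[of "real (k + 1)" "K * C ^ (k + 1)" "fact k"] show ?thesis by (simp add: mult_ac)
    qed
    finally show ?thesis by (simp add: abs_mult)
  qed
  then have sq: "(?a k)\<^sup>2 \<le> (K * C * C ^ k / fact k)\<^sup>2" for k
    by (metis abs_le_square_iff abs_ge_self order_trans)
  have "summable (\<lambda>k. fact k * (?a k)\<^sup>2 * ?v ^ k)"
  proof (rule summable_comparison_test')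
    show "summable (\<lambda>k. (K * C)\<^sup>2 * ((C\<^sup>2 * ?v) ^ k /\<^sub>R fact k))"
      by (intro summable_mult summable_exp_generic)
    show "norm (fact k * (?a k)\<^sup>2 * ?v ^ k) \<le> (K * C)\<^sup>2 * ((C\<^sup>2 * ?v) ^ k /\<^sub>R fact k)" if "k \<ge> 0" for k
    proof -
      have "fact k * (?a k)\<^sup>2 * ?v ^ k \<le> fact k * (K * C * C ^ k / fact k)\<^sup>2 * ?v ^ k"
        using v by (intro mult_right_mono mult_left_mono sq) auto
      also have "\<dots> = (K * C)\<^sup>2 * ((C\<^sup>2 * ?v) ^ k /\<^sub>R fact k)"
        by (simp add: power_mult_distrib power2_eq_square field_simps)
      finally show ?thesis using v by simp
    qed
  qed
  from wick_series_exists[OF f this] show ?thesis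
    unfolding wick_derivative_def by (rule someI_ex)
qed

theorem theorem11:
  fixes M :: "'a measure"
    and W :: "real \<Rightarrow> 'a \<Rightarrow> real"
    and f f' g g' :: "real \<Rightarrow> real"
    and a b :: "nat \<Rightarrow> real"
    and F G :: "'a \<Rightarrow> real"
  assumes "brownian_motion M W"
    and "has_BV_derivative f f'"
    and "has_BV_derivative g g'"
    and "wick_analytic M W f a F"
    and "wick_analytic M W g b G"
  shows "(\<lambda>n. (real n)\<^sup>2 *
            (\<integral>\<omega>. (F \<omega> - optimal_approx M W n F \<omega>) * (G \<omega> - optimal_approx M W n G \<omega>) \<partial>M))
          \<longlonglongrightarrow> 1 / 12 * inner_L2 f' g' *
            (\<integral>\<omega>. wick_derivative M W f a \<omega> * wick_derivative M W g b \<omega> \<partial>M)"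
proof -
  interpret brownian_motion M W by (rule assms(1))
  have f: "f \<in> L2 unit_interval" and g: "g \<in> L2 unit_interval"
    using assms(2,3) by (auto simp: has_BV_derivative_def)
  have F: "L2_sums M (wick_term M W f a) F" and G: "L2_sums M (wick_term M W g b) G"
    using assms(4,5) by (auto simp: wick_analytic_def)
  obtain K C where a: "0 \<le> K" "0 \<le> C" "\<And>k. \<bar>a k\<bar> \<le> K * C ^ k / fact k"
    using wick_analytic_coeff_bound[OF assms(4)] by blast
  obtain K' C' where b: "0 \<le> K'" "0 \<le> C'" "\<And>k. \<bar>b k\<bar> \<le> K' * C' ^ k / fact k"
    using wick_analytic_coeff_bound[OF assms(5)] by blast
  let ?E = "\<lambda>n. \<integral>\<omega>. (F \<omega> - optimal_approx M W n F \<omega>) * (G \<omega> - optimal_approx M W n G \<omega>) \<partial>M"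
  define c where "c k = fact k * a k * b k" for k
  define x where "x = inner_L2 f g"
  define y where "y n = inner_L2 (grid_projection n f) (grid_projection n g)" for n
  define p where "p z = (\<Sum>k. c k * z ^ k)" for z
  have sm: "summable (\<lambda>k. c k * z ^ k)" for z
  proof (rule summable_comparison_test')
    show "summable (\<lambda>k. K * K' * ((C * C' * \<bar>z\<bar>) ^ k /\<^sub>R fact k))"
      by (intro summable_mult summable_exp_generic)
    show "norm (c k * z ^ k) \<le> K * K' * ((C * C' * \<bar>z\<bar>) ^ k /\<^sub>R fact k)" if "k \<ge> 0" for k
    proof -
      have "\<bar>a k\<bar> * \<bar>b k\<bar> \<le> (K * C ^ k / fact k) * (K' * C' ^ k / fact k)"
        using a b by (intro mult_mono) auto
      then have "fact k * (\<bar>a k\<bar> * \<bar>b k\<bar>) * \<bar>z\<bar> ^ k \<le>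
          fact k * ((K * C ^ k / fact k) * (K' * C' ^ k / fact k)) * \<bar>z\<bar> ^ k"
        by (intro mult_right_mono mult_left_mono) auto
      also have "\<dots> = K * K' * ((C * C' * \<bar>z\<bar>) ^ k /\<^sub>R fact k)"
        by (simp add: power_mult_distrib field_simps)
      finally show ?thesis by (simp add: c_def abs_mult power_abs mult.assoc)
    qed
  qed
  have "(p has_field_derivative (\<Sum>k. diffs c k * x ^ k)) (at x)"
    unfolding p_def[abs_def] by (rule termdiffs_strong_converges_everywhere[OF sm])
  moreover have "(\<Sum>k. diffs c k * x ^ k) =
      (\<integral>\<omega>. wick_derivative M W f a \<omega> * wick_derivative M W g b \<omega> \<partial>M)"
  proof -
    \<comment> \<open>The extra factor \<open>k + 1\<close> from differentiation and the one in
      \<open>fact (k + 1)\<close> are distributed over the two coefficient sequences; what remains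
      is the inner product series of the two Wick derivatives.\<close>
    have "diffs c k = fact k * (real (k + 1) * a (k + 1)) * (real (k + 1) * b (k + 1))" for k
      by (simp add: diffs_def c_def algebra_simps)
    then show ?thesis
      using wick_series_inner_sums[OF f g wick_derivative_sums[OF f a(3)] wick_derivative_sums[OF g b(3)]]
      by (simp add: x_def sums_iff)
  qed
  \<comment> \<open>Caratheodory's form of the derivative: an exact factorisation, valid also for
    those \<open>n\<close> with \<open>y n = x\<close>, where a difference quotient would
    fail.\<close>
  ultimately obtain q where q: "\<And>z. p z - p x = q z * (z - x)" "isCont q x"
      "q x = (\<integral>\<omega>. wick_derivative M W f a \<omega> * wick_derivative M W g b \<omega> \<partial>M)"
    by (auto simp: CARAT_DERIV)
  have lim: "(\<lambda>n. (real n)\<^sup>2 * (x - y n)) \<longlonglongrightarrow> 1 / 12 * inner_L2 f' g'"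
    unfolding x_def y_def by (rule grid_projection_error[OF assms(2,3)])
  \<comment> \<open>Convergence of \<open>y n\<close> to \<open>x\<close> is extracted from the
    quadratic rate by dividing it out again.\<close>
  have "(\<lambda>n. (real n)\<^sup>2 * (x - y n) * (1 / real n * (1 / real n))) \<longlonglongrightarrow> 1 / 12 * inner_L2 f' g' * (0 * 0)"
    by (intro tendsto_mult lim lim_1_over_n)
  moreover have "\<forall>\<^sub>F n in sequentially. (real n)\<^sup>2 * (x - y n) * (1 / real n * (1 / real n)) = x - y n"
    using eventually_gt_at_top[of 0] by eventually_elim (simp add: power2_eq_square)
  ultimately have "(\<lambda>n. x - y n) \<longlonglongrightarrow> 0" by (simp add: Lim_transform_eventually)
  then have "y \<longlonglongrightarrow> x" using tendsto_diff[OF tendsto_const[of x], of "\<lambda>n. x - y n" 0] by simp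
  then have "(\<lambda>n. q (y n)) \<longlonglongrightarrow> q x" by (rule isCont_tendsto_compose[OF q(2)])
  from tendsto_mult[OF lim this]
  have "(\<lambda>n. (real n)\<^sup>2 * (x - y n) * q (y n)) \<longlonglongrightarrow> 1 / 12 * inner_L2 f' g' * q x" .
  moreover have "\<forall>\<^sub>F n in sequentially. (real n)\<^sup>2 * (x - y n) * q (y n) = (real n)\<^sup>2 * ?E n"
    using eventually_gt_at_top[of 0]
  proof eventually_elim
    case (elim n)
    have "(\<lambda>k. c k * x ^ k - c k * y n ^ k) sums ?E n"
      using optimal_approx_error_sums[OF elim f g F G] by (simp add: c_def x_def y_def right_diff_distrib)
    moreover have "(\<lambda>k. c k * x ^ k - c k * y n ^ k) sums (p x - p (y n))"
      unfolding p_def by (intro sums_diff summable_sums sm)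
    ultimately have "?E n = p x - p (y n)" by (rule sums_unique2)
    also have "\<dots> = (x - y n) * q (y n)" using q(1)[of "y n"] by (simp add: algebra_simps)
    finally show ?case by simp
  qed
  ultimately show ?thesis unfolding q(3) by (rule Lim_transform_eventually)
qed

end
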